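(* Let $\alpha$ be a continuous rotationally symmetric norm, let $n\ge1$, and let $\mathcal{M}$ be a closed subspace of $H^{\alpha}$ invariant under the operator $T_{z^n}$ of multiplication by $z^n$. Then there exist $n$-inner functions $J_1,\ldots,J_r$ ($r\le n$) such that \[\mathcal{M}=J_1M_{\alpha}(z^n)\oplus\cdots\oplus J_rM_{\alpha}(z^n),\] where $\oplus$ denotes a direct sum.
   Context: $\mathbb T$ is the unit circle with normalized Lebesgue measure $m$; $H^p$ are the classical Hardy spaces on $\mathbb T$. A norm $\alpha$ on $L^\infty$ is rotationally symmetric if $\alpha(1)=1$, $\alpha(|f|)=\alpha(f)$, and $\alpha(f_w)=\alpha(f)$ for all $f\in L^\infty$ and $w\in\mathbb T$, where $f_w(z)=f(\overline w z)$; it is continuous if $\alpha(\chi_E)\to0$ as $m(E)\to0^+$. It is extended to measurable $f$ by $\alpha(f)=\sup\{\alpha(s): s\text{ simple},0\le s\le|f|\}$. $H^\alpha$ is the $\alpha$-closure of $H^\infty$. $H^\infty(z^n)=\{f(z^n): f\in H^\infty\}$ and $M_\alpha(z^n)$ is the $\alpha$-closure of $H^\infty(z^n)$. A function $\varphi\in H^\infty$ is $n$-inner if $\{z^{nm}\varphi: m=0,1,2,\ldots\}$ is an orthonormal set in $H^2$. *)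

theory Defs
  imports "HOL-Analysis.Analysis"
begin

text \<open>Functions on the unit circle are represented as functions complex to complex;
  only their values on the circle matter, since the measure is concentrated there.\<close>

definition mT :: "complex measure" where
  "mT = distr (density lborel (\<lambda>t. ennreal (indicator {0..2*pi} t / (2*pi)))) borel cis"

definition Linf :: "(complex \<Rightarrow> complex) set" where
  "Linf = {f. f \<in> borel_measurable mT \<and> (\<exists>C. AE z in mT. norm (f z) \<le> C)}"

definition fourier_coeff :: "(complex \<Rightarrow> complex) \<Rightarrow> int \<Rightarrow> complex" where
  "fourier_coeff f k = (LINT z|mT. f z * z powi (- k))"

definition Hinf :: "(complex \<Rightarrow> complex) set" where
  "Hinf = {f \<in> Linf. \<forall>k::int. k < 0 \<longrightarrow> fourier_coeff f k = 0}"

definition Linf_norm :: "((complex \<Rightarrow> complex) \<Rightarrow> real) \<Rightarrow> bool" where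
  "Linf_norm \<alpha> \<longleftrightarrow>
     (\<forall>f\<in>Linf. \<forall>g\<in>Linf. (AE z in mT. f z = g z) \<longrightarrow> \<alpha> f = \<alpha> g) \<and>
     (\<forall>f\<in>Linf. \<alpha> f = 0 \<longleftrightarrow> (AE z in mT. f z = 0)) \<and>
     (\<forall>f\<in>Linf. \<forall>g\<in>Linf. \<alpha> (\<lambda>z. f z + g z) \<le> \<alpha> f + \<alpha> g) \<and>
     (\<forall>f\<in>Linf. \<forall>c::complex. \<alpha> (\<lambda>z. c * f z) = norm c * \<alpha> f)"

definition rot_sym_norm :: "((complex \<Rightarrow> complex) \<Rightarrow> real) \<Rightarrow> bool" where
  "rot_sym_norm \<alpha> \<longleftrightarrow> Linf_norm \<alpha> \<and>
     \<alpha> (\<lambda>_. 1) = 1 \<and>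
     (\<forall>f\<in>Linf. \<alpha> (\<lambda>z. complex_of_real (norm (f z))) = \<alpha> f) \<and>
     (\<forall>f\<in>Linf. \<forall>w. norm w = 1 \<longrightarrow> \<alpha> (\<lambda>z. f (cnj w * z)) = \<alpha> f)"

definition continuous_norm :: "((complex \<Rightarrow> complex) \<Rightarrow> real) \<Rightarrow> bool" where
  "continuous_norm \<alpha> \<longleftrightarrow>
     (\<forall>\<epsilon>>0. \<exists>\<delta>>0. \<forall>E\<in>sets mT. measure mT E < \<delta> \<longrightarrow>
        \<alpha> (\<lambda>z. complex_of_real (indicator E z)) < \<epsilon>)"

definition alpha_ext :: "((complex \<Rightarrow> complex) \<Rightarrow> real) \<Rightarrow> (complex \<Rightarrow> complex) \<Rightarrow> ennreal" where
  "alpha_ext \<alpha> f = (SUP s \<in> {s :: complex \<Rightarrow> real. s \<in> borel_measurable mT \<and> finite (range s) \<and>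
        (AE z in mT. 0 \<le> s z \<and> s z \<le> norm (f z))}. ennreal (\<alpha> (\<lambda>z. complex_of_real (s z))))"

definition alpha_closure :: "((complex \<Rightarrow> complex) \<Rightarrow> real) \<Rightarrow> (complex \<Rightarrow> complex) set \<Rightarrow> (complex \<Rightarrow> complex) set" where
  "alpha_closure \<alpha> S = {f. f \<in> borel_measurable mT \<and>
      (\<exists>h. (\<forall>k. h k \<in> S) \<and> (\<lambda>k. alpha_ext \<alpha> (\<lambda>z. f z - h k z)) \<longlonglongrightarrow> 0)}"

definition Halpha :: "((complex \<Rightarrow> complex) \<Rightarrow> real) \<Rightarrow> (complex \<Rightarrow> complex) set" where
  "Halpha \<alpha> = alpha_closure \<alpha> Hinf"

definition Hinf_zn :: "nat \<Rightarrow> (complex \<Rightarrow> complex) set" where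
  "Hinf_zn n = {(\<lambda>z. f (z ^ n)) | f. f \<in> Hinf}"

definition Malpha_zn :: "((complex \<Rightarrow> complex) \<Rightarrow> real) \<Rightarrow> nat \<Rightarrow> (complex \<Rightarrow> complex) set" where
  "Malpha_zn \<alpha> n = alpha_closure \<alpha> (Hinf_zn n)"

definition n_inner :: "nat \<Rightarrow> (complex \<Rightarrow> complex) \<Rightarrow> bool" where
  "n_inner n \<phi> \<longleftrightarrow> \<phi> \<in> Hinf \<and>
     (\<forall>m k :: nat. (LINT z|mT. (z ^ (n*m) * \<phi> z) * cnj (z ^ (n*k) * \<phi> z)) =
        (if m = k then 1 else 0))"

definition closed_invariant_subspace ::
  "((complex \<Rightarrow> complex) \<Rightarrow> real) \<Rightarrow> nat \<Rightarrow> (complex \<Rightarrow> complex) set \<Rightarrow> bool" where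
  "closed_invariant_subspace \<alpha> n M \<longleftrightarrow>
     M \<subseteq> Halpha \<alpha> \<and> (\<lambda>_. 0) \<in> M \<and>
     (\<forall>f\<in>M. \<forall>g\<in>M. (\<lambda>z. f z + g z) \<in> M) \<and>
     (\<forall>f\<in>M. \<forall>c::complex. (\<lambda>z. c * f z) \<in> M) \<and>
     (\<forall>s f. (\<forall>k. s k \<in> M) \<and> f \<in> Halpha \<alpha> \<and>
        (\<lambda>k. alpha_ext \<alpha> (\<lambda>z. s k z - f z)) \<longlonglongrightarrow> 0 \<longrightarrow> f \<in> M) \<and>
     (\<forall>f\<in>M. (\<lambda>z. z ^ n * f z) \<in> M)"

definition mult_set :: "(complex \<Rightarrow> complex) \<Rightarrow> (complex \<Rightarrow> complex) set \<Rightarrow> (complex \<Rightarrow> complex) set" where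
  "mult_set J S = {(\<lambda>z. J z * h z) | h. h \<in> S}"

definition sum_subspaces :: "nat \<Rightarrow> (nat \<Rightarrow> (complex \<Rightarrow> complex) set) \<Rightarrow> (complex \<Rightarrow> complex) set" where
  "sum_subspaces r S = {f. f \<in> borel_measurable mT \<and>
      (\<exists>g. (\<forall>i<r. g i \<in> S i) \<and> (AE z in mT. f z = (\<Sum>i<r. g i z)))}"

definition direct_sum :: "nat \<Rightarrow> (nat \<Rightarrow> (complex \<Rightarrow> complex) set) \<Rightarrow> bool" where
  "direct_sum r S \<longleftrightarrow> (\<forall>g. (\<forall>i<r. g i \<in> S i) \<and> (AE z in mT. (\<Sum>i<r. g i z) = 0) \<longrightarrow>
      (\<forall>i<r. AE z in mT. g i z = 0))"

end

theory Submission
  imports Defs "HOL-Computational_Algebra.Polynomial"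
begin

text \<open>
  Rotational symmetry and continuity give two facts about the norm: it dominates the \<open>L\<^sup>1\<close> norm
  (average over roots of unity), and bounded sequences tending to zero in \<open>L\<^sup>1\<close> tend to zero in the
  norm. Multiplying \<open>f \<in> M\<close> by outer functions of \<open>z ^ n\<close> that are small where \<open>f\<close> is large
  shows that the bounded elements of \<open>M\<close> are dense in \<open>M\<close>; the same device shows that every
  bounded element of their \<open>L\<^sup>2\<close> closure \<open>N\<close> already lies in \<open>M\<close>. Take a maximal orthonormal system
  \<open>J\<^sub>1, \<dots>, J\<^sub>r\<close> in the wandering subspace \<open>W = N \<ominus> z\<^sup>n N\<close>. Comparing Fourier coefficients,
  the average of \<open>J\<^sub>i \<cdot> cnj J\<^sub>j\<close> over each fibre of \<open>z ^ n\<close> is the Kronecker delta, so the \<open>J\<^sub>i\<close> are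
  bounded and \<open>r \<le> n\<close>. The coefficients of an expansion in the \<open>J\<^sub>i\<close> are therefore fibre averages of
  \<open>f \<cdot> cnj J\<^sub>i\<close>, which are continuous for the norm, and the expansion passes from bounded elements to
  all of \<open>M\<close>.
\<close>

section \<open>The normalized measure on the circle\<close>

text \<open>Two obstacles shape the argument. \<open>M\<close> only admits multipliers that are
  functions of \<open>z ^ n\<close>, and \<open>\<alpha>\<close> need not be comparable with the L2
  norm, so \<open>M\<close> itself carries no orthogonal projection. The former is why truncating
  weights are built from the sum of the modulus over a fibre: it is constant on fibres, dominates
  the modulus at each point, and is integrable because \<open>\<alpha>\<close> dominates the L1
  norm. The logarithm of its excess over a level is square integrable, by
  \<open>(ln x)^2 \<le> 4 * x\<close>, and this suffices for an outer function obtained as an L2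
  limit: for a polynomial with real constant term the real part controls the whole polynomial, which
  replaces the theory of conjugate functions. The latter is why the \<open>J i\<close> are found in
  \<open>N\<close> while no orthogonal series is ever summed in \<open>\<alpha>\<close>: a
  coefficient is a finite sum of rotates of a product with a bounded function. Fourier analysis
  rests on one fact, the uniform density of real parts of polynomials among real continuous
  functions on the circle.\<close>

lemma sets_mT [simp, measurable_cong]: "sets mT = sets borel"
  by (simp add: mT_def)

lemma space_mT [simp]: "space mT = UNIV"
  by (simp add: mT_def)

lemma borel_measurable_mT [simp]: "borel_measurable mT = borel_measurable borel"
  by (rule measurable_cong_sets) simp_all

lemma cis_borel [measurable]: "cis \<in> borel_measurable borel"
  by (intro borel_measurable_continuous_onI continuous_intros)

lemma integral_mT:
  fixes f :: "complex \<Rightarrow> 'a::{banach, second_countable_topology}"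
  assumes [measurable]: "f \<in> borel_measurable borel"
  shows "(LINT z|mT. f z) = (LINT t|lborel. (indicator {0..2*pi} t / (2*pi)) *\<^sub>R f (cis t))"
  unfolding mT_def
  by (subst integral_distr, simp, simp, subst integral_density) auto

lemma emeasure_mT_UNIV: "emeasure mT UNIV = 1"
proof -
  have "emeasure mT UNIV = (\<integral>\<^sup>+t. ennreal (indicator {0..2*pi} t / (2*pi)) \<partial>lborel)"
    by (simp add: mT_def emeasure_distr emeasure_density)
  also have "\<dots> = (\<integral>\<^sup>+t. ennreal (1/(2*pi)) * indicator {0..2*pi} t \<partial>lborel)"
    by (intro nn_integral_cong) (auto simp: indicator_def)
  also have "\<dots> = ennreal (1/(2*pi)) * ennreal (2*pi)"
    by (subst nn_integral_cmult_indicator) auto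
  also have "\<dots> = 1"
    by (subst ennreal_mult[symmetric]) auto
  finally show ?thesis .
qed

interpretation mT: finite_measure mT
  by (rule finite_measureI) (simp add: emeasure_mT_UNIV)

lemma measure_mT_UNIV [simp]: "measure mT UNIV = 1"
  by (simp add: measure_def emeasure_mT_UNIV)

lemma AE_mT_norm: "AE z in mT. norm z = 1"
  unfolding mT_def by (subst AE_distr_iff) auto

text \<open>Total mass one makes an exceptional null set miss some point of the circle. This is how
  signs of essential bounds and facts about a single fibre are extracted from almost-everywhere
  statements.\<close>

lemma AE_mT_ex: "AE z in mT. P z \<Longrightarrow> \<exists>z. norm z = 1 \<and> P z"
proof (rule ccontr)
  assume "AE z in mT. P z" and n: "\<not> (\<exists>z. norm z = 1 \<and> P z)"
  then have "AE z in mT. False"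
    using AE_mT_norm by (auto elim: AE_mp)
  then show False
    using emeasure_mT_UNIV by (auto simp: AE_iff_null null_sets_def)
qed

lemma integral_mT_power:
  "(LINT z|mT. z ^ k) = (if k = 0 then 1 else 0)"
proof (cases "k = 0")
  case False
  have "(LINT t|lborel. indicator {0..2*pi} t *\<^sub>R cis (real k * t))
      = cis (real k * (2*pi)) / (\<i> * k) - cis (real k * 0) / (\<i> * k)"
  proof (rule integral_FTC_Icc)
    fix x :: real
    show "((\<lambda>x. cis (real k * x) / (\<i> * k)) has_vector_derivative cis (real k * x)) (at x within {0..2*pi})"
    proof -
      have "((\<lambda>w. exp (\<i> * k * w) / (\<i> * k)) has_field_derivative exp (\<i> * k * of_real x)) (at (of_real x))"
        using False by (auto intro!: derivative_eq_intros)
      from has_vector_derivative_real_field[OF this] show ?thesis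
        by (simp add: cis_conv_exp mult.assoc)
    qed
  qed (auto intro!: continuous_intros)
  also have "\<dots> = 0"
    by (simp add: cis_multiple_2pi mult.commute[of "real k"])
  finally have *: "(LINT t|lborel. indicator {0..2*pi} t *\<^sub>R cis (real k * t)) = 0" .
  have "(LINT z|mT. z ^ k) = (LINT t|lborel. (1/(2*pi)) *\<^sub>R (indicator {0..2*pi} t *\<^sub>R cis (real k * t)))"
    by (subst integral_mT) (simp_all add: Complex.DeMoivre)
  also have "\<dots> = 0"
    by (subst integral_scaleR_right) (simp add: *)
  finally show ?thesis using False by simp
qed simp

lemma integrable_mT_bounded:
  fixes f :: "complex \<Rightarrow> 'a::{banach, second_countable_topology}"
  assumes "f \<in> borel_measurable borel" "AE z in mT. norm (f z) \<le> C"
  shows "integrable mT f"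
  using assms by (intro mT.integrable_const_bound[of f C]) auto

lemma poly_borel [measurable]: "poly p \<in> borel_measurable (borel :: complex measure)"
  by (intro borel_measurable_continuous_onI continuous_intros) 

lemma poly_bounded_circle: "\<exists>C\<ge>0. \<forall>z::complex. norm z = 1 \<longrightarrow> norm (poly p z) \<le> C"
proof -
  have "bounded (poly p ` sphere (0::complex) 1)"
    by (intro compact_imp_bounded compact_continuous_image continuous_intros) auto
  then obtain C where C: "\<forall>x\<in>poly p ` sphere (0::complex) 1. norm x \<le> C"
    unfolding bounded_iff ..
  have "norm (poly p z) \<le> max C 0" if "norm z = 1" for z
    using C that by (simp add: le_max_iff_disj)
  then show ?thesis by (meson max.cobounded2)
qed

lemma integrable_mT_poly: "integrable mT (poly p)"
proof -
  obtain C where "\<forall>z::complex. norm z = 1 \<longrightarrow> norm (poly p z) \<le> C"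
    using poly_bounded_circle by blast
  then show ?thesis
    using AE_mT_norm by (intro integrable_mT_bounded[of _ C]) auto
qed

lemma integral_mT_poly: "(LINT z|mT. poly p z) = coeff p 0"
proof -
  have i: "integrable mT (\<lambda>z. coeff p i * z ^ i)" for i
    using integrable_mT_poly[of "monom (coeff p i) i"] unfolding poly_monom .
  have "(LINT z|mT. poly p z) = (LINT z|mT. (\<Sum>i\<le>degree p. coeff p i * z ^ i))"
    by (simp add: poly_altdef)
  also have "\<dots> = (\<Sum>i\<le>degree p. coeff p i * (if i = 0 then 1 else 0))"
    by (subst Bochner_Integration.integral_sum) (auto simp: i integral_mT_power intro!: sum.cong)
  also have "\<dots> = coeff p 0" by (simp add: if_distrib cong: if_cong)
  finally show ?thesis .
qed

lemma circle_mult_cnj: "norm z = 1 \<Longrightarrow> z * cnj z = 1"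
  by (metis complex_norm_square of_real_1 one_power2)

section \<open>Real parts of polynomials on the circle; moments determine a measure\<close>

text \<open>On the circle \<open>cnj z\<close> inverts \<open>z\<close>, so every monomial
  \<open>c * z ^ i * cnj z ^ K\<close> collapses to a monomial in \<open>z\<close> or to the
  conjugate of one, and the real part cannot tell a number from its conjugate. Trigonometric
  polynomials thus have the same real parts as analytic ones.\<close>

lemma laurent_Re_poly:
  "\<exists>p. \<forall>z::complex. norm z = 1 \<longrightarrow> Re (poly q z * cnj z ^ K) = Re (poly p z)"
proof -
  have "\<exists>p. \<forall>z::complex. norm z = 1 \<longrightarrow> Re (c * z ^ i * cnj z ^ K) = Re (poly p z)" for c i
  proof (cases "i \<ge> K")
    case True
    have "c * z ^ i * cnj z ^ K = poly (monom c (i - K)) z" if "norm z = 1" for z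
    proof -
      have "z ^ i * cnj z ^ K = z ^ (i - K) * (z * cnj z) ^ K"
        using True by (simp add: power_mult_distrib flip: power_add mult.assoc)
      also have "z * cnj z = 1" using that by (rule circle_mult_cnj)
      finally show ?thesis by (simp add: poly_monom mult.assoc)
    qed
    then show ?thesis by metis
  next
    case False
    have "Re (c * z ^ i * cnj z ^ K) = Re (poly (monom (cnj c) (K - i)) z)" if "norm z = 1" for z
    proof -
      have "z ^ i * cnj z ^ K = cnj z ^ (K - i) * (z * cnj z) ^ i"
        using False by (simp add: power_mult_distrib flip: power_add mult.assoc)
      also have "z * cnj z = 1" using that by (rule circle_mult_cnj)
      finally have "c * z ^ i * cnj z ^ K = cnj (cnj c * z ^ (K - i))" by (simp add: mult.assoc)
      then show ?thesis by (metis complex_cnj_cnj cnj.simps(1) poly_monom)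
    qed
    then show ?thesis by metis
  qed
  then obtain p where p: "\<And>c i z. norm z = 1 \<Longrightarrow> Re (c * z ^ i * cnj z ^ K) = Re (poly (p c i) z)"
    by metis
  have "Re (poly q z * cnj z ^ K) = Re (poly (\<Sum>i\<le>degree q. p (coeff q i) i) z)" if "norm z = 1" for z
  proof -
    have "Re (poly q z * cnj z ^ K) = (\<Sum>i\<le>degree q. Re (coeff q i * z ^ i * cnj z ^ K))"
      unfolding poly_altdef[of q] sum_distrib_right by (rule Re_sum)
    also have "\<dots> = (\<Sum>i\<le>degree q. Re (poly (p (coeff q i) i) z))"
      using p that by (intro sum.cong) blast+
    also have "\<dots> = Re (poly (\<Sum>i\<le>degree q. p (coeff q i) i) z)"
      unfolding poly_sum by (rule Re_sum[symmetric])
    finally show ?thesis .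
  qed
  then show ?thesis by blast
qed

text \<open>Laurent polynomials, written as \<open>poly q z * cnj z ^ K\<close>, contain the real
  linear functionals and the constants and are closed under sums and products; a common exponent is
  reached because \<open>z * cnj z = 1\<close>.\<close>

lemma real_polynomial_function_circle:
  assumes "real_polynomial_function g"
  shows "\<exists>q K. \<forall>z::complex. norm z = 1 \<longrightarrow> complex_of_real (g z) = poly q z * cnj z ^ K"
  using assms
proof induction
  case (linear f)
  interpret bounded_linear f by fact
  \<comment> \<open>\<open>f z\<close> is expressed through \<open>f 1\<close> and
    \<open>f \<i>\<close>, and the coordinates through \<open>z\<close> and \<open>cnj z\<close>.
    Factoring out \<open>cnj z\<close> leaves a quadratic without linear term, since
    \<open>z = z ^ 2 * cnj z\<close>.\<close>
  have "complex_of_real (f z) = poly [: of_real (f 1) / 2 - of_real (f \<i>) / (2*\<i>), 0, of_real (f 1) / 2 + of_real (f \<i>) / (2*\<i>) :] z * cnj z ^ 1"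
    if "norm z = 1" for z
  proof -
    have "f z = f (Re z *\<^sub>R 1 + Im z *\<^sub>R \<i>)"
      by (rule arg_cong[of _ _ f]) (simp add: complex_eq_iff)
    then have f: "f z = Re z * f 1 + Im z * f \<i>"
      by (simp only: add scaleR real_scaleR_def)
    have z: "z * (z * cnj z) = z" using circle_mult_cnj[OF that] by simp
    have 1: "complex_of_real (Re z) = (z + cnj z) / 2" "complex_of_real (Im z) = (z - cnj z) / (2*\<i>)"
      by (simp_all add: complex_eq_iff)
    have "poly [: of_real (f 1) / 2 - of_real (f \<i>) / (2*\<i>), 0, of_real (f 1) / 2 + of_real (f \<i>) / (2*\<i>) :] z * cnj z ^ 1
      = (of_real (f 1) / 2 - of_real (f \<i>) / (2*\<i>)) * cnj z + (of_real (f 1) / 2 + of_real (f \<i>) / (2*\<i>)) * (z * (z * cnj z))"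
      by (simp add: algebra_simps)
    also have "\<dots> = complex_of_real (f z)"
      unfolding z f of_real_add of_real_mult 1 by (simp add: field_simps)
    finally show ?thesis by simp
  qed
  then show ?case by blast
next
  case (const c)
  show ?case
    by (rule exI[of _ "[:of_real c:]"], rule exI[of _ 0]) simp
next
  case (add f g)
  then obtain q1 K1 q2 K2 where *: "\<And>z. norm z = 1 \<Longrightarrow> complex_of_real (f z) = poly q1 z * cnj z ^ K1"
    "\<And>z. norm z = 1 \<Longrightarrow> complex_of_real (g z) = poly q2 z * cnj z ^ K2" by metis
  have "complex_of_real (f z + g z) = poly (q1 * monom 1 K2 + q2 * monom 1 K1) z * cnj z ^ (K1 + K2)"
    if "norm z = 1" for z
  proof -
    have "poly (q1 * monom 1 K2 + q2 * monom 1 K1) z * cnj z ^ (K1 + K2)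
      = poly q1 z * cnj z ^ K1 * (z * cnj z) ^ K2 + poly q2 z * cnj z ^ K2 * (z * cnj z) ^ K1"
      by (simp add: algebra_simps power_add power_mult_distrib poly_monom)
    then show ?thesis using * that circle_mult_cnj by simp
  qed
  then show ?case by blast
next
  case (mult f g)
  then obtain q1 K1 q2 K2 where *: "\<And>z. norm z = 1 \<Longrightarrow> complex_of_real (f z) = poly q1 z * cnj z ^ K1"
    "\<And>z. norm z = 1 \<Longrightarrow> complex_of_real (g z) = poly q2 z * cnj z ^ K2" by metis
  have "complex_of_real (f z * g z) = poly (q1 * q2) z * cnj z ^ (K1 + K2)"
    if "norm z = 1" for z
    using *[OF that] by (simp add: power_add)
  then show ?case by blast
qed

text \<open>The real Stone-Weierstrass theorem supplies a real polynomial in the two coordinates;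
  passing to Laurent form and discarding conjugates leaves a complex polynomial. The polynomial
  approximations in the mean below rest on this uniform one.\<close>

lemma continuous_approx_Re_poly:
  fixes f :: "complex \<Rightarrow> real"
  assumes "continuous_on UNIV f" "0 < e"
  shows "\<exists>p. \<forall>z. norm z = 1 \<longrightarrow> \<bar>f z - Re (poly p z)\<bar> < e"
proof -
  obtain g where g: "real_polynomial_function g" "\<And>z. z \<in> sphere 0 1 \<Longrightarrow> \<bar>f z - g z\<bar> < e"
    using Stone_Weierstrass_real_polynomial_function[of "sphere 0 1" f e] assms continuous_on_subset
    by (metis compact_sphere subset_UNIV)
  obtain q K where q: "\<And>z. norm z = 1 \<Longrightarrow> complex_of_real (g z) = poly q z * cnj z ^ K"
    using real_polynomial_function_circle[OF g(1)] by blast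
  obtain p where "\<And>z. norm z = 1 \<Longrightarrow> Re (poly q z * cnj z ^ K) = Re (poly p z)"
    using laurent_Re_poly by blast
  then have "g z = Re (poly p z)" if "norm z = 1" for z
    using q[OF that] that by (metis Re_complex_of_real)
  with g(2) show ?thesis by (metis mem_sphere_0)
qed

lemma integrable_continuous_circle:
  fixes f :: "complex \<Rightarrow> 'a::{banach,second_countable_topology}"
  assumes "finite_measure \<mu>" and s: "sets \<mu> = sets borel" and c: "AE z in \<mu>. norm z = 1"
    and f: "continuous_on UNIV f"
  shows "integrable \<mu> f"
proof -
  interpret finite_measure \<mu> by fact
  have "bounded (f ` sphere 0 1)"
    by (intro compact_imp_bounded compact_continuous_image continuous_on_subset[OF f]) auto
  then obtain C where C: "\<forall>x\<in>f ` sphere 0 1. norm x \<le> C"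
    unfolding bounded_iff ..
  have "f \<in> borel_measurable \<mu>"
    using borel_measurable_continuous_onI[OF f] measurable_cong_sets[OF s refl] by blast
  then show ?thesis
    using c C by (intro integrable_const_bound[of _ C]) auto
qed

text \<open>Tent functions \<open>1 - k * infdist z C\<close>, cut off at 0, equal 1 on
  \<open>C\<close> and vanish eventually off \<open>C\<close>. They carry equalities of integrals of
  continuous functions over to measures of closed sets.\<close>

lemma closed_indicator_limit:
  fixes C :: "'a::metric_space set"
  assumes C: "closed C"
  shows "\<exists>g::nat \<Rightarrow> 'a \<Rightarrow> real. (\<forall>k. continuous_on UNIV (g k)) \<and> (\<forall>k z. norm (g k z) \<le> 1) \<and>
    (\<forall>z. (\<lambda>k. g k z) \<longlonglongrightarrow> indicator C z)"
\<comment> \<open>\<open>infdist z {}\<close> is 0 by convention, so for empty \<open>C\<close> the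
  tents would be 1 everywhere.\<close>
proof (cases "C = {}")
  case True
  then show ?thesis by (intro exI[of _ "\<lambda>_ _. 0"]) auto
next
  case False
  define g where "g k z = max 0 (1 - real k * infdist z C)" for k z
  have "continuous_on UNIV (g k)" for k
    unfolding g_def by (intro continuous_intros)
  moreover have "norm (g k z) \<le> 1" for k z
    by (simp add: g_def infdist_nonneg)
  moreover have "(\<lambda>k. g k z) \<longlonglongrightarrow> indicator C z" for z
  proof (cases "z \<in> C")
    case True then show ?thesis by (simp add: g_def)
  next
    case F: False
    then have pos: "infdist z C > 0"
      using infdist_pos_not_in_closed[OF C False] by simp
    obtain K where K: "1 / infdist z C < real K" using reals_Archimedean2 by blast
    have "g k z = 0" if "k \<ge> K" for k
    proof -
      have "1 / infdist z C < real k" using K that by linarith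
      then show ?thesis using pos by (simp add: g_def field_simps)
    qed
    then have "eventually (\<lambda>k. g k z = 0) sequentially"
      using eventually_at_top_linorder by blast
    then show ?thesis using F by (simp add: tendsto_eventually)
  qed
  ultimately show ?thesis by blast
qed

text \<open>Nonnegative powers suffice because taking real parts of integrals brings in the
  conjugate powers. Equality extends from real parts of polynomials to real continuous functions by
  uniform density, and to closed sets by tents; closed sets form an intersection-stable generator of
  the Borel sets.\<close>

lemma measure_eqI_circle_moments:
  fixes \<mu> \<nu> :: "complex measure"
  assumes f: "finite_measure \<mu>" "finite_measure \<nu>"
    and s [measurable_cong]: "sets \<mu> = sets borel" "sets \<nu> = sets borel"
    and c: "AE z in \<mu>. norm z = 1" "AE z in \<nu>. norm z = 1"
    and m: "\<And>k. (LINT z|\<mu>. z ^ k) = (LINT z|\<nu>. z ^ k)"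
  shows "\<mu> = \<nu>"
proof -
  interpret M: finite_measure \<mu> by fact
  interpret N: finite_measure \<nu> by fact
  have bor: "borel_measurable \<mu> = borel_measurable borel" "borel_measurable \<nu> = borel_measurable borel"
    by (rule measurable_cong_sets[OF s(1) refl], rule measurable_cong_sets[OF s(2) refl])
  note int = integrable_continuous_circle[OF f(1) s(1) c(1)] integrable_continuous_circle[OF f(2) s(2) c(2)]
  have p: "(LINT z|\<mu>. poly p z) = (LINT z|\<nu>. poly p z)" for p
    unfolding poly_altdef
    by (subst (1 2) Bochner_Integration.integral_sum) (auto simp: m intro!: int continuous_intros)
  have rp: "(LINT z|\<mu>. Re (poly p z)) = (LINT z|\<nu>. Re (poly p z))" for p
    by (subst (1 2) integral_Re) (auto simp: p intro!: int continuous_intros)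
  have cont: "(LINT z|\<mu>. f z) = (LINT z|\<nu>. f z)" if f: "continuous_on UNIV f" for f :: "complex \<Rightarrow> real"
  proof -
    define B where "B = measure \<mu> (space \<mu>) + measure \<nu> (space \<nu>)"
    have B: "B \<ge> 0" by (simp add: B_def)
    have "\<bar>(LINT z|\<mu>. f z) - (LINT z|\<nu>. f z)\<bar> \<le> 0 + e" if "e > 0" for e
    proof -
      \<comment> \<open>\<open>B\<close> is the total mass of both measures, the factor in front of
        the uniform error; the summand 1 keeps the quotient meaningful when \<open>B\<close> is
        0.\<close>
      define d where "d = e / (B + 1)"
      have d: "d > 0" using that B by (simp add: d_def)
      obtain p where p: "\<And>z. norm z = 1 \<Longrightarrow> \<bar>f z - Re (poly p z)\<bar> < d"
        using continuous_approx_Re_poly[OF f d] by blast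
      have i: "integrable \<mu> (\<lambda>z. Re (poly p z))" "integrable \<nu> (\<lambda>z. Re (poly p z))"
        by (auto intro!: int continuous_intros)
      have "\<bar>LINT z|\<mu>. f z - Re (poly p z)\<bar> \<le> (LINT z|\<mu>. d)"
        using i int[OF f] c(1) p by (intro integral_abs_bound[THEN order_trans] integral_mono_AE) (auto intro: less_imp_le)
      moreover have "\<bar>LINT z|\<nu>. f z - Re (poly p z)\<bar> \<le> (LINT z|\<nu>. d)"
        using i int[OF f] c(2) p by (intro integral_abs_bound[THEN order_trans] integral_mono_AE) (auto intro: less_imp_le)
      ultimately have "\<bar>(LINT z|\<mu>. f z) - (LINT z|\<nu>. f z)\<bar> \<le> d * B"
        using i int[OF f] rp[of p] by (simp add: B_def algebra_simps)
      also have "\<dots> \<le> d * (B + 1)" using d by simp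
      also have "\<dots> = e" using B by (simp add: d_def)
      finally show ?thesis by simp
    qed
    then have "\<bar>(LINT z|\<mu>. f z) - (LINT z|\<nu>. f z)\<bar> \<le> 0"
      by (rule field_le_epsilon)
    then show ?thesis by simp
  qed
  have closed: "emeasure \<mu> C = emeasure \<nu> C" if C: "closed C" for C
  proof -
    obtain g :: "nat \<Rightarrow> complex \<Rightarrow> real" where g: "\<And>k. continuous_on UNIV (g k)"
      and b: "\<And>k z. norm (g k z) \<le> 1" and lim: "\<And>z. (\<lambda>k. g k z) \<longlonglongrightarrow> indicator C z"
      using closed_indicator_limit[OF C] by blast
    have meas [measurable]: "C \<in> sets borel" "\<And>k. g k \<in> borel_measurable borel"
      using C g by (auto intro: borel_measurable_continuous_onI)
    have "(\<lambda>k. LINT z|\<mu>. g k z) \<longlonglongrightarrow> (LINT z|\<mu>. indicator C z)"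
      by (rule integral_dominated_convergence[where w="\<lambda>_. 1"]) (auto simp: bor lim b[unfolded real_norm_def])
    moreover have "(\<lambda>k. LINT z|\<nu>. g k z) \<longlonglongrightarrow> (LINT z|\<nu>. indicator C z)"
      by (rule integral_dominated_convergence[where w="\<lambda>_. 1"]) (auto simp: bor lim b[unfolded real_norm_def])
    ultimately have "(LINT z|\<mu>. indicator C z) = (LINT z|\<nu>. indicator C z :: real)"
      unfolding cont[OF g] by (rule LIMSEQ_unique)
    then have "measure \<mu> C = measure \<nu> C"
      using sets_eq_imp_space_eq[OF s(1)] sets_eq_imp_space_eq[OF s(2)] by simp
    then show ?thesis by (simp add: M.emeasure_eq_measure N.emeasure_eq_measure)
  qed
  show ?thesis
  proof (rule measure_eqI_generator_eq[where \<Omega>=UNIV and E="Collect closed" and A="\<lambda>_. UNIV"])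
    show "Int_stable (Collect closed)" by (auto simp: Int_stable_def)
    show "sets \<mu> = sigma_sets UNIV (Collect closed)" "sets \<nu> = sigma_sets UNIV (Collect closed)"
      using s by (simp_all add: borel_eq_closed)
  qed (use closed M.emeasure_finite in auto)
qed

section \<open>Rotations, powers and roots on the circle\<close>

lemma cnj_borel [measurable]: "cnj \<in> borel_measurable borel"
  by (intro borel_measurable_continuous_onI continuous_intros)

lemma integral_mT_cmult_power: "(LINT z|mT. (c * z) ^ k) = c ^ k * (if k = 0 then 1 else 0)"
  by (simp add: power_mult_distrib integral_mT_power)

lemma distr_mT_rotate:
  assumes "norm w = 1"
  shows "distr mT borel ((*) w) = mT"
proof (rule measure_eqI_circle_moments)
  have m: "(*) w \<in> measurable mT borel" by simp
  show "finite_measure (distr mT borel ((*) w))"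
    by (rule mT.finite_measure_distr) fact
  show "AE z in distr mT borel ((*) w). norm z = 1"
    using AE_mT_norm assms by (subst AE_distr_iff) (auto simp: norm_mult)
  show "(LINT z|distr mT borel ((*) w). z ^ k) = (LINT z|mT. z ^ k)" for k
    by (subst integral_distr) (auto simp: integral_mT_cmult_power integral_mT_power)
qed (auto intro: AE_mT_norm mT.finite_measure_axioms)

text \<open>Substituting \<open>z ^ n\<close> turns the moment of order \<open>k\<close> into that
  of order \<open>n * k\<close>, and both vanish for \<open>k > 0\<close>. Statements about
  functions of \<open>z ^ n\<close> thereby reduce to statements on the base circle.\<close>

lemma distr_mT_power:
  assumes "n \<ge> 1"
  shows "distr mT borel (\<lambda>z. z ^ n) = mT"
proof (rule measure_eqI_circle_moments)
  have m: "(\<lambda>z. z ^ n) \<in> measurable mT borel" by simp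
  show "finite_measure (distr mT borel (\<lambda>z. z ^ n))"
    by (rule mT.finite_measure_distr) fact
  show "AE z in distr mT borel (\<lambda>z. z ^ n). norm z = 1"
    using AE_mT_norm by (subst AE_distr_iff) (auto simp: norm_power)
  show "(LINT z|distr mT borel (\<lambda>z. z ^ n). z ^ k) = (LINT z|mT. z ^ k)" for k
    using assms by (subst integral_distr) (auto simp: integral_mT_power simp flip: power_mult)
qed (auto intro: AE_mT_norm mT.finite_measure_axioms)

lemma AE_rotate: "norm w = 1 \<Longrightarrow> AE z in mT. P z \<Longrightarrow> AE z in mT. P (w * z)"
  by (rule AE_distrD[where M'=borel]) (simp_all only: distr_mT_rotate, simp)

lemma AE_power: "n \<ge> 1 \<Longrightarrow> AE z in mT. P z \<Longrightarrow> AE z in mT. P (z ^ n)"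
  by (rule AE_distrD[where M'=borel]) (simp_all only: distr_mT_power, simp)

lemma AE_power_iff:
  assumes n: "n \<ge> 1" and [measurable]: "Measurable.pred borel P"
  shows "(AE z in mT. P (z ^ n)) \<longleftrightarrow> (AE z in mT. P z)"
proof -
  have "(AE z in distr mT borel (\<lambda>z. z ^ n). P z) \<longleftrightarrow> (AE z in mT. P (z ^ n))"
    by (rule AE_distr_iff) (use assms(2) in \<open>auto simp: pred_def\<close>)
  then show ?thesis unfolding distr_mT_power[OF n] by (rule sym)
qed

lemma integral_rotate:
  fixes f :: "complex \<Rightarrow> 'a::{banach, second_countable_topology}"
  assumes "norm w = 1" "f \<in> borel_measurable borel"
  shows "(LINT z|mT. f (w * z)) = (LINT z|mT. f z)"
  using integral_distr[of "(*) w" mT borel f] assms by (simp add: distr_mT_rotate)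

lemma integral_power:
  fixes f :: "complex \<Rightarrow> 'a::{banach, second_countable_topology}"
  assumes "n \<ge> 1" "f \<in> borel_measurable borel"
  shows "(LINT z|mT. f (z ^ n)) = (LINT z|mT. f z)"
  using integral_distr[of "\<lambda>z. z ^ n" mT borel f] assms by (simp add: distr_mT_power)

lemma integrable_rotate:
  fixes f :: "complex \<Rightarrow> 'a::{banach, second_countable_topology}"
  assumes "norm w = 1" "integrable mT f"
  shows "integrable mT (\<lambda>z. f (w * z))"
  using integrable_distr[of "(*) w" mT borel f] assms by (simp add: distr_mT_rotate)

lemma integrable_power_iff:
  fixes f :: "complex \<Rightarrow> 'a::{banach, second_countable_topology}"
  assumes "n \<ge> 1" "f \<in> borel_measurable borel"
  shows "integrable mT (\<lambda>z. f (z ^ n)) \<longleftrightarrow> integrable mT f"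
  using integrable_distr_eq[of "\<lambda>z. z ^ n" mT borel f] assms by (simp add: distr_mT_power)

text \<open>A Borel branch of the n-th root on the circle: the argument is recovered as a signed
  \<open>arccos\<close> of the real part, and clamping the real part makes the formula measurable on
  the whole plane. Composition with it writes a function that is constant on the fibres of
  \<open>z ^ n\<close> as a function of \<open>z ^ n\<close>.\<close>

definition circle_root :: "nat \<Rightarrow> complex \<Rightarrow> complex" where
  "circle_root n w = cis ((if Im w \<ge> 0 then 1 else -1) * arccos (max (-1) (min 1 (Re w))) / n)"

lemma circle_root_measurable [measurable]: "circle_root n \<in> borel_measurable borel"
proof -
  have "(\<lambda>w. arccos (max (-1) (min 1 (Re w)))) \<in> borel_measurable borel"
    by (intro borel_measurable_continuous_onI continuous_intros) auto
  then show ?thesis unfolding circle_root_def by measurable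
qed

lemma norm_circle_root [simp]: "norm (circle_root n w) = 1"
  by (simp add: circle_root_def)

lemma circle_root_power:
  assumes "n \<ge> 1" "norm w = 1"
  shows "circle_root n w ^ n = w"
proof -
  define s :: real where "s = (if Im w \<ge> 0 then 1 else -1)"
  have R: "\<bar>Re w\<bar> \<le> 1" using abs_Re_le_cmod[of w] assms by simp
  have "(Re w)\<^sup>2 + (Im w)\<^sup>2 = 1" using assms(2) by (simp add: cmod_def)
  then have "sqrt (1 - (Re w)\<^sup>2) = \<bar>Im w\<bar>" by (metis add_diff_cancel_left' real_sqrt_abs)
  then have "sin (s * arccos (Re w)) = Im w" "cos (s * arccos (Re w)) = Re w"
    using R by (auto simp: s_def sin_arccos abs_le_iff)
  then have "cis (s * arccos (Re w)) = w" by (simp add: complex_eq_iff)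
  moreover have "max (-1) (min 1 (Re w)) = Re w" using R by auto
  ultimately show ?thesis using assms
    by (simp add: circle_root_def Complex.DeMoivre flip: s_def)
qed

section \<open>Approximation of integrable functions; uniqueness of Fourier coefficients\<close>

text \<open>Inner regularity gives a compact \<open>K\<close> inside \<open>B\<close> of almost the
  same measure, and tents over \<open>K\<close> converge to its indicator by dominated
  convergence.\<close>

lemma integrable_indicator_approx:
  assumes "B \<in> sets borel" "e > 0"
  shows "\<exists>g::complex \<Rightarrow> real. continuous_on UNIV g \<and> integrable mT g \<and> (LINT z|mT. \<bar>indicator B z - g z\<bar>) < e"
proof -
  have sup: "emeasure mT B = (SUP K \<in> {K. K \<subseteq> B \<and> compact K}. emeasure mT K)"
    using assms emeasure_mT_UNIV by (intro inner_regular) auto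
  have "\<exists>K. K \<subseteq> B \<and> compact K \<and> measure mT B - e/2 < measure mT K"
  \<comment> \<open>A negative target \<open>measure mT B - e/2\<close> would be clipped to 0 by
    \<open>ennreal\<close>, and the strict inequality could fail there; the empty set serves in that
    case.\<close>
  proof (cases "measure mT B < e/2")
    case True then show ?thesis by (intro exI[of _ "{}"]) auto
  next
    case False
    then have "ennreal (measure mT B - e/2) < emeasure mT B"
      unfolding mT.emeasure_eq_measure using assms(2) by (subst ennreal_less_iff) auto
    then obtain K where "K \<subseteq> B" "compact K" "ennreal (measure mT B - e/2) < emeasure mT K"
      unfolding sup less_SUP_iff by auto
    then show ?thesis unfolding mT.emeasure_eq_measure using False by (auto simp: ennreal_less_iff)
  qed
  then obtain K where K: "K \<subseteq> B" "compact K" "measure mT B - e/2 < measure mT K" by blast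
  note [measurable] = assms(1) borel_compact[OF K(2)]
  obtain g :: "nat \<Rightarrow> complex \<Rightarrow> real" where g: "\<And>k. continuous_on UNIV (g k)"
      and b: "\<And>k z. norm (g k z) \<le> 1" and lim: "\<And>z. (\<lambda>k. g k z) \<longlonglongrightarrow> indicator K z"
    using closed_indicator_limit[OF compact_imp_closed[OF K(2)]] by blast
  have [measurable]: "\<And>k. g k \<in> borel_measurable borel"
    using g by (auto intro: borel_measurable_continuous_onI)
  have gi: "integrable mT (g k)" for k
    using b by (intro integrable_mT_bounded[of _ 1]) auto
  have "(\<lambda>k. LINT z|mT. \<bar>indicator K z - g k z\<bar>) \<longlonglongrightarrow> (LINT z|mT. 0)"
  proof (rule integral_dominated_convergence[where w="\<lambda>_. 2"])
    have "(\<lambda>k. \<bar>indicator K z - g k z\<bar>) \<longlonglongrightarrow> 0" for z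
      using tendsto_rabs[OF tendsto_diff[OF tendsto_const lim], of "indicator K z" z] by simp
    then show "AE z in mT. (\<lambda>k. \<bar>indicator K z - g k z\<bar>) \<longlonglongrightarrow> 0" by simp
    have "\<bar>indicator K z - g k z\<bar> \<le> 2" for k z
      using b[of k z] by (cases "z \<in> K") auto
    then show "AE z in mT. norm \<bar>indicator K z - g k z\<bar> \<le> 2" for k by simp
  qed auto
  then have "eventually (\<lambda>k. (LINT z|mT. \<bar>indicator K z - g k z\<bar>) < e/2) sequentially"
    using assms(2) by (intro order_tendstoD) auto
  then obtain k where k: "(LINT z|mT. \<bar>indicator K z - g k z\<bar>) < e/2"
    by (auto simp: eventually_sequentially)
  have i: "integrable mT (indicat_real B)" "integrable mT (indicat_real K)"
    by (auto intro!: integrable_mT_bounded[of _ 1])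
  have "(LINT z|mT. \<bar>indicator B z - g k z\<bar>) \<le> (LINT z|mT. (indicator B z - indicator K z) + \<bar>indicator K z - g k z\<bar>)"
  proof (rule integral_mono)
    show "\<bar>indicator B z - g k z\<bar> \<le> indicator B z - indicator K z + \<bar>indicator K z - g k z\<bar>" for z
      using K(1) by (auto simp: indicator_def)
  qed (use i gi in auto)
  also have "\<dots> = measure mT B - measure mT K + (LINT z|mT. \<bar>indicator K z - g k z\<bar>)"
    using i gi by simp
  also have "\<dots> < e" using k K(3) by simp
  finally show ?thesis using g gi by (intro exI[of _ "g k"] conjI) auto
qed

lemma integrable_continuous_approx:
  fixes f :: "complex \<Rightarrow> real"
  assumes "integrable mT f" "e > 0"
  shows "\<exists>g::complex \<Rightarrow> real. continuous_on UNIV g \<and> integrable mT g \<and> (LINT z|mT. \<bar>f z - g z\<bar>) < e"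
  using assms
proof (induction f arbitrary: e rule: integrable_induct)
  case (base A c)
  then have "e / (\<bar>c\<bar> + 1) > 0" by (simp add: add_nonneg_pos)
  then obtain g :: "complex \<Rightarrow> real" where g: "continuous_on UNIV g" "integrable mT g" "(LINT z|mT. \<bar>indicator A z - g z\<bar>) < e / (\<bar>c\<bar> + 1)"
    using integrable_indicator_approx[of A "e / (\<bar>c\<bar> + 1)"] base by auto
  have "(LINT z|mT. \<bar>indicator A z *\<^sub>R c - c * g z\<bar>) = (LINT z|mT. \<bar>c\<bar> * \<bar>indicator A z - g z\<bar>)"
    by (intro Bochner_Integration.integral_cong) (auto simp: abs_mult[symmetric] algebra_simps)
  also have "\<dots> = \<bar>c\<bar> * (LINT z|mT. \<bar>indicator A z - g z\<bar>)" by simp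
  also have "\<dots> \<le> \<bar>c\<bar> * (e / (\<bar>c\<bar> + 1))"
    using g(3) by (intro mult_left_mono) auto
  also have "\<dots> < e" using base(3) by (simp add: field_simps add_nonneg_pos)
  finally show ?case using g by (intro exI[of _ "\<lambda>z. c * g z"]) (auto intro!: continuous_intros)
next
  case (add f g)
  obtain f' g' :: "complex \<Rightarrow> real" where *: "continuous_on UNIV f'" "integrable mT f'" "(LINT z|mT. \<bar>f z - f' z\<bar>) < e/2"
     "continuous_on UNIV g'" "integrable mT g'" "(LINT z|mT. \<bar>g z - g' z\<bar>) < e/2"
    using add(3)[of "e/2"] add(4)[of "e/2"] add(5) by auto
  have "(LINT z|mT. \<bar>(f z + g z) - (f' z + g' z)\<bar>) \<le> (LINT z|mT. \<bar>f z - f' z\<bar> + \<bar>g z - g' z\<bar>)"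
    using * add(1,2) by (intro integral_mono) auto
  also have "\<dots> = (LINT z|mT. \<bar>f z - f' z\<bar>) + (LINT z|mT. \<bar>g z - g' z\<bar>)"
    using * add(1,2) by simp
  also have "\<dots> < e" using * by simp
  finally show ?case using * by (intro exI[of _ "\<lambda>z. f' z + g' z"]) (auto intro!: continuous_intros)
next
  case (lim f s)
  have "(\<lambda>k. LINT z|mT. \<bar>f z - s k z\<bar>) \<longlonglongrightarrow> (LINT z|mT. 0)"
  \<comment> \<open>The simple functions of the induction rule satisfy
    \<open>norm (s k z) \<le> 2 * norm (f z)\<close>, which gives the factor 3.\<close>
  proof (rule integral_dominated_convergence[where w="\<lambda>z. 3 * \<bar>f z\<bar>"])
    have "(\<lambda>k. \<bar>f z - s k z\<bar>) \<longlonglongrightarrow> 0" for z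
      using tendsto_rabs[OF tendsto_diff[OF tendsto_const lim(2)], of z "f z"] by simp
    then show "AE z in mT. (\<lambda>k. \<bar>f z - s k z\<bar>) \<longlonglongrightarrow> 0" by simp
    have "\<bar>f z - s k z\<bar> \<le> 3 * \<bar>f z\<bar>" for k z
      using lim(3)[of z k] by auto
    then show "AE z in mT. norm \<bar>f z - s k z\<bar> \<le> 3 * \<bar>f z\<bar>" for k by simp
  qed (use lim in auto)
  then have "eventually (\<lambda>k. (LINT z|mT. \<bar>f z - s k z\<bar>) < e/2) sequentially"
    using lim(6) by (intro order_tendstoD) auto
  then obtain k where k: "(LINT z|mT. \<bar>f z - s k z\<bar>) < e/2"
    by (auto simp: eventually_sequentially)
  obtain g :: "complex \<Rightarrow> real" where g: "continuous_on UNIV g" "integrable mT g" "(LINT z|mT. \<bar>s k z - g z\<bar>) < e/2"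
    using lim(5)[of "e/2" k] lim(6) by auto
  have "(LINT z|mT. \<bar>f z - g z\<bar>) \<le> (LINT z|mT. \<bar>f z - s k z\<bar> + \<bar>s k z - g z\<bar>)"
    using g lim(1,4) by (intro integral_mono) auto
  also have "\<dots> = (LINT z|mT. \<bar>f z - s k z\<bar>) + (LINT z|mT. \<bar>s k z - g z\<bar>)"
    using g lim(1,4) by simp
  also have "\<dots> < e" using g k by simp
  finally show ?case using g by (intro exI[of _ g] conjI) auto
qed

lemma integrable_Re_poly: "integrable mT (\<lambda>z. Re (poly p z))"
  using integrable_mT_poly by (rule integrable_Re)

text \<open>Approximation in the mean alone would lose the bounds that dominated convergence and the
  outer functions rely on. The continuous approximant is clamped to the range from 0 to
  \<open>C\<close> and the polynomial is raised by its uniform error \<open>d\<close>; positivity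
  survives and the upper bound grows to \<open>C + 1\<close>.\<close>

lemma bounded_approx_Re_poly:
  fixes f :: "complex \<Rightarrow> real"
  assumes [measurable]: "f \<in> borel_measurable borel" and f: "AE z in mT. 0 \<le> f z \<and> f z \<le> C" and "e > 0"
  shows "\<exists>p. (\<forall>z. norm z = 1 \<longrightarrow> 0 \<le> Re (poly p z) \<and> Re (poly p z) \<le> C + 1) \<and>
    (LINT z|mT. \<bar>f z - Re (poly p z)\<bar>) < e"
proof -
  have C: "C \<ge> 0" using AE_mT_ex[OF f] by auto
  have fi: "integrable mT f" using f by (intro integrable_mT_bounded[of _ C]) auto
  obtain g where g: "continuous_on UNIV g" "integrable mT g" "(LINT z|mT. \<bar>f z - g z\<bar>) < e/2"
    using integrable_continuous_approx[OF fi, of "e/2"] \<open>e > 0\<close> by auto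
  define g' where "g' z = max 0 (min C (g z))" for z
  \<comment> \<open>The shift and the uniform error add up to at most \<open>2 * d\<close>, which
    has to fit into the slack 1 of the upper bound and into the remaining half of
    \<open>e\<close>.\<close>
  define d where "d = min (1/2) (e/4)"
  have d: "d > 0" "2 * d \<le> 1" "2 * d \<le> e/2" using \<open>e > 0\<close> by (auto simp: d_def)
  have g': "continuous_on UNIV g'" "integrable mT g'"
    unfolding g'_def using g by (auto intro!: continuous_intros)
  obtain q where q: "\<And>z. norm z = 1 \<Longrightarrow> \<bar>g' z - Re (poly q z)\<bar> < d"
    using continuous_approx_Re_poly[OF g'(1) d(1)] by blast
  define p where "p = q + [:of_real d:]"
  have p: "Re (poly p z) = Re (poly q z) + d" for z by (simp add: p_def)
  have "0 \<le> Re (poly p z) \<and> Re (poly p z) \<le> C + 1" if "norm z = 1" for z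
  proof -
    have "0 \<le> g' z" "g' z \<le> C" using C by (auto simp: g'_def)
    then show ?thesis using q[OF that] d unfolding p by linarith
  qed
  moreover have "(LINT z|mT. \<bar>f z - Re (poly p z)\<bar>) < e"
  proof -
    have "(LINT z|mT. \<bar>f z - Re (poly p z)\<bar>) \<le> (LINT z|mT. \<bar>f z - g z\<bar> + 2 * d)"
    proof (rule integral_mono_AE)
      show "AE z in mT. \<bar>f z - Re (poly p z)\<bar> \<le> \<bar>f z - g z\<bar> + 2 * d"
        using f AE_mT_norm
      proof eventually_elim
        case (elim z)
        have "\<bar>f z - g' z\<bar> \<le> \<bar>f z - g z\<bar>" using elim by (auto simp: g'_def)
        then show ?case using q[OF elim(2)] unfolding p by linarith
      qed
    qed (use fi g integrable_Re_poly in auto)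
    also have "\<dots> = (LINT z|mT. \<bar>f z - g z\<bar>) + 2 * d" using fi g by simp
    also have "\<dots> < e" using g d by linarith
    finally show ?thesis .
  qed
  ultimately show ?thesis by blast
qed

text \<open>Convergence in the mean yields an almost everywhere convergent subsequence. The uniform
  bounds are inherited, so that the limit can be taken under integrals and under
  \<open>\<alpha>\<close>.\<close>

lemma bounded_limit_Re_poly:
  fixes f :: "complex \<Rightarrow> real"
  assumes [measurable]: "f \<in> borel_measurable borel" and f: "AE z in mT. 0 \<le> f z \<and> f z \<le> C"
  shows "\<exists>p. (\<forall>j z. norm z = 1 \<longrightarrow> 0 \<le> Re (poly (p j) z) \<and> Re (poly (p j) z) \<le> C + 1) \<and>
    (AE z in mT. (\<lambda>j. Re (poly (p j) z)) \<longlonglongrightarrow> f z)"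
proof -
  have "\<exists>p. (\<forall>z. norm z = 1 \<longrightarrow> 0 \<le> Re (poly p z) \<and> Re (poly p z) \<le> C + 1) \<and>
    (LINT z|mT. \<bar>f z - Re (poly p z)\<bar>) < 1 / real (Suc j)" for j
    using assms by (intro bounded_approx_Re_poly) auto
  then obtain p where p: "\<And>j z. norm z = 1 \<Longrightarrow> 0 \<le> Re (poly (p j) z) \<and> Re (poly (p j) z) \<le> C + 1"
    "\<And>j. (LINT z|mT. \<bar>f z - Re (poly (p j) z)\<bar>) < 1 / real (Suc j)" by metis
  have fi: "integrable mT f" using f by (intro integrable_mT_bounded[of _ C]) auto
  have "(\<lambda>j. LINT z|mT. norm (f z - Re (poly (p j) z))) \<longlonglongrightarrow> 0"
  proof (rule tendsto_sandwich[OF _ _ tendsto_const LIMSEQ_Suc[OF lim_1_over_n]])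
    show "\<forall>\<^sub>F j in sequentially. (LINT z|mT. norm (f z - Re (poly (p j) z))) \<le> 1 / real (Suc j)"
      using p(2) by (auto intro!: always_eventually less_imp_le)
  qed auto
  then obtain r :: "nat \<Rightarrow> nat" where "AE z in mT. (\<lambda>j. f z - Re (poly (p (r j)) z)) \<longlonglongrightarrow> 0"
    using tendsto_L1_AE_subseq[of mT "\<lambda>j z. f z - Re (poly (p j) z)"] fi integrable_Re_poly by auto
  then have "AE z in mT. (\<lambda>j. Re (poly (p (r j)) z)) \<longlonglongrightarrow> f z"
  proof eventually_elim
    case (elim z)
    from tendsto_diff[OF tendsto_const[of "f z"] this] show ?case by simp
  qed
  then show ?thesis using p(1) by (intro exI[of _ "\<lambda>j. p (r j)"]) auto
qed

lemma integrable_mult_bounded: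
  fixes f g :: "complex \<Rightarrow> complex"
  assumes f: "integrable mT f" and [measurable]: "g \<in> borel_measurable borel" and g: "AE z in mT. norm (g z) \<le> C"
  shows "integrable mT (\<lambda>z. f z * g z)"
proof (rule Bochner_Integration.integrable_bound[OF integrable_mult_right[OF integrable_norm[OF f], of C]])
  note [measurable] = borel_measurable_integrable[OF f]
  show "(\<lambda>z. f z * g z) \<in> borel_measurable mT" by measurable
  show "AE z in mT. norm (f z * g z) \<le> norm (C * norm (f z))"
    using g
  proof eventually_elim
    case (elim z)
    show ?case using mult_left_mono[OF elim norm_ge_zero[of "f z"]] by (simp add: norm_mult mult.commute)
  qed
qed

text \<open>\<open>f\<close> annihilates every \<open>Re (poly p z)\<close>, hence, by bounded
  almost everywhere limits, every Borel function with values between 0 and 1. Indicators of the sets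
  where \<open>f\<close> lies in an open half-plane then force \<open>f\<close> to vanish.\<close>

lemma AE_zero_of_moments:
  fixes f :: "complex \<Rightarrow> complex"
  assumes fi: "integrable mT f" and pos: "\<And>j. (LINT z|mT. f z * z ^ j) = 0"
    and neg: "\<And>j. (LINT z|mT. f z * cnj z ^ j) = 0"
  shows "AE z in mT. f z = 0"
proof -
  have [measurable]: "f \<in> borel_measurable borel" using fi by auto
  note bi = integrable_mult_bounded[OF fi]
  have zi: "integrable mT (\<lambda>z. f z * z ^ j)" "integrable mT (\<lambda>z. f z * cnj z ^ j)" for j
    using AE_mT_norm by (auto intro!: bi[where C=1] simp: norm_power)
  have p: "(LINT z|mT. f z * poly p z) = 0" for p
  proof -
    have "(LINT z|mT. f z * poly p z) = (LINT z|mT. (\<Sum>i\<le>degree p. coeff p i * (f z * z ^ i)))"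
      by (intro Bochner_Integration.integral_cong) (auto simp: poly_altdef sum_distrib_left mult_ac)
    also have "\<dots> = 0" using zi pos by simp
    finally show ?thesis .
  qed
  have q: "(LINT z|mT. f z * cnj (poly p z)) = 0" for p
  proof -
    have "(LINT z|mT. f z * cnj (poly p z)) = (LINT z|mT. (\<Sum>i\<le>degree p. cnj (coeff p i) * (f z * cnj z ^ i)))"
      by (intro Bochner_Integration.integral_cong) (auto simp: poly_altdef sum_distrib_left mult_ac)
    also have "\<dots> = 0" using zi neg by simp
    finally show ?thesis .
  qed
  have r: "(LINT z|mT. f z * of_real (Re (poly p z))) = 0" for p
  proof -
    obtain C where C: "\<And>z. norm z = 1 \<Longrightarrow> norm (poly p z) \<le> C"
      using poly_bounded_circle[of p] by auto
    have "(LINT z|mT. f z * of_real (Re (poly p z))) = (LINT z|mT. (f z * poly p z + f z * cnj (poly p z)) / 2)"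
    proof (intro Bochner_Integration.integral_cong refl)
      fix z show "f z * of_real (Re (poly p z)) = (f z * poly p z + f z * cnj (poly p z)) / 2"
        using complex_add_cnj[of "poly p z"] by (simp flip: distrib_left)
    qed
    also have "\<dots> = 0"
    proof -
      have C': "AE z in mT. norm (poly p z) \<le> C" using AE_mT_norm by eventually_elim (rule C)
      show ?thesis using bi[of "poly p" C] bi[of "\<lambda>z. cnj (poly p z)" C] C' by (simp add: p q)
    qed
    finally show ?thesis .
  qed
  have s: "(LINT z|mT. f z * of_real (g z)) = 0"
    if gm [measurable]: "g \<in> borel_measurable borel" and g: "AE z in mT. 0 \<le> g z \<and> g z \<le> 1" for g
  proof -
    obtain p where pb: "\<forall>j z. norm z = 1 \<longrightarrow> 0 \<le> Re (poly (p j) z) \<and> Re (poly (p j) z) \<le> 1 + 1"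
      and pl: "AE z in mT. (\<lambda>j. Re (poly (p j) z)) \<longlonglongrightarrow> g z"
      using bounded_limit_Re_poly[OF gm g] by (elim exE conjE)
    have "(\<lambda>j. LINT z|mT. f z * of_real (Re (poly (p j) z))) \<longlonglongrightarrow> (LINT z|mT. f z * of_real (g z))"
    proof (rule integral_dominated_convergence[where w="\<lambda>z. 2 * norm (f z)"])
      show "AE z in mT. (\<lambda>j. f z * of_real (Re (poly (p j) z))) \<longlonglongrightarrow> f z * of_real (g z)"
        using pl by eventually_elim (auto intro!: tendsto_intros)
      show "AE z in mT. norm (f z * of_real (Re (poly (p j) z))) \<le> 2 * norm (f z)" for j
        using AE_mT_norm
      proof eventually_elim
        case (elim z)
        have "\<bar>Re (poly (p j) z)\<bar> \<le> 2" using pb elim by auto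
        then show ?case using mult_left_mono[of "\<bar>Re (poly (p j) z)\<bar>" 2 "norm (f z)"] by (simp add: norm_mult)
      qed
    qed (use fi in auto)
    then show ?thesis by (simp add: r LIMSEQ_const_iff)
  qed
  \<comment> \<open>Testing against the indicator of \<open>Re (c * f z) > 0\<close> produces the
    integral of the positive part of \<open>Re (c * f z)\<close>, which therefore vanishes.\<close>
  have half: "AE z in mT. Re (c * f z) \<le> 0" for c
  proof -
    have "(LINT z|mT. f z * of_real (indicator {z. Re (c * f z) > 0} z)) = 0"
      by (rule s) (auto simp: indicator_def)
    then have "c * (LINT z|mT. f z * of_real (indicator {z. Re (c * f z) > 0} z)) = 0" by simp
    then have "(LINT z|mT. c * (f z * of_real (indicator {z. Re (c * f z) > 0} z))) = 0" by simp
    then have "Re (LINT z|mT. c * (f z * of_real (indicator {z. Re (c * f z) > 0} z))) = 0"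
      by (simp only: zero_complex.simps)
    moreover have ii: "integrable mT (\<lambda>z. c * (f z * of_real (indicator {z. Re (c * f z) > 0} z)))"
      by (intro integrable_mult_right bi[where C=1]) (auto simp: indicator_def)
    ultimately have "(LINT z|mT. Re (c * (f z * of_real (indicator {z. Re (c * f z) > 0} z)))) = 0"
      by (subst integral_Re) auto
    moreover have "Re (c * (f z * of_real (indicator {z. Re (c * f z) > 0} z))) = max 0 (Re (c * f z))" for z
      by (auto simp: indicator_def max_def)
    ultimately have "(LINT z|mT. max 0 (Re (c * f z))) = 0" by simp
    then have "AE z in mT. max 0 (Re (c * f z)) = 0"
      using fi by (subst (asm) integral_nonneg_eq_0_iff_AE) auto
    then show ?thesis by eventually_elim (auto simp: max_def split: if_splits)
  qed
  \<comment> \<open>The four values of \<open>c\<close> bound the real and the imaginary part of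
    \<open>f\<close> by 0 from both sides.\<close>
  show ?thesis
    using half[of 1] half[of "-1"] half[of "\<i>"] half[of "-\<i>"]
    by eventually_elim (auto simp: complex_eq_iff)
qed

section \<open>Square-integrable functions\<close>

definition L2 :: "(complex \<Rightarrow> complex) set" where
  "L2 = {f. f \<in> borel_measurable borel \<and> integrable mT (\<lambda>z. (norm (f z))\<^sup>2)}"

text \<open>The square of the L2 norm. Most estimates are kept in squared form, where a weaker
  inequality with factor 2 replaces the triangle inequality.\<close>

definition sqn :: "(complex \<Rightarrow> complex) \<Rightarrow> real" where
  "sqn f = (LINT z|mT. (norm (f z))\<^sup>2)"

definition ip :: "(complex \<Rightarrow> complex) \<Rightarrow> (complex \<Rightarrow> complex) \<Rightarrow> complex" where
  "ip f g = (LINT z|mT. f z * cnj (g z))"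

lemma L2D: "f \<in> L2 \<Longrightarrow> f \<in> borel_measurable borel" "f \<in> L2 \<Longrightarrow> integrable mT (\<lambda>z. (norm (f z))\<^sup>2)"
  by (auto simp: L2_def)

lemma sqn_nonneg [simp]: "0 \<le> sqn f"
  by (simp add: sqn_def)

lemma two_mult_le_squares: "2 * (a * b) \<le> a\<^sup>2 + (b\<^sup>2 :: real)"
  using zero_le_power2[of "a - b"] by (simp add: power2_eq_square algebra_simps)

lemma norm_add_square_le: "(norm (a + b))\<^sup>2 \<le> 2 * (norm a)\<^sup>2 + 2 * (norm (b :: complex))\<^sup>2"
proof -
  have "(norm (a + b))\<^sup>2 \<le> (norm a + norm b)\<^sup>2"
    by (intro power_mono norm_triangle_ineq norm_ge_zero)
  also have "\<dots> \<le> 2 * (norm a)\<^sup>2 + 2 * (norm b)\<^sup>2"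
    using two_mult_le_squares[of "norm a" "norm b"] by (simp add: power2_sum)
  finally show ?thesis .
qed

lemma L2_norm_mult_integrable:
  assumes "f \<in> L2" "g \<in> L2"
  shows "integrable mT (\<lambda>z. norm (f z) * norm (g z))"
proof (rule Bochner_Integration.integrable_bound)
  note [measurable] = L2D(1)[OF assms(1)] L2D(1)[OF assms(2)]
  show "integrable mT (\<lambda>z. (norm (f z))\<^sup>2 + (norm (g z))\<^sup>2)"
    using assms by (auto intro: L2D)
  show "(\<lambda>z. norm (f z) * norm (g z)) \<in> borel_measurable mT" by simp
  have "norm (f z) * norm (g z) \<le> (norm (f z))\<^sup>2 + (norm (g z))\<^sup>2" for z
    using two_mult_le_squares[of "norm (f z)" "norm (g z)"] zero_le_power2[of "norm (f z)"] zero_le_power2[of "norm (g z)"]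
    by linarith
  then show "AE z in mT. norm (norm (f z) * norm (g z)) \<le> norm ((norm (f z))\<^sup>2 + (norm (g z))\<^sup>2)"
    by (simp add: abs_mult)
qed

lemma L2_mult_integrable:
  assumes "f \<in> L2" "g \<in> L2"
  shows "integrable mT (\<lambda>z. f z * g z)"
proof (rule Bochner_Integration.integrable_bound[OF L2_norm_mult_integrable[OF assms]])
  show "(\<lambda>z. f z * g z) \<in> borel_measurable mT" using assms[THEN L2D(1)] by simp
qed (simp add: norm_mult)

lemma L2_mult_bounded:
  assumes f: "f \<in> L2" and [measurable]: "g \<in> borel_measurable borel" and g: "AE z in mT. norm (g z) \<le> C"
  shows "(\<lambda>z. g z * f z) \<in> L2" "sqn (\<lambda>z. g z * f z) \<le> C\<^sup>2 * sqn f"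
proof -
  note [measurable] = L2D(1)[OF f]
  have b: "AE z in mT. (norm (g z * f z))\<^sup>2 \<le> C\<^sup>2 * (norm (f z))\<^sup>2"
    using g
  proof eventually_elim
    case (elim z)
    then have "norm (g z * f z) \<le> C * norm (f z)" by (simp add: norm_mult mult_right_mono)
    then show ?case by (metis norm_ge_zero power_mono power_mult_distrib)
  qed
  have i: "integrable mT (\<lambda>z. C\<^sup>2 * (norm (f z))\<^sup>2)" using L2D(2)[OF f] by simp
  show L: "(\<lambda>z. g z * f z) \<in> L2"
    unfolding L2_def using b by (auto intro!: Bochner_Integration.integrable_bound[OF i])
  show "sqn (\<lambda>z. g z * f z) \<le> C\<^sup>2 * sqn f"
    unfolding sqn_def using integral_mono_AE[OF L2D(2)[OF L] i b] by simp
qed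

lemma bounded_L2:
  assumes "f \<in> borel_measurable borel" "AE z in mT. norm (f z) \<le> C"
  shows "f \<in> L2"
proof -
  have "(\<lambda>_. 1) \<in> L2" by (simp add: L2_def)
  from L2_mult_bounded(1)[OF this assms] show ?thesis by simp
qed

lemma L2_const [simp]: "(\<lambda>_. c) \<in> L2"
  by (simp add: L2_def)

lemma L2_scale: "f \<in> L2 \<Longrightarrow> (\<lambda>z. c * f z) \<in> L2"
  by (rule L2_mult_bounded(1)[of f "\<lambda>_. c" "norm c"]) auto

lemma L2_add:
  assumes "f \<in> L2" "g \<in> L2" shows "(\<lambda>z. f z + g z) \<in> L2"
proof -
  note [measurable] = L2D(1)[OF assms(1)] L2D(1)[OF assms(2)]
  have i: "integrable mT (\<lambda>z. 2 * (norm (f z))\<^sup>2 + 2 * (norm (g z))\<^sup>2)"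
    using L2D(2)[OF assms(1)] L2D(2)[OF assms(2)] by simp
  show ?thesis
    unfolding L2_def using norm_add_square_le by (auto intro!: Bochner_Integration.integrable_bound[OF i])
qed

lemma L2_diff:
  assumes "f \<in> L2" "g \<in> L2" shows "(\<lambda>z. f z - g z) \<in> L2"
  using L2_add[OF assms(1) L2_scale[OF assms(2), of "-1"]] by simp

lemma L2_cnj: "f \<in> L2 \<Longrightarrow> (\<lambda>z. cnj (f z)) \<in> L2"
  by (auto simp: L2_def)

lemma L2_integrable: "f \<in> L2 \<Longrightarrow> integrable mT f"
  using L2_mult_integrable[of f "\<lambda>_. 1"] by simp

lemma L2_poly: "poly p \<in> L2"
proof -
  obtain C where C: "\<And>z. norm z = 1 \<Longrightarrow> norm (poly p z) \<le> C"
    using poly_bounded_circle[of p] by auto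
  have "AE z in mT. norm (poly p z) \<le> C" using AE_mT_norm by eventually_elim (rule C)
  then show ?thesis by (intro bounded_L2) auto
qed

lemma L2_AE_cong:
  assumes "f \<in> L2" "AE z in mT. f z = g z" and [measurable]: "g \<in> borel_measurable borel"
  shows "g \<in> L2" "sqn g = sqn f"
proof -
  note [measurable] = L2D(1)[OF assms(1)]
  have eq: "AE z in mT. (norm (f z))\<^sup>2 = (norm (g z))\<^sup>2" using assms(2) by eventually_elim simp
  show "g \<in> L2" unfolding L2_def using integrable_cong_AE_imp[OF L2D(2)[OF assms(1)] _ eq] by simp
  show "sqn g = sqn f" unfolding sqn_def using eq by (intro integral_cong_AE) auto
qed

lemma L2_ip_integrable: "f \<in> L2 \<Longrightarrow> g \<in> L2 \<Longrightarrow> integrable mT (\<lambda>z. f z * cnj (g z))"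
  by (intro L2_mult_integrable L2_cnj)

lemma ip_diff_left: "f \<in> L2 \<Longrightarrow> g \<in> L2 \<Longrightarrow> h \<in> L2 \<Longrightarrow> ip (\<lambda>z. f z - g z) h = ip f h - ip g h"
  using L2_ip_integrable[of f h] L2_ip_integrable[of g h] by (simp add: ip_def left_diff_distrib)

lemma ip_scale_left: "ip (\<lambda>z. c * f z) h = c * ip f h"
  by (simp add: ip_def mult.assoc)

lemma ip_commute: "ip f g = cnj (ip g f)"
  unfolding ip_def Bochner_Integration.integral_cnj[symmetric] by (simp add: mult.commute)

lemma ip_scale_right: "ip f (\<lambda>z. c * h z) = cnj c * ip f h"
  by (subst (1 2) ip_commute) (simp add: ip_scale_left)

lemma ip_self: "ip f f = of_real (sqn f)"
  unfolding ip_def sqn_def integral_complex_of_real[symmetric] by (simp only: complex_norm_square)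

lemma sqn_add:
  assumes "f \<in> L2" "g \<in> L2"
  shows "sqn (\<lambda>z. f z + g z) = sqn f + 2 * Re (ip f g) + sqn g"
proof -
  have i: "integrable mT (\<lambda>z. f z * cnj (g z))" using assms by (rule L2_ip_integrable)
  define R where "R z = Re (f z * cnj (g z))" for z
  have R: "integrable mT R" unfolding R_def using i by (rule integrable_Re)
  have "sqn (\<lambda>z. f z + g z) = (LINT z|mT. (norm (f z))\<^sup>2 + 2 * R z + (norm (g z))\<^sup>2)"
    unfolding sqn_def cmod_power2 R_def
    by (intro Bochner_Integration.integral_cong) (auto simp: power2_eq_square algebra_simps)
  also have "\<dots> = sqn f + 2 * (LINT z|mT. R z) + sqn g"
    using L2D(2)[OF assms(1)] L2D(2)[OF assms(2)] R by (simp add: sqn_def)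
  also have "(LINT z|mT. R z) = Re (ip f g)"
    unfolding ip_def R_def by (rule integral_Re[OF i])
  finally show ?thesis .
qed

lemma sqn_scale: "sqn (\<lambda>z. c * f z) = (norm c)\<^sup>2 * sqn f"
  by (simp add: sqn_def norm_mult power_mult_distrib)

lemma sqn_diff:
  assumes "f \<in> L2" "g \<in> L2"
  shows "sqn (\<lambda>z. f z - g z) = sqn f - 2 * Re (ip f g) + sqn g"
  using sqn_add[OF assms(1) L2_scale[OF assms(2), of "-1"], unfolded ip_scale_right sqn_scale] by simp

lemma sqn_commute: "sqn (\<lambda>z. f z - g z) = sqn (\<lambda>z. g z - f z)"
  by (simp add: sqn_def norm_minus_commute)

lemma sqn_parallelogram:
  "f \<in> L2 \<Longrightarrow> g \<in> L2 \<Longrightarrow> sqn (\<lambda>z. f z + g z) + sqn (\<lambda>z. f z - g z) = 2 * sqn f + 2 * sqn g"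
  by (simp add: sqn_add sqn_diff)

lemma sqn_add_le:
  "f \<in> L2 \<Longrightarrow> g \<in> L2 \<Longrightarrow> sqn (\<lambda>z. f z + g z) \<le> 2 * sqn f + 2 * sqn g"
  using sqn_parallelogram[of f g] sqn_nonneg[of "\<lambda>z. f z - g z"] by linarith

lemma sqn_triangle_le:
  assumes "f \<in> L2" "g \<in> L2" "h \<in> L2"
  shows "sqn (\<lambda>z. f z - h z) \<le> 2 * sqn (\<lambda>z. f z - g z) + 2 * sqn (\<lambda>z. g z - h z)"
  using sqn_add_le[OF L2_diff[OF assms(1,2)] L2_diff[OF assms(2,3)]] by simp

lemma sqn_eq_0_iff: "f \<in> L2 \<Longrightarrow> sqn f = 0 \<longleftrightarrow> (AE z in mT. f z = 0)"
  unfolding sqn_def using integral_nonneg_eq_0_iff_AE[OF L2D(2)[of f]] by simp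

lemma Cauchy_Schwarz_mT:
  assumes "f \<in> L2" "g \<in> L2"
  shows "(LINT z|mT. norm (f z) * norm (g z)) \<le> sqrt (sqn f) * sqrt (sqn g)"
proof (cases "sqn g = 0")
  case True
  then have "AE z in mT. g z = 0" using sqn_eq_0_iff assms by auto
  then have "(LINT z|mT. norm (f z) * norm (g z)) = (LINT z|mT. 0)"
    using assms[THEN L2D(1)] by (intro integral_cong_AE) auto
  then show ?thesis by simp
next
  case False
  then have pos: "sqn g > 0" using sqn_nonneg[of g] by linarith
  define I where "I = (LINT z|mT. norm (f z) * norm (g z))"
  \<comment> \<open>The minimiser of the quadratic in \<open>t\<close> below; expanding there leaves
    \<open>sqn f - I^2 / sqn g\<close>, whose sign is the claim.\<close>
  define t where "t = I / sqn g"
  note int = L2D(2)[OF assms(1)] L2D(2)[OF assms(2)] L2_norm_mult_integrable[OF assms]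
  have "0 \<le> (LINT z|mT. (norm (f z) - t * norm (g z))\<^sup>2)" by simp
  also have "\<dots> = (LINT z|mT. (norm (f z))\<^sup>2 - 2 * t * (norm (f z) * norm (g z)) + t\<^sup>2 * (norm (g z))\<^sup>2)"
    by (intro Bochner_Integration.integral_cong) (auto simp: power2_eq_square algebra_simps)
  also have "\<dots> = sqn f - 2 * t * I + t\<^sup>2 * sqn g"
    using int by (simp add: sqn_def I_def)
  also have "\<dots> = sqn f - I\<^sup>2 / sqn g"
    using pos by (simp add: t_def power2_eq_square field_simps)
  finally have "I\<^sup>2 \<le> sqn f * sqn g" using pos by (simp add: field_simps)
  then have "I \<le> sqrt (sqn f * sqn g)" by (rule real_le_rsqrt)
  then show ?thesis by (simp add: I_def real_sqrt_mult)
qed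

lemma integral_norm_le_sqn: "f \<in> L2 \<Longrightarrow> (LINT z|mT. norm (f z)) \<le> sqrt (sqn f)"
  using Cauchy_Schwarz_mT[of f "\<lambda>_. 1"] by (simp add: sqn_def)

lemma norm_ip_le:
  assumes "f \<in> L2" "g \<in> L2"
  shows "norm (ip f g) \<le> sqrt (sqn f) * sqrt (sqn g)"
proof -
  have "norm (ip f g) \<le> (LINT z|mT. norm (f z * cnj (g z)))"
    unfolding ip_def by (rule integral_norm_bound)
  also have "\<dots> \<le> sqrt (sqn f) * sqrt (sqn g)"
    using Cauchy_Schwarz_mT[OF assms] by (simp add: norm_mult)
  finally show ?thesis .
qed

text \<open>The argument of Riesz and Fischer: an L2-Cauchy sequence is Cauchy in L1, so a
  subsequence converges almost everywhere, and Fatou's lemma shows that its limit is the L2 limit of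
  the whole sequence.\<close>

lemma L2_complete:
  assumes s: "\<And>i. s i \<in> L2"
    and C: "\<And>e. e > 0 \<Longrightarrow> \<exists>N. \<forall>i\<ge>N. \<forall>j\<ge>N. sqn (\<lambda>z. s i z - s j z) < e"
  shows "\<exists>f\<in>L2. (\<lambda>i. sqn (\<lambda>z. s i z - f z)) \<longlonglongrightarrow> 0"
proof -
  note [measurable] = L2D(1)[OF s]
  have "\<exists>N. \<forall>i\<ge>N. \<forall>j\<ge>N. (LINT z|mT. norm (s i z - s j z)) < e" if e: "e > 0" for e
  proof -
    obtain N where N: "\<forall>i\<ge>N. \<forall>j\<ge>N. sqn (\<lambda>z. s i z - s j z) < e\<^sup>2"
      using C[of "e\<^sup>2"] e by auto
    have "(LINT z|mT. norm (s i z - s j z)) < e" if "i \<ge> N" "j \<ge> N" for i j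
    proof -
      have "(LINT z|mT. norm (s i z - s j z)) \<le> sqrt (sqn (\<lambda>z. s i z - s j z))"
        by (intro integral_norm_le_sqn L2_diff s)
      also have "\<dots> < e" using N that \<open>e > 0\<close> by (intro real_less_lsqrt) auto
      finally show ?thesis .
    qed
    then show ?thesis by (intro exI[of _ N]) auto
  qed
  then obtain r where r: "strict_mono r" "AE z in mT. Cauchy (\<lambda>i. s (r i) z)"
    using cauchy_L1_AE_cauchy_subseq[of mT s] L2_integrable[OF s] by metis
  define f where "f z = lim (\<lambda>i. s (r i) z)" for z
  have [measurable]: "f \<in> borel_measurable borel" unfolding f_def by measurable
  have lim: "AE z in mT. (\<lambda>i. s (r i) z) \<longlonglongrightarrow> f z"
    using r(2) by eventually_elim (simp add: f_def Cauchy_convergent_iff convergent_LIMSEQ_iff)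
  \<comment> \<open>Only the second index runs through the subsequence; \<open>i\<close> stays an
    index of the full sequence, so the bound already speaks of the full sequence.\<close>
  have fatou: "(\<integral>\<^sup>+ z. ennreal ((norm (s i z - f z))\<^sup>2) \<partial>mT) \<le> ennreal e"
    if N: "\<forall>i\<ge>N. \<forall>j\<ge>N. sqn (\<lambda>z. s i z - s j z) < e" and "i \<ge> N" for i N e
  proof -
    have "(\<integral>\<^sup>+ z. ennreal ((norm (s i z - f z))\<^sup>2) \<partial>mT)
      = (\<integral>\<^sup>+ z. liminf (\<lambda>j. ennreal ((norm (s i z - s (r j) z))\<^sup>2)) \<partial>mT)"
    proof (intro nn_integral_cong_AE)
      show "AE z in mT. ennreal ((norm (s i z - f z))\<^sup>2) = liminf (\<lambda>j. ennreal ((norm (s i z - s (r j) z))\<^sup>2))"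
        using lim
      proof eventually_elim
        case (elim z)
        then have "(\<lambda>j. ennreal ((norm (s i z - s (r j) z))\<^sup>2)) \<longlonglongrightarrow> ennreal ((norm (s i z - f z))\<^sup>2)"
          by (intro tendsto_intros)
        from lim_imp_Liminf[OF trivial_limit_sequentially this] show ?case by (rule sym)
      qed
    qed
    also have "\<dots> \<le> liminf (\<lambda>j. \<integral>\<^sup>+ z. ennreal ((norm (s i z - s (r j) z))\<^sup>2) \<partial>mT)"
      by (intro nn_integral_liminf) auto
    also have "\<dots> \<le> ennreal e"
    proof (rule Liminf_le)
      have "(\<integral>\<^sup>+ z. ennreal ((norm (s i z - s (r j) z))\<^sup>2) \<partial>mT) \<le> ennreal e" if "j \<ge> N" for j
      proof -
        have "r j \<ge> N" using seq_suble[OF r(1), of j] that by linarith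
        then have "sqn (\<lambda>z. s i z - s (r j) z) < e" using N \<open>i \<ge> N\<close> by auto
        moreover have "(\<integral>\<^sup>+ z. ennreal ((norm (s i z - s (r j) z))\<^sup>2) \<partial>mT) = ennreal (sqn (\<lambda>z. s i z - s (r j) z))"
          unfolding sqn_def by (intro nn_integral_eq_integral L2D(2) L2_diff s) auto
        ultimately show ?thesis by (simp add: ennreal_leI)
      qed
      then show "\<forall>\<^sub>F j in sequentially. (\<integral>\<^sup>+ z. ennreal ((norm (s i z - s (r j) z))\<^sup>2) \<partial>mT) \<le> ennreal e"
        unfolding eventually_sequentially by blast
    qed simp
    finally show ?thesis .
  qed
  have L: "(\<lambda>z. s i z - f z) \<in> L2" if N: "\<forall>i\<ge>N. \<forall>j\<ge>N. sqn (\<lambda>z. s i z - s j z) < e" and "i \<ge> N" for i N e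
    unfolding L2_def using fatou[OF that] by (auto simp: integrable_iff_bounded intro: le_less_trans)
  obtain N where N: "\<forall>i\<ge>N. \<forall>j\<ge>N. sqn (\<lambda>z. s i z - s j z) < 1" using C[of 1] by auto
  \<comment> \<open>The limit is square integrable because it differs from \<open>s N\<close> by a
    function whose norm the Fatou bound makes finite.\<close>
  have "(\<lambda>z. s N z - (s N z - f z)) \<in> L2" by (intro L2_diff s L[OF N]) simp
  then have fL: "f \<in> L2" by simp
  have "(\<lambda>i. sqn (\<lambda>z. s i z - f z)) \<longlonglongrightarrow> 0"
  proof (rule LIMSEQ_I)
    fix e :: real assume "e > 0"
    then obtain N where N: "\<forall>i\<ge>N. \<forall>j\<ge>N. sqn (\<lambda>z. s i z - s j z) < e/2" using C[of "e/2"] by auto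
    have "norm (sqn (\<lambda>z. s i z - f z) - 0) < e" if "i \<ge> N" for i
    proof -
      have "ennreal (sqn (\<lambda>z. s i z - f z)) = (\<integral>\<^sup>+ z. ennreal ((norm (s i z - f z))\<^sup>2) \<partial>mT)"
        unfolding sqn_def by (intro nn_integral_eq_integral[symmetric] L2D(2) L2_diff s fL) auto
      also have "\<dots> \<le> ennreal (e/2)" by (rule fatou[OF N that])
      finally have "sqn (\<lambda>z. s i z - f z) \<le> e/2" using \<open>e > 0\<close> by (simp add: ennreal_le_iff)
      then show ?thesis using \<open>e > 0\<close> by simp
    qed
    then show "\<exists>N. \<forall>i\<ge>N. norm (sqn (\<lambda>z. s i z - f z) - 0) < e" by (intro exI[of _ N]) auto
  qed
  then show ?thesis using fL by (intro bexI)
qed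

section \<open>Closed subspaces of L2 and orthogonal projection\<close>

definition L2_subspace :: "(complex \<Rightarrow> complex) set \<Rightarrow> bool" where
  "L2_subspace K \<longleftrightarrow> K \<subseteq> L2 \<and> (\<lambda>_. 0) \<in> K \<and> (\<forall>f\<in>K. \<forall>g\<in>K. (\<lambda>z. f z + g z) \<in> K) \<and>
     (\<forall>f\<in>K. \<forall>c. (\<lambda>z. c * f z) \<in> K)"

definition L2_closed :: "(complex \<Rightarrow> complex) set \<Rightarrow> bool" where
  "L2_closed K \<longleftrightarrow> (\<forall>f\<in>L2. (\<forall>e>0. \<exists>g\<in>K. sqn (\<lambda>z. f z - g z) < e) \<longrightarrow> f \<in> K)"

definition L2_closure :: "(complex \<Rightarrow> complex) set \<Rightarrow> (complex \<Rightarrow> complex) set" where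
  "L2_closure S = {f \<in> L2. \<forall>e>0. \<exists>g\<in>S. sqn (\<lambda>z. f z - g z) < e}"

lemma L2_closedD:
  assumes "L2_closed K" "f \<in> L2" "\<And>e. e > 0 \<Longrightarrow> \<exists>g\<in>K. sqn (\<lambda>z. f z - g z) < e"
  shows "f \<in> K"
  using assms by (simp add: L2_closed_def)

lemma L2_subspaceD:
  assumes "L2_subspace K"
  shows "f \<in> K \<Longrightarrow> f \<in> L2" "(\<lambda>_. 0) \<in> K" "f \<in> K \<Longrightarrow> g \<in> K \<Longrightarrow> (\<lambda>z. f z + g z) \<in> K"
    "f \<in> K \<Longrightarrow> (\<lambda>z. c * f z) \<in> K"
  using assms by (auto simp: L2_subspace_def)

lemma L2_subspace_diff:
  assumes "L2_subspace K" "f \<in> K" "g \<in> K"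
  shows "(\<lambda>z. f z - g z) \<in> K"
  using L2_subspaceD(3)[OF assms(1,2) L2_subspaceD(4)[OF assms(1,3), of "-1"]] by simp

lemma L2_subspace_sum:
  assumes "L2_subspace K"
  shows "(\<And>i. i \<in> I \<Longrightarrow> f i \<in> K) \<Longrightarrow> (\<lambda>z. \<Sum>i\<in>I. f i z) \<in> K"
  by (induction I rule: infinite_finite_induct) (auto intro: L2_subspaceD[OF assms])

lemma L2_closure_mono:
  assumes "S \<subseteq> L2" "f \<in> S" shows "f \<in> L2_closure S"
proof -
  have "sqn (\<lambda>z. f z - f z) = 0" by (simp add: sqn_def)
  then show ?thesis unfolding L2_closure_def using assms by (auto intro!: bexI[of _ f])
qed

lemma L2_closed_closure:
  assumes "S \<subseteq> L2" shows "L2_closed (L2_closure S)"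
  unfolding L2_closed_def
proof (intro ballI impI)
  fix f assume f: "f \<in> L2" "\<forall>e>0. \<exists>g\<in>L2_closure S. sqn (\<lambda>z. f z - g z) < e"
  have "\<exists>h\<in>S. sqn (\<lambda>z. f z - h z) < e" if e: "e > 0" for e
  proof -
    obtain g where g: "g \<in> L2_closure S" "sqn (\<lambda>z. f z - g z) < e/4" using f(2)[rule_format, of "e/4"] e by auto
    then obtain h where h: "h \<in> S" "sqn (\<lambda>z. g z - h z) < e/4"
      unfolding L2_closure_def using e by (auto dest!: spec[of _ "e/4"])
    have "sqn (\<lambda>z. f z - h z) \<le> 2 * sqn (\<lambda>z. f z - g z) + 2 * sqn (\<lambda>z. g z - h z)"
      using f g h assms by (intro sqn_triangle_le) (auto simp: L2_closure_def)
    also have "\<dots> < e" using g h by linarith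
    finally show ?thesis using h(1) by (intro bexI)
  qed
  then show "f \<in> L2_closure S" using f(1) by (simp add: L2_closure_def)
qed

lemma L2_subspace_closure:
  assumes S: "L2_subspace S" shows "L2_subspace (L2_closure S)"
  unfolding L2_subspace_def
proof (intro conjI ballI allI)
  note D = L2_subspaceD[OF S]
  show "L2_closure S \<subseteq> L2" by (auto simp: L2_closure_def)
  show "(\<lambda>_. 0) \<in> L2_closure S" using D by (intro L2_closure_mono) auto
  show "(\<lambda>z. f z + g z) \<in> L2_closure S" if fg: "f \<in> L2_closure S" "g \<in> L2_closure S" for f g
    unfolding L2_closure_def
  proof (intro CollectI conjI allI impI)
    have L: "f \<in> L2" "g \<in> L2" using fg by (auto simp: L2_closure_def)
    then show "(\<lambda>z. f z + g z) \<in> L2" by (rule L2_add)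
    fix e :: real assume "e > 0"
    then obtain f' g' where *: "f' \<in> S" "sqn (\<lambda>z. f z - f' z) < e/4" "g' \<in> S" "sqn (\<lambda>z. g z - g' z) < e/4"
      using fg unfolding L2_closure_def by (auto dest!: spec[of _ "e/4"])
    have "sqn (\<lambda>z. (f z - f' z) + (g z - g' z)) \<le> 2 * sqn (\<lambda>z. f z - f' z) + 2 * sqn (\<lambda>z. g z - g' z)"
      using * D L by (intro sqn_add_le L2_diff) auto
    also have "\<dots> < e" using * by linarith
    finally show "\<exists>h\<in>S. sqn (\<lambda>z. f z + g z - h z) < e"
      using D(3)[OF *(1,3)] by (intro bexI) (auto simp: algebra_simps)
  qed
  show "(\<lambda>z. c * f z) \<in> L2_closure S" if f: "f \<in> L2_closure S" for f c
    unfolding L2_closure_def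
  proof (intro CollectI conjI allI impI)
    show "(\<lambda>z. c * f z) \<in> L2" using f by (auto simp: L2_closure_def intro: L2_scale)
    fix e :: real assume "e > 0"
    then have "e / ((norm c)\<^sup>2 + 1) > 0" by (simp add: add_nonneg_pos)
    then obtain g where g: "g \<in> S" "sqn (\<lambda>z. f z - g z) < e / ((norm c)\<^sup>2 + 1)"
      using f unfolding L2_closure_def by auto
    have "sqn (\<lambda>z. c * f z - c * g z) = (norm c)\<^sup>2 * sqn (\<lambda>z. f z - g z)"
      using sqn_scale[of c "\<lambda>z. f z - g z"] by (simp add: algebra_simps)
    also have "\<dots> \<le> (norm c)\<^sup>2 * (e / ((norm c)\<^sup>2 + 1))" using g by (intro mult_left_mono) auto
    also have "\<dots> < e"
    proof -
      have "(t - 1) * (e / t) < e" if "t \<ge> 1" for t using that \<open>e > 0\<close> by (simp add: field_simps)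
      from this[of "(norm c)\<^sup>2 + 1"] show ?thesis by simp
    qed
    finally show "\<exists>h\<in>S. sqn (\<lambda>z. c * f z - h z) < e"
      using D(4)[OF g(1)] by (intro bexI) auto
  qed
qed

text \<open>A minimising sequence is Cauchy by the parallelogram law, and a nonzero inner product of
  the residue with some vector of \<open>K\<close> would allow a step inside \<open>K\<close> that
  shortens the residue.\<close>

lemma L2_projection:
  assumes K: "L2_subspace K" "L2_closed K" and x: "x \<in> L2"
  shows "\<exists>y\<in>K. \<forall>v\<in>K. ip (\<lambda>z. x z - y z) v = 0"
proof -
  note D = L2_subspaceD[OF K(1)]
  define d where "d = (INF y\<in>K. sqn (\<lambda>z. x z - y z))"
  have ne: "K \<noteq> {}" using D(2) by auto
  have bdd: "bdd_below ((\<lambda>y. sqn (\<lambda>z. x z - y z)) ` K)" by (rule bdd_belowI2[where m=0]) simp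
  have dle: "d \<le> sqn (\<lambda>z. x z - y z)" if "y \<in> K" for y
    unfolding d_def by (rule cINF_lower[OF bdd that])
  have "\<exists>y\<in>K. sqn (\<lambda>z. x z - y z) < d + 1 / real (Suc k)" for k
  proof -
    have "(INF y\<in>K. sqn (\<lambda>z. x z - y z)) < d + 1 / real (Suc k)" unfolding d_def by simp
    then show ?thesis using cINF_less_iff[OF ne bdd] by blast
  qed
  then obtain y where y: "\<And>k. y k \<in> K" "\<And>k. sqn (\<lambda>z. x z - y k z) < d + 1 / real (Suc k)" by metis
  have yL: "y k \<in> L2" for k using y(1) D(1) by auto
  have cau: "sqn (\<lambda>z. y i z - y j z) \<le> 2 * (1 / real (Suc i)) + 2 * (1 / real (Suc j))" for i j
  proof -
    \<comment> \<open>The midpoint of two approximants lies in \<open>K\<close>, so its squared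
      distance from \<open>x\<close> is at least \<open>d\<close>; the parallelogram law turns this
      into a bound for \<open>y i - y j\<close>.\<close>
    define m where "m z = (1/2) * (y i z + y j z)" for z
    have m: "m \<in> K" unfolding m_def by (intro D y)
    have "sqn (\<lambda>z. (x z - y i z) + (x z - y j z)) = sqn (\<lambda>z. 2 * (x z - m z))"
      by (simp add: m_def algebra_simps)
    also have "\<dots> = 4 * sqn (\<lambda>z. x z - m z)" unfolding sqn_scale by simp
    also have "\<dots> \<ge> 4 * d" using dle[OF m] by simp
    finally have "4 * d \<le> sqn (\<lambda>z. (x z - y i z) + (x z - y j z))" .
    moreover have "sqn (\<lambda>z. (x z - y i z) + (x z - y j z)) + sqn (\<lambda>z. (x z - y i z) - (x z - y j z))
        = 2 * sqn (\<lambda>z. x z - y i z) + 2 * sqn (\<lambda>z. x z - y j z)"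
      by (intro sqn_parallelogram L2_diff x yL)
    moreover have "sqn (\<lambda>z. (x z - y i z) - (x z - y j z)) = sqn (\<lambda>z. y i z - y j z)"
      by (simp add: sqn_commute[of "y i"])
    ultimately show ?thesis using y(2)[of i] y(2)[of j] by linarith
  qed
  have "\<exists>N. \<forall>i\<ge>N. \<forall>j\<ge>N. sqn (\<lambda>z. y i z - y j z) < e" if e: "e > 0" for e
  proof -
    obtain N where N: "1 / real (Suc N) < e / 4" using nat_approx_posE[of "e/4"] e by auto
    have "sqn (\<lambda>z. y i z - y j z) < e" if "i \<ge> N" "j \<ge> N" for i j
    proof -
      have "1 / real (Suc i) \<le> 1 / real (Suc N)" "1 / real (Suc j) \<le> 1 / real (Suc N)"
        using that by (auto intro!: divide_left_mono)
      then show ?thesis using cau[of i j] N by linarith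
    qed
    then show ?thesis by (intro exI[of _ N]) auto
  qed
  then obtain l where l: "l \<in> L2" "(\<lambda>i. sqn (\<lambda>z. y i z - l z)) \<longlonglongrightarrow> 0"
    using L2_complete[of y] yL by blast
  have lK: "l \<in> K"
  proof -
    have "\<exists>g\<in>K. sqn (\<lambda>z. l z - g z) < e" if "e > 0" for e
    proof -
      have "eventually (\<lambda>i. sqn (\<lambda>z. y i z - l z) < e) sequentially" using l(2) that by (intro order_tendstoD) auto
      then obtain i where "sqn (\<lambda>z. y i z - l z) < e" by (auto simp: eventually_sequentially)
      then show ?thesis using y(1) sqn_commute by metis
    qed
    then show ?thesis using K(2) l(1) unfolding L2_closed_def by auto
  qed
  \<comment> \<open>The limit attains the infimum: expanding \<open>(x - l) - (y i - l)\<close>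
    bounds the squared distance of \<open>l\<close> by quantities that tend to
    \<open>d\<close>.\<close>
  have ld: "sqn (\<lambda>z. x z - l z) \<le> d"
  proof (rule field_le_epsilon)
    fix e :: real assume "e > 0"
    define B where "B = sqrt (sqn (\<lambda>z. x z - l z))"
    have "(\<lambda>i. 2 * (B * sqrt (sqn (\<lambda>z. y i z - l z))) + (d + 1 / real (Suc i))) \<longlonglongrightarrow> 2 * (B * sqrt 0) + (d + 0)"
      by (intro tendsto_intros l LIMSEQ_Suc[OF lim_1_over_n])
    moreover have "sqn (\<lambda>z. x z - l z) \<le> 2 * (B * sqrt (sqn (\<lambda>z. y i z - l z))) + (d + 1 / real (Suc i))" for i
    proof -
      have "sqn (\<lambda>z. (x z - l z) - (y i z - l z)) = sqn (\<lambda>z. x z - l z) - 2 * Re (ip (\<lambda>z. x z - l z) (\<lambda>z. y i z - l z)) + sqn (\<lambda>z. y i z - l z)"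
        by (intro sqn_diff L2_diff x yL l)
      moreover have "Re (ip (\<lambda>z. x z - l z) (\<lambda>z. y i z - l z)) \<le> B * sqrt (sqn (\<lambda>z. y i z - l z))"
        unfolding B_def by (intro order_trans[OF complex_Re_le_cmod] norm_ip_le L2_diff x yL l)
      moreover have "sqn (\<lambda>z. (x z - l z) - (y i z - l z)) = sqn (\<lambda>z. x z - y i z)" by simp
      ultimately show ?thesis using y(2)[of i] sqn_nonneg[of "\<lambda>z. y i z - l z"] by linarith
    qed
    ultimately have "sqn (\<lambda>z. x z - l z) \<le> 2 * (B * sqrt 0) + (d + 0)"
      by (intro LIMSEQ_le_const) auto
    then show "sqn (\<lambda>z. x z - l z) \<le> d + e" using \<open>e > 0\<close> by simp
  qed
  have "ip (\<lambda>z. x z - l z) v = 0" if v: "v \<in> K" for v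
  proof (rule ccontr)
    define w where "w = ip (\<lambda>z. x z - l z) v"
    assume "ip (\<lambda>z. x z - l z) v \<noteq> 0"
    then have w: "norm w > 0" by (simp add: w_def)
    \<comment> \<open>Moving by \<open>c * v\<close> lowers the squared distance by
      \<open>2 * t * (norm w)^2\<close> and raises it by less than \<open>t * (norm w)^2\<close>, as
      \<open>t * sqn v < 1\<close>.\<close>
    define t where "t = 1 / (sqn v + 1)"
    have t: "t > 0" "t * sqn v < 1" by (auto simp: t_def add_nonneg_pos)
    define c where "c = of_real t * w"
    have L: "(\<lambda>z. x z - l z) \<in> L2" "(\<lambda>z. c * v z) \<in> L2" using v D by (auto intro: L2_diff x l)
    have "(\<lambda>z. l z + c * v z) \<in> K" by (intro D lK v)
    then have "sqn (\<lambda>z. x z - l z) \<le> sqn (\<lambda>z. x z - (l z + c * v z))" using dle ld by force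
    also have "\<dots> = sqn (\<lambda>z. (x z - l z) - c * v z)" by (simp add: algebra_simps)
    also have "\<dots> = sqn (\<lambda>z. x z - l z) - 2 * Re (cnj c * w) + (norm c)\<^sup>2 * sqn v"
      unfolding sqn_diff[OF L] by (simp add: ip_scale_right sqn_scale w_def)
    also have "Re (cnj c * w) = t * (norm w)\<^sup>2"
      unfolding c_def cmod_power2 by (simp add: power2_eq_square algebra_simps)
    also have "(norm c)\<^sup>2 = t\<^sup>2 * (norm w)\<^sup>2" using t by (simp add: c_def norm_mult power_mult_distrib)
    finally have "t * (norm w)\<^sup>2 * 2 \<le> t * (norm w)\<^sup>2 * (t * sqn v)" by (simp add: power2_eq_square algebra_simps)
    then have "2 \<le> t * sqn v" using t(1) w by (subst (asm) mult_le_cancel_left_pos) auto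
    then show False using t(2) by simp
  qed
  then show ?thesis using lK by blast
qed

section \<open>Outer functions as limits of polynomials\<close>

text \<open>The residue of projecting \<open>F\<close> onto the closure of the polynomials is
  orthogonal to all \<open>z ^ j\<close>. Its integrals against \<open>z ^ j\<close> with
  \<open>j \<ge> 1\<close> vanish as well, since both \<open>F\<close> and its projection are
  analytic, so all its Fourier coefficients are 0.\<close>

lemma H2_poly_dense:
  assumes F: "F \<in> L2" and an: "\<And>j. j \<ge> 1 \<Longrightarrow> (LINT z|mT. F z * z ^ j) = 0"
  shows "F \<in> L2_closure (range poly)"
proof -
  have sub: "L2_subspace (range poly)"
    unfolding L2_subspace_def
  proof (intro conjI ballI allI)
    show "range poly \<subseteq> L2" using L2_poly by auto
    show "(\<lambda>_. 0) \<in> range poly" by (rule image_eqI[of _ _ 0]) auto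
    fix f g :: "complex \<Rightarrow> complex" and c assume "f \<in> range poly"
    then obtain p where p: "f = poly p" by auto
    show "(\<lambda>z. c * f z) \<in> range poly" by (rule image_eqI[of _ _ "smult c p"]) (auto simp: p)
    assume "g \<in> range poly"
    then obtain q where q: "g = poly q" by auto
    show "(\<lambda>z. f z + g z) \<in> range poly" by (rule image_eqI[of _ _ "p + q"]) (auto simp: p q)
  qed
  have K: "L2_subspace (L2_closure (range poly))" "L2_closed (L2_closure (range poly))"
    using L2_poly by (auto intro: L2_subspace_closure[OF sub] L2_closed_closure)
  obtain y where y: "y \<in> L2_closure (range poly)"
    and orth: "\<And>v. v \<in> L2_closure (range poly) \<Longrightarrow> ip (\<lambda>z. F z - y z) v = 0"
    using L2_projection[OF K F] by auto
  have yL: "y \<in> L2" using y by (simp add: L2_closure_def)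
  have pw: "(\<lambda>z::complex. z ^ j) = poly (monom 1 j)" for j by (simp add: fun_eq_iff poly_monom)
  have pwL: "(\<lambda>z. z ^ j) \<in> L2" for j unfolding pw by (rule L2_poly)
  \<comment> \<open>For polynomials these integrals are constant terms of polynomials divisible by
    \<open>z\<close>; Cauchy-Schwarz carries their vanishing over to the L2 limit
    \<open>y\<close>.\<close>
  have yan: "(LINT z|mT. y z * z ^ j) = 0" if j: "j \<ge> 1" for j
  proof -
    have "norm (LINT z|mT. y z * z ^ j) \<le> 0 + e" if e: "e > 0" for e
    proof -
      obtain q where q: "sqn (\<lambda>z. y z - poly q z) < e\<^sup>2"
        using y e unfolding L2_closure_def by (auto dest!: spec[of _ "e\<^sup>2"])
      have *: "ip f (\<lambda>z. cnj z ^ j) = (LINT z|mT. f z * z ^ j)" for f by (simp add: ip_def)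
      have cL: "(\<lambda>z. cnj z ^ j) \<in> L2" using L2_cnj[OF pwL[of j]] by simp
      have "(LINT z|mT. poly q z * z ^ j) = (LINT z|mT. poly (q * monom 1 j) z)"
        by (simp add: poly_monom)
      also have "\<dots> = 0" unfolding integral_mT_poly using j by (simp add: coeff_mult)
      finally have "(LINT z|mT. y z * z ^ j) = ip (\<lambda>z. y z - poly q z) (\<lambda>z. cnj z ^ j)"
        unfolding ip_diff_left[OF yL L2_poly cL] * by simp
      also have "norm \<dots> \<le> sqrt (sqn (\<lambda>z. y z - poly q z)) * sqrt (sqn (\<lambda>z. cnj z ^ j))"
        by (intro norm_ip_le L2_diff yL L2_poly cL)
      also have "sqn (\<lambda>z. cnj z ^ j) = 1"
      proof -
        have "sqn (\<lambda>z. cnj z ^ j) = (LINT z|mT. 1)"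
          unfolding sqn_def using AE_mT_norm by (intro integral_cong_AE) (auto simp: norm_power)
        then show ?thesis by simp
      qed
      also have "sqrt (sqn (\<lambda>z. y z - poly q z)) * sqrt 1 \<le> e"
        using q e real_le_lsqrt[of e "sqn (\<lambda>z. y z - poly q z)"] by simp
      finally show ?thesis by simp
    qed
    then have "norm (LINT z|mT. y z * z ^ j) \<le> 0" by (rule field_le_epsilon)
    then show ?thesis by simp
  qed
  have "AE z in mT. F z - y z = 0"
  proof (rule AE_zero_of_moments)
    have L: "(\<lambda>z. F z - y z) \<in> L2" by (intro L2_diff F yL)
    then show "integrable mT (\<lambda>z. F z - y z)" by (rule L2_integrable)
    have neg: "(LINT z|mT. (F z - y z) * cnj z ^ j) = 0" for j
    proof -
      have "(\<lambda>z. z ^ j) \<in> L2_closure (range poly)"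
        unfolding pw using L2_poly by (intro L2_closure_mono) auto
      from orth[OF this] show ?thesis by (simp add: ip_def)
    qed
    then show "(LINT z|mT. (F z - y z) * cnj z ^ j) = 0" for j .
    show "(LINT z|mT. (F z - y z) * z ^ j) = 0" for j
    proof (cases "j = 0")
      case True then show ?thesis using neg[of 0] by simp
    next
      case False
      then show ?thesis
        using an[of j] yan[of j] L2_mult_integrable[OF F pwL[of j]] L2_mult_integrable[OF yL pwL[of j]]
        by (simp add: left_diff_distrib)
    qed
  qed
  then have "AE z in mT. F z - y z = 0" .
  then have "sqn (\<lambda>z. F z - y z) = 0" using sqn_eq_0_iff L2_diff[OF F yL] by auto
  then show ?thesis using K(2) F y unfolding L2_closed_def by (metis)
qed

text \<open>The derivative of \<open>exp\<close> has modulus at most 1 on the closed left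
  half-plane, which is convex. The distance of an outer function from 1 can thus be measured by the
  L2 norm of its logarithm.\<close>

lemma norm_exp_minus_one_le:
  fixes w :: complex
  assumes "Re w \<le> 0" shows "norm (exp w - 1) \<le> norm w"
proof -
  have "norm (exp w - exp 0) \<le> 1 * norm (w - 0)"
  proof (rule field_differentiable_bound[of "{z. Re z \<le> 0}"])
    show "convex {z. Re z \<le> 0}" by (rule convex_halfspace_Re_le)
    show "(exp has_field_derivative exp z) (at z within {z. Re z \<le> 0})" for z :: complex
      by (rule DERIV_subset[OF DERIV_exp]) simp
  qed (use assms in auto)
  then show ?thesis by simp
qed

text \<open>The values of \<open>q\<close> on the circle stay in a disc, where the exponential
  series converges uniformly; its partial sums evaluated at \<open>- q\<close> are polynomials in
  \<open>z\<close>.\<close>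

lemma exp_poly_approx:
  fixes q :: "complex poly"
  assumes "e > 0"
  shows "\<exists>p. \<forall>z. norm z = 1 \<longrightarrow> norm (exp (- poly q z) - poly p z) < e"
proof -
  obtain C where C: "C \<ge> 0" "\<And>z. norm z = 1 \<Longrightarrow> norm (poly q z) \<le> C"
    using poly_bounded_circle[of q] by auto
  have "uniform_limit (cball (0::complex) C) (\<lambda>N w. \<Sum>m<N. w ^ m /\<^sub>R fact m) (\<lambda>w. \<Sum>m. w ^ m /\<^sub>R fact m) sequentially"
  proof (rule Weierstrass_m_test)
    show "norm (w ^ m /\<^sub>R fact m) \<le> C ^ m /\<^sub>R fact m" if "w \<in> cball 0 C" for m and w :: complex
      using that C by (auto simp: norm_power divide_inverse[symmetric] mult.commute intro!: divide_right_mono power_mono)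
    show "summable (\<lambda>m. C ^ m /\<^sub>R fact m)" by (rule summable_exp_generic)
  qed
  then have "\<forall>\<^sub>F N in sequentially. \<forall>w\<in>cball (0::complex) C. dist (\<Sum>m<N. w ^ m /\<^sub>R fact m) (exp w) < e"
    using assms unfolding uniform_limit_iff exp_def by simp
  then obtain N where "\<forall>w\<in>cball (0::complex) C. dist (\<Sum>m<N. w ^ m /\<^sub>R fact m) (exp w) < e"
    unfolding eventually_sequentially by auto
  then have N: "norm (exp w - (\<Sum>m<N. w ^ m /\<^sub>R fact m)) < e" if "norm w \<le> C" for w :: complex
    using that by (simp add: dist_norm norm_minus_commute)
  have "norm (exp (- poly q z) - poly (\<Sum>m<N. smult (1 / fact m) ((- q) ^ m)) z) < e" if "norm z = 1" for z
  proof -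
    have "poly (\<Sum>m<N. smult (1 / fact m) ((- q) ^ m)) z = (\<Sum>m<N. (- poly q z) ^ m /\<^sub>R fact m)"
      unfolding poly_sum by (intro sum.cong refl) (simp add: poly_power scaleR_conv_of_real field_simps)
    then show ?thesis using N[of "- poly q z"] C(2)[OF that] by simp
  qed
  then show ?thesis by (intro exI) auto
qed

text \<open>Bounded truncations of \<open>u\<close> converge to it in L2 by dominated convergence,
  and for bounded functions an L1 error controls the squared L2 error.\<close>

lemma nonneg_L2_approx_Re_poly:
  fixes u :: "complex \<Rightarrow> real"
  assumes [measurable]: "u \<in> borel_measurable borel" and pos: "AE z in mT. 0 \<le> u z"
    and i: "integrable mT (\<lambda>z. (u z)\<^sup>2)" and e: "e > 0"
  shows "\<exists>p. (\<forall>z. norm z = 1 \<longrightarrow> 0 \<le> Re (poly p z)) \<and> Im (coeff p 0) = 0 \<and>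
     (LINT z|mT. (u z - Re (poly p z))\<^sup>2) < e"
proof -
  have "(\<lambda>k. LINT z|mT. (u z - min (u z) (real k))\<^sup>2) \<longlonglongrightarrow> (LINT z|mT. 0)"
  proof (rule integral_dominated_convergence[where w="\<lambda>z. (u z)\<^sup>2"])
    show "AE z in mT. (\<lambda>k. (u z - min (u z) (real k))\<^sup>2) \<longlonglongrightarrow> 0"
    proof (rule AE_I2)
      fix z
      obtain K where "u z \<le> real K" using real_arch_simple by blast
      then have "(u z - min (u z) (real k))\<^sup>2 = 0" if "k \<ge> K" for k using that by (auto simp: min_def)
      then show "(\<lambda>k. (u z - min (u z) (real k))\<^sup>2) \<longlonglongrightarrow> 0"
        by (intro tendsto_eventually) (auto simp: eventually_sequentially)
    qed
    show "AE z in mT. norm ((u z - min (u z) (real k))\<^sup>2) \<le> (u z)\<^sup>2" for k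
      using pos by eventually_elim (auto intro!: power_mono)
  qed (use i in auto)
  then have "eventually (\<lambda>k. (LINT z|mT. (u z - min (u z) (real k))\<^sup>2) < e/4) sequentially"
    using e by (intro order_tendstoD) auto
  then obtain k where k: "(LINT z|mT. (u z - min (u z) (real k))\<^sup>2) < e/4"
    by (auto simp: eventually_sequentially)
  define v where "v z = min (u z) (real k)" for z
  have [measurable]: "v \<in> borel_measurable borel" unfolding v_def by measurable
  have v: "AE z in mT. 0 \<le> v z \<and> v z \<le> real k" using pos by eventually_elim (auto simp: v_def)
  \<comment> \<open>Both functions lie between 0 and \<open>k + 1\<close>, so the squared error is
    at most \<open>k + 1\<close> times the error in the mean; the required accuracy is divided
    accordingly.\<close>
  have "e / (4 * (real k + 1)) > 0" using e by simp
  from bounded_approx_Re_poly[OF _ v this]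
  obtain p where p: "\<And>z. norm z = 1 \<Longrightarrow> 0 \<le> Re (poly p z) \<and> Re (poly p z) \<le> real k + 1"
    "(LINT z|mT. \<bar>v z - Re (poly p z)\<bar>) < e / (4 * (real k + 1))"
    by auto
  \<comment> \<open>Removing the imaginary part of the constant term leaves the real part of the
    polynomial unchanged; with a real constant term the real part controls the whole polynomial in
    L2.\<close>
  define q where "q = p - [:\<i> * Im (coeff p 0):]"
  have q: "Re (poly q z) = Re (poly p z)" for z by (simp add: q_def)
  have vi: "integrable mT v" using v by (intro integrable_mT_bounded[of _ "real k"]) auto
  have b: "AE z in mT. (v z - Re (poly p z))\<^sup>2 \<le> (real k + 1) * \<bar>v z - Re (poly p z)\<bar>"
    using v AE_mT_norm
  proof eventually_elim
    case (elim z)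
    have "\<bar>v z - Re (poly p z)\<bar> \<le> real k + 1" using p(1)[of z] elim by auto
    from mult_right_mono[OF this abs_ge_zero[of "v z - Re (poly p z)"]] show ?case
      by (simp add: power2_eq_square)
  qed
  have bi: "integrable mT (\<lambda>z. (real k + 1) * \<bar>v z - Re (poly p z)\<bar>)"
    using vi integrable_Re_poly by (intro integrable_mult_right integrable_abs) auto
  have i1: "integrable mT (\<lambda>z. (v z - Re (poly p z))\<^sup>2)"
    using b by (intro Bochner_Integration.integrable_bound[OF bi]) auto
  have i2: "integrable mT (\<lambda>z. (u z - v z)\<^sup>2)"
  proof (rule Bochner_Integration.integrable_bound[OF i])
    show "AE z in mT. norm ((u z - v z)\<^sup>2) \<le> norm ((u z)\<^sup>2)"
      using pos by eventually_elim (auto simp: v_def intro!: power_mono)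
  qed simp
  have pt: "(u z - Re (poly p z))\<^sup>2 \<le> 2 * (u z - v z)\<^sup>2 + 2 * (v z - Re (poly p z))\<^sup>2" for z
    using two_mult_le_squares[of "u z - v z" "v z - Re (poly p z)"]
    by (simp add: power2_eq_square algebra_simps)
  have i3: "integrable mT (\<lambda>z. (u z - Re (poly p z))\<^sup>2)"
  proof (rule Bochner_Integration.integrable_bound)
    show "integrable mT (\<lambda>z. 2 * (u z - v z)\<^sup>2 + 2 * (v z - Re (poly p z))\<^sup>2)"
      by (intro Bochner_Integration.integrable_add integrable_mult_right i1 i2)
    show "AE z in mT. norm ((u z - Re (poly p z))\<^sup>2) \<le> norm (2 * (u z - v z)\<^sup>2 + 2 * (v z - Re (poly p z))\<^sup>2)"
      by (rule AE_I2) (simp only: real_norm_def abs_power2 order_trans[OF pt abs_ge_self])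
  qed simp
  have "(LINT z|mT. (u z - Re (poly p z))\<^sup>2) \<le> (LINT z|mT. 2 * (u z - v z)\<^sup>2 + 2 * (v z - Re (poly p z))\<^sup>2)"
    by (intro integral_mono Bochner_Integration.integrable_add integrable_mult_right i1 i2 i3 pt)
  also have "\<dots> = 2 * (LINT z|mT. (u z - v z)\<^sup>2) + 2 * (LINT z|mT. (v z - Re (poly p z))\<^sup>2)"
    using i1 i2 by simp
  also have "(LINT z|mT. (v z - Re (poly p z))\<^sup>2) \<le> (real k + 1) * (LINT z|mT. \<bar>v z - Re (poly p z)\<bar>)"
    using integral_mono_AE[OF i1 bi b] by simp
  also have "(real k + 1) * (LINT z|mT. \<bar>v z - Re (poly p z)\<bar>) \<le> (real k + 1) * (e / (4 * (real k + 1)))"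
    using p(2) by (intro mult_left_mono) auto
  also have "\<dots> = e/4" by (simp add: field_simps)
  finally have "(LINT z|mT. (u z - Re (poly p z))\<^sup>2) < e" using k by (simp add: v_def)
  then show ?thesis using p(1) by (intro exI[of _ q]) (auto simp: q, simp add: q_def)
qed

text \<open>The constant term is real, so the integral of the square of the polynomial is nonnegative,
  which bounds the imaginary part by the real part.\<close>

lemma sqn_poly_le_Re:
  assumes "Im (coeff p 0) = 0"
  shows "sqn (poly p) \<le> 2 * (LINT z|mT. (Re (poly p z))\<^sup>2)"
proof -
  have i: "integrable mT (poly (p * p))" by (rule integrable_mT_poly)
  have L: "integrable mT (\<lambda>z. (norm (poly p z))\<^sup>2)" by (rule L2D(2)[OF L2_poly])
  have eq: "2 * (Re (poly p z))\<^sup>2 = (norm (poly p z))\<^sup>2 + Re (poly (p * p) z)" for z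
    unfolding cmod_power2 by (simp add: power2_eq_square)
  have "Re (LINT z|mT. poly (p * p) z) = (Re (coeff p 0))\<^sup>2"
    unfolding integral_mT_poly using assms by (simp add: coeff_mult power2_eq_square)
  then have "0 \<le> (LINT z|mT. Re (poly (p * p) z))"
    unfolding integral_Re[OF i] by (metis zero_le_power2)
  then have "sqn (poly p) \<le> (LINT z|mT. (norm (poly p z))\<^sup>2) + (LINT z|mT. Re (poly (p * p) z))"
    by (simp add: sqn_def)
  also have "\<dots> = (LINT z|mT. (norm (poly p z))\<^sup>2 + Re (poly (p * p) z))"
    using L integrable_Re[OF i] by (intro Bochner_Integration.integral_add[symmetric])
  also have "\<dots> = (LINT z|mT. 2 * (Re (poly p z))\<^sup>2)" unfolding eq ..
  finally show ?thesis by simp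
qed

lemma sqn_of_real_diff: "sqn (\<lambda>z. of_real (a z) - of_real (b z)) = (LINT z|mT. (a z - b z)\<^sup>2)"
  unfolding sqn_def of_real_diff[symmetric] norm_of_real by simp

text \<open>The outer function is a bounded limit of polynomials on the circle, so that no function
  theory of the disc is needed.\<close>

lemma outer_function:
  fixes u :: "complex \<Rightarrow> real"
  assumes [measurable]: "u \<in> borel_measurable borel" and pos: "AE z in mT. 0 \<le> u z"
    and i: "integrable mT (\<lambda>z. (u z)\<^sup>2)"
  shows "\<exists>h p. h \<in> borel_measurable borel \<and> (AE z in mT. norm (h z) = exp (- u z)) \<and>
    sqn (\<lambda>z. h z - 1) \<le> 8 * (LINT z|mT. (u z)\<^sup>2) \<and>
    (\<forall>j z. norm z = 1 \<longrightarrow> norm (poly (p j) z) \<le> 2) \<and> (AE z in mT. (\<lambda>j. poly (p j) z) \<longlonglongrightarrow> h z)"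
proof -
  have "\<exists>p. (\<forall>z. norm z = 1 \<longrightarrow> 0 \<le> Re (poly p z)) \<and> Im (coeff p 0) = 0 \<and>
     (LINT z|mT. (u z - Re (poly p z))\<^sup>2) < 1 / real (Suc j)" for j
    using assms by (intro nonneg_L2_approx_Re_poly) auto
  then obtain q where q: "\<And>j z. norm z = 1 \<Longrightarrow> 0 \<le> Re (poly (q j) z)" "\<And>j. Im (coeff (q j) 0) = 0"
     "\<And>j. (LINT z|mT. (u z - Re (poly (q j) z))\<^sup>2) < 1 / real (Suc j)" by metis
  define U where "U z = complex_of_real (u z)" for z
  define R where "R j z = complex_of_real (Re (poly (q j) z))" for j z
  have UL: "U \<in> L2" using i by (simp add: L2_def U_def[abs_def])
  have RL: "(\<lambda>z. complex_of_real (Re (poly p z))) \<in> L2" for p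
  proof -
    have "(\<lambda>z. (1/2) * (poly p z + cnj (poly p z))) \<in> L2"
      by (intro L2_scale L2_add L2_cnj L2_poly)
    moreover have "(1/2) * (poly p z + cnj (poly p z)) = complex_of_real (Re (poly p z))" for z
      by (simp add: complex_add_cnj)
    ultimately show ?thesis by simp
  qed
  have RL': "R j \<in> L2" for j unfolding R_def by (rule RL)
  have UR: "sqn (\<lambda>z. U z - R j z) < 1 / real (Suc j)" for j
    unfolding U_def R_def sqn_of_real_diff by (rule q)
  \<comment> \<open>Differences of the \<open>q j\<close> again have real constant term, so their L2
    norms are controlled by those of their real parts, which approach \<open>u\<close>. This makes
    the \<open>q j\<close> a Cauchy sequence.\<close>
  have diff: "sqn (\<lambda>z. poly (q a) z - poly (q b) z) \<le> 4 * (1 / real (Suc a)) + 4 * (1 / real (Suc b))" for a b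
  proof -
    have "sqn (poly (q a - q b)) \<le> 2 * (LINT z|mT. (Re (poly (q a - q b) z))\<^sup>2)"
      by (rule sqn_poly_le_Re) (simp add: q)
    also have "(LINT z|mT. (Re (poly (q a - q b) z))\<^sup>2) = sqn (\<lambda>z. R a z - R b z)"
      unfolding R_def sqn_of_real_diff by simp
    also have "sqn (\<lambda>z. R a z - R b z) \<le> 2 * sqn (\<lambda>z. R a z - U z) + 2 * sqn (\<lambda>z. U z - R b z)"
      by (intro sqn_triangle_le RL' UL)
    also have "sqn (\<lambda>z. R a z - U z) = sqn (\<lambda>z. U z - R a z)" by (rule sqn_commute)
    finally show ?thesis using UR[of a] UR[of b] by (simp add: poly_diff[abs_def])
  qed
  have "\<exists>N. \<forall>a\<ge>N. \<forall>b\<ge>N. sqn (\<lambda>z. poly (q a) z - poly (q b) z) < e" if e: "e > 0" for e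
  proof -
    obtain N where N: "1 / real (Suc N) < e / 8" using nat_approx_posE[of "e/8"] e by auto
    have "sqn (\<lambda>z. poly (q a) z - poly (q b) z) < e" if "a \<ge> N" "b \<ge> N" for a b
    proof -
      have "1 / real (Suc a) \<le> 1 / real (Suc N)" "1 / real (Suc b) \<le> 1 / real (Suc N)"
        using that by (auto intro!: divide_left_mono)
      then show ?thesis using diff[of a b] N by linarith
    qed
    then show ?thesis by (intro exI[of _ N]) auto
  qed
  then obtain G where G: "G \<in> L2" "(\<lambda>j. sqn (\<lambda>z. poly (q j) z - G z)) \<longlonglongrightarrow> 0"
    using L2_complete[of "\<lambda>j. poly (q j)"] L2_poly by auto
  note [measurable] = L2D(1)[OF G(1)]
  have "(\<lambda>j. LINT z|mT. norm (poly (q j) z - G z)) \<longlonglongrightarrow> 0"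
  proof (rule tendsto_sandwich[OF _ _ tendsto_const])
    show "(\<lambda>j. sqrt (sqn (\<lambda>z. poly (q j) z - G z))) \<longlonglongrightarrow> 0" using tendsto_real_sqrt[OF G(2)] by simp
    show "\<forall>\<^sub>F j in sequentially. (LINT z|mT. norm (poly (q j) z - G z)) \<le> sqrt (sqn (\<lambda>z. poly (q j) z - G z))"
      by (intro always_eventually allI integral_norm_le_sqn L2_diff L2_poly G)
  qed auto
  then obtain r where r: "strict_mono r" "AE z in mT. (\<lambda>j. poly (q (r j)) z - G z) \<longlonglongrightarrow> 0"
    using tendsto_L1_AE_subseq[of mT "\<lambda>j z. poly (q j) z - G z"] L2_integrable[OF L2_diff[OF L2_poly G(1)]] by auto
  have lim: "AE z in mT. (\<lambda>j. poly (q (r j)) z) \<longlonglongrightarrow> G z"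
    using r(2) by eventually_elim (simp add: LIM_zero_iff)
  \<comment> \<open>Taking real parts does not increase distances, so \<open>Re (G z)\<close> is the
    L2 limit of \<open>Re (poly (q j) z)\<close>, which is \<open>u\<close>.\<close>
  have Gu: "AE z in mT. Re (G z) = u z"
  proof -
    define D where "D z = complex_of_real (Re (G z)) - U z" for z
    have GR: "(\<lambda>z. complex_of_real (Re (G z))) \<in> L2"
    proof -
      have "(\<lambda>z. (1/2) * (G z + cnj (G z))) \<in> L2" by (intro L2_scale L2_add L2_cnj G)
      moreover have "(1/2) * (G z + cnj (G z)) = complex_of_real (Re (G z))" for z
        by (simp add: complex_add_cnj)
      ultimately show ?thesis by simp
    qed
    have "sqn D \<le> 2 * sqn (\<lambda>z. poly (q j) z - G z) + 2 * (1 / real (Suc j))" for j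
    proof -
      have "sqn D \<le> 2 * sqn (\<lambda>z. complex_of_real (Re (G z)) - R j z) + 2 * sqn (\<lambda>z. R j z - U z)"
        unfolding D_def by (intro sqn_triangle_le GR RL' UL)
      also have "sqn (\<lambda>z. complex_of_real (Re (G z)) - R j z) \<le> sqn (\<lambda>z. poly (q j) z - G z)"
        unfolding R_def sqn_of_real_diff sqn_def
      proof (rule integral_mono)
        show "integrable mT (\<lambda>z. (Re (G z) - Re (poly (q j) z))\<^sup>2)"
          using L2D(2)[OF L2_diff[OF GR RL[of "q j"]]] unfolding of_real_diff[symmetric] norm_of_real by simp
        show "integrable mT (\<lambda>z. (norm (poly (q j) z - G z))\<^sup>2)" by (intro L2D L2_diff L2_poly G)
        show "(Re (G z) - Re (poly (q j) z))\<^sup>2 \<le> (norm (poly (q j) z - G z))\<^sup>2" for z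
          unfolding cmod_power2 by (simp add: power2_commute)
      qed
      finally show ?thesis using UR[of j] unfolding sqn_commute[of "R j"] by linarith
    qed
    moreover have "(\<lambda>j. 2 * sqn (\<lambda>z. poly (q j) z - G z) + 2 * (1 / real (Suc j))) \<longlonglongrightarrow> 2 * 0 + 2 * 0"
      by (intro tendsto_intros G LIMSEQ_Suc[OF lim_1_over_n])
    ultimately have "sqn D \<le> 2 * 0 + 2 * 0" by (intro LIMSEQ_le_const) auto
    then have "sqn D = 0" using sqn_nonneg[of D] by simp
    moreover have "D \<in> L2" unfolding D_def[abs_def] by (intro L2_diff GR UL)
    ultimately have "AE z in mT. D z = 0" using sqn_eq_0_iff by simp
    then show ?thesis by eventually_elim (simp add: D_def U_def of_real_diff[symmetric] del: of_real_diff)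
  qed
  \<comment> \<open>\<open>G\<close> plays the part of \<open>u\<close> completed by its conjugate
    function to an analytic function, so that \<open>exp (- G z)\<close> has modulus
    \<open>exp (- u z)\<close>.\<close>
  define h where "h z = exp (- G z)" for z
  have hm [measurable]: "h \<in> borel_measurable borel" unfolding h_def by measurable
  have hn: "AE z in mT. norm (h z) = exp (- u z)"
    using Gu by eventually_elim (simp add: h_def norm_exp_eq_Re)
  \<comment> \<open>The constant is a product of three factors 2: from approximating
    \<open>G\<close> by \<open>q j\<close>, from passing from \<open>q j\<close> to its real part,
    and from comparing that real part with \<open>u\<close>.\<close>
  have "sqn G \<le> 8 * (LINT z|mT. (u z)\<^sup>2)"
  proof -
    have U0: "sqn U = (LINT z|mT. (u z)\<^sup>2)" by (simp add: sqn_def U_def)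
    have "sqn G \<le> 2 * sqn (\<lambda>z. poly (q j) z - G z) + 8 * (1 / real (Suc j)) + 8 * sqn U" for j
    proof -
      have "sqn (\<lambda>z. poly (q j) z - (poly (q j) z - G z)) = sqn G" by simp
      moreover have "sqn (\<lambda>z. poly (q j) z - (poly (q j) z - G z)) + sqn (\<lambda>z. poly (q j) z + (poly (q j) z - G z))
        = 2 * sqn (poly (q j)) + 2 * sqn (\<lambda>z. poly (q j) z - G z)"
        using sqn_parallelogram[OF L2_poly L2_diff[OF L2_poly G(1)], of "q j" "q j"] by simp
      moreover have "sqn (poly (q j)) \<le> 2 * sqn (R j)"
        using sqn_poly_le_Re[OF q(2)[of j]] by (simp add: sqn_def R_def)
      moreover have "sqn (\<lambda>z. (R j z - U z) + U z) \<le> 2 * sqn (\<lambda>z. R j z - U z) + 2 * sqn U"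
        by (intro sqn_add_le L2_diff RL' UL)
      moreover have "sqn (\<lambda>z. (R j z - U z) + U z) = sqn (R j)" by simp
      ultimately show ?thesis
        using UR[of j] sqn_nonneg[of "\<lambda>z. poly (q j) z + (poly (q j) z - G z)"]
        unfolding sqn_commute[of "R j"] by linarith
    qed
    moreover have "(\<lambda>j. 2 * sqn (\<lambda>z. poly (q j) z - G z) + 8 * (1 / real (Suc j)) + 8 * sqn U) \<longlonglongrightarrow> 2 * 0 + 8 * 0 + 8 * sqn U"
      by (intro tendsto_intros G LIMSEQ_Suc[OF lim_1_over_n])
    ultimately have "sqn G \<le> 2 * 0 + 8 * 0 + 8 * sqn U" by (intro LIMSEQ_le_const) auto
    then show ?thesis by (simp add: U0)
  qed
  moreover have "sqn (\<lambda>z. h z - 1) \<le> sqn G"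
    unfolding sqn_def
  proof (rule integral_mono_AE)
    show "integrable mT (\<lambda>z. (norm (G z))\<^sup>2)" by (intro L2D G)
    have "h \<in> L2"
    proof (rule bounded_L2[OF hm])
      show "AE z in mT. norm (h z) \<le> 1" using hn pos by eventually_elim simp
    qed
    then show "integrable mT (\<lambda>z. (norm (h z - 1))\<^sup>2)" by (intro L2D L2_diff L2_const)
    show "AE z in mT. (norm (h z - 1))\<^sup>2 \<le> (norm (G z))\<^sup>2"
      using Gu pos
    proof eventually_elim
      case (elim z)
      then have "norm (h z - 1) \<le> norm (- G z)" unfolding h_def by (intro norm_exp_minus_one_le) simp
      then show ?case by (auto intro!: power_mono)
    qed
  qed
  ultimately have h1: "sqn (\<lambda>z. h z - 1) \<le> 8 * (LINT z|mT. (u z)\<^sup>2)" by linarith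
  \<comment> \<open>Replacing \<open>exp (- poly (q (r j)) z)\<close>, of modulus at most 1, by a
    polynomial within distance 1 accounts for the bound 2.\<close>
  have "\<exists>p. \<forall>z. norm z = 1 \<longrightarrow> norm (exp (- poly (q (r j)) z) - poly p z) < 1 / real (Suc j)" for j
    by (intro exp_poly_approx) simp
  then obtain p where p: "\<And>j z. norm z = 1 \<Longrightarrow> norm (exp (- poly (q (r j)) z) - poly (p j) z) < 1 / real (Suc j)"
    by metis
  have pb: "norm (poly (p j) z) \<le> 2" if z: "norm z = 1" for j z
  proof -
    have "norm (exp (- poly (q (r j)) z)) \<le> 1" using q(1)[OF z] by (simp add: norm_exp_eq_Re)
    moreover have "1 / real (Suc j) \<le> 1" by simp
    moreover have "norm (poly (p j) z) \<le> norm (exp (- poly (q (r j)) z)) + norm (exp (- poly (q (r j)) z) - poly (p j) z)"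
      using norm_triangle_ineq4[of "exp (- poly (q (r j)) z)" "exp (- poly (q (r j)) z) - poly (p j) z"]
      by (simp del: norm_exp_eq_Re)
    ultimately show ?thesis using p[OF z, of j] by linarith
  qed
  have "AE z in mT. (\<lambda>j. poly (p j) z) \<longlonglongrightarrow> h z"
    using lim AE_mT_norm
  proof eventually_elim
    case (elim z)
    have "(\<lambda>j. exp (- poly (q (r j)) z)) \<longlonglongrightarrow> h z" unfolding h_def by (intro tendsto_intros elim)
    moreover have "(\<lambda>j. exp (- poly (q (r j)) z) - poly (p j) z) \<longlonglongrightarrow> 0"
    proof (rule Lim_null_comparison)
      show "\<forall>\<^sub>F j in sequentially. norm (exp (- poly (q (r j)) z) - poly (p j) z) \<le> 1 / real (Suc j)"
        using p[OF elim(2)] by (auto intro!: always_eventually less_imp_le)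
    qed (rule LIMSEQ_Suc[OF lim_1_over_n])
    ultimately show ?case using tendsto_diff by fastforce
  qed
  then show ?thesis using hm hn h1 pb by (intro exI[of _ h] exI[of _ p] conjI) auto
qed

section \<open>Sums over roots of unity\<close>

text \<open>\<open>rsum n g z / n\<close> is the conditional expectation of \<open>g\<close> given \<open>z ^ n\<close>.\<close>

definition rsum :: "nat \<Rightarrow> (complex \<Rightarrow> 'a::comm_monoid_add) \<Rightarrow> complex \<Rightarrow> 'a" where
  "rsum n g z = (\<Sum>u\<in>{u::complex. u ^ n = 1}. g (u * z))"

lemma root_unity_norm: "n \<ge> 1 \<Longrightarrow> u ^ n = 1 \<Longrightarrow> norm (u::complex) = 1"
  using power_eq_1_iff[of u n] by auto

lemma rsum_rotate:
  fixes v :: complex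
  assumes "n \<ge> 1" "v ^ n = 1"
  shows "rsum n g (v * z) = rsum n g z"
proof -
  have "v \<noteq> 0" using assms by (auto simp: power_0_left)
  have "rsum n g (v * z) = (\<Sum>u\<in>{u::complex. u ^ n = 1}. g ((u * v) * z))"
    by (simp add: rsum_def mult.assoc)
  also have "\<dots> = (\<Sum>u\<in>{u::complex. u ^ n = 1}. g (u * z))"
    by (rule sum.reindex_bij_witness[of _ "\<lambda>u. u / v" "\<lambda>u. u * v"])
       (use assms \<open>v \<noteq> 0\<close> in \<open>auto simp: power_mult_distrib power_divide\<close>)
  finally show ?thesis by (simp add: rsum_def)
qed

text \<open>The chosen root of \<open>z ^ n\<close> differs from \<open>z\<close> by a root of
  unity, under which fibre sums are invariant. Hence composing \<open>rsum n g\<close> with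
  \<open>circle_root n\<close> gives the function on the base circle from which
  \<open>rsum n g\<close> is pulled back.\<close>

lemma rsum_circle_root:
  assumes "n \<ge> 1" "norm z = 1"
  shows "rsum n g (circle_root n (z ^ n)) = rsum n g z"
proof -
  have z: "z \<noteq> 0" using assms by auto
  have "(circle_root n (z ^ n) / z) ^ n = 1"
    using assms z circle_root_power[of n "z ^ n"] by (simp add: power_divide norm_power)
  from rsum_rotate[OF assms(1) this, of g z] show ?thesis using z by simp
qed

lemma rsum_measurable [measurable]:
  fixes g :: "complex \<Rightarrow> 'a::{second_countable_topology, real_normed_vector}"
  assumes [measurable]: "g \<in> borel_measurable borel"
  shows "rsum n g \<in> borel_measurable borel"
  unfolding rsum_def[abs_def] by measurable

text \<open>Functions of \<open>z ^ n\<close> are constants for the conditional expectation, because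
  rotation by a root of unity does not change \<open>z ^ n\<close>.\<close>

lemma rsum_mult_power:
  fixes g :: "complex \<Rightarrow> 'a::comm_semiring_0"
  shows "rsum n (\<lambda>z. g z * F (z ^ n)) z = rsum n g z * F (z ^ n)"
  by (simp add: rsum_def sum_distrib_right power_mult_distrib)

lemma rsum_diff: "rsum n (\<lambda>z. f z - g z :: 'a::ab_group_add) z = rsum n f z - rsum n g z"
  by (simp add: rsum_def sum_subtractf)

lemma rsum_sum: "rsum n (\<lambda>z. \<Sum>i\<in>I. f i z) z = (\<Sum>i\<in>I. rsum n (f i) z)"
  unfolding rsum_def by (rule sum.swap)

lemma rsum_const: "n \<ge> 1 \<Longrightarrow> rsum n (\<lambda>_. c :: 'a::comm_semiring_1) z = of_nat n * c"
  by (simp add: rsum_def card_roots_unity_eq)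

text \<open>The root 1 contributes the value at \<open>z\<close> itself. The fibre sum of a modulus
  is therefore a majorant that depends only on \<open>z ^ n\<close>.\<close>

lemma rsum_member_le:
  fixes g :: "complex \<Rightarrow> real"
  assumes "n \<ge> 1" "\<And>z. 0 \<le> g z"
  shows "g z \<le> rsum n g z"
proof -
  have "g (1 * z) \<le> (\<Sum>u\<in>{u::complex. u ^ n = 1}. g (u * z))"
    using assms by (intro member_le_sum) (auto intro: finite_roots_unity)
  then show ?thesis by (simp add: rsum_def)
qed

lemma AE_roots:
  assumes "n \<ge> 1" "AE z in mT. P z"
  shows "AE z in mT. \<forall>u\<in>{u::complex. u ^ n = 1}. P (u * z)"
  using assms by (intro AE_finite_allI AE_rotate) (auto intro: finite_roots_unity root_unity_norm)

lemma rsum_integrable: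
  fixes g :: "complex \<Rightarrow> 'a::{banach, second_countable_topology}"
  assumes "n \<ge> 1" "integrable mT g"
  shows "integrable mT (rsum n g)"
  unfolding rsum_def[abs_def] using assms
  by (intro Bochner_Integration.integrable_sum integrable_rotate) (auto intro: root_unity_norm)

lemma rsum_integral:
  fixes g :: "complex \<Rightarrow> 'a::{banach, second_countable_topology}"
  assumes "n \<ge> 1" "integrable mT g"
  shows "(LINT z|mT. rsum n g z) = real n *\<^sub>R (LINT z|mT. g z)"
proof -
  have "(LINT z|mT. rsum n g z) = (\<Sum>u\<in>{u::complex. u ^ n = 1}. (LINT z|mT. g (u * z)))"
    unfolding rsum_def using assms
    by (intro Bochner_Integration.integral_sum integrable_rotate) (auto intro: root_unity_norm)
  also have "\<dots> = (\<Sum>u\<in>{u::complex. u ^ n = 1}. (LINT z|mT. g z))"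
    using assms by (intro sum.cong refl integral_rotate) (auto intro: root_unity_norm)
  also have "\<dots> = real n *\<^sub>R (LINT z|mT. g z)"
    using assms by (simp add: sum_constant_scaleR card_roots_unity_eq)
  finally show ?thesis .
qed

text \<open>Otherwise all \<open>n\<close> solutions of \<open>v ^ n = 1\<close> would satisfy
  \<open>v ^ m = 1\<close> with \<open>m = j mod n\<close> between 1 and \<open>n - 1\<close>, an
  equation with only \<open>m\<close> solutions.\<close>

lemma exists_root_unity_power_neq_1:
  assumes "n \<ge> 1" "\<not> n dvd j"
  shows "\<exists>v::complex. v ^ n = 1 \<and> v ^ j \<noteq> 1"
proof (rule ccontr)
  assume "\<not> ?thesis"
  then have *: "v ^ j = 1" if "v ^ n = 1" for v :: complex using that by blast
  define m where "m = j mod n"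
  have m: "1 \<le> m" "m < n" using assms by (auto simp: m_def dvd_eq_mod_eq_0)
  have "v ^ m = 1" if "v ^ n = 1" for v :: complex
  proof -
    have "v ^ j = v ^ (n * (j div n) + m)" by (simp add: m_def)
    also have "\<dots> = v ^ m" using that by (simp add: power_add power_mult)
    finally show ?thesis using *[OF that] by simp
  qed
  then have "{v::complex. v ^ n = 1} \<subseteq> {v. v ^ m = 1}" by auto
  then have "card {v::complex. v ^ n = 1} \<le> card {v::complex. v ^ m = 1}"
    using m by (intro card_mono finite_roots_unity) auto
  then show False using m assms by (simp add: card_roots_unity_eq)
qed

text \<open>Rotation by \<open>v\<close> preserves the measure and the fibre sum but multiplies
  \<open>\<phi>\<close> by \<open>c\<close>, so the integral equals \<open>c\<close> times
  itself.\<close>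

lemma rsum_moment_zero:
  fixes g :: "complex \<Rightarrow> complex"
  assumes n: "n \<ge> 1" and g: "integrable mT g" and \<phi>: "\<phi> \<in> borel_measurable borel" "AE z in mT. norm (\<phi> z) \<le> C"
    and c: "v ^ n = 1" "c \<noteq> 1" "\<And>z. \<phi> (v * z) = c * \<phi> z"
  shows "(LINT z|mT. rsum n g z * \<phi> z) = 0"
proof -
  note [measurable] = borel_measurable_integrable[OF g, unfolded borel_measurable_mT] \<phi>(1)
  have "(LINT z|mT. rsum n g z * \<phi> z) = (LINT z|mT. rsum n g (v * z) * \<phi> (v * z))"
    by (rule integral_rotate[symmetric]) (use root_unity_norm[OF n c(1)] in auto)
  also have "\<dots> = c * (LINT z|mT. rsum n g z * \<phi> z)"
    by (simp add: rsum_rotate[OF n c(1)] c(3) mult.left_commute)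
  finally have "(1 - c) * (LINT z|mT. rsum n g z * \<phi> z) = 0" by (simp add: algebra_simps)
  then show ?thesis using c(2) by simp
qed

text \<open>Moments of a fibre sum of order not divisible by \<open>n\<close> vanish by rotation,
  and those of order \<open>n * k\<close> are \<open>n\<close> times the moments of
  \<open>g\<close>. Testing against powers of \<open>z ^ n\<close> and their conjugates thus
  identifies a conditional expectation.\<close>

lemma rsum_AE_zero:
  fixes g :: "complex \<Rightarrow> complex"
  assumes n: "n \<ge> 1" and g: "integrable mT g"
    and pos: "\<And>k. (LINT z|mT. g z * z ^ (n * k)) = 0"
    and neg: "\<And>k. (LINT z|mT. g z * cnj z ^ (n * k)) = 0"
  shows "AE z in mT. rsum n g z = 0"
proof (rule AE_zero_of_moments)
  show "integrable mT (rsum n g)" by (rule rsum_integrable[OF n g])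
  have bz: "AE z in mT. norm (z ^ j) \<le> 1" "AE z in mT. norm (cnj z ^ j) \<le> 1" for j
    using AE_mT_norm by (auto simp: norm_power)
  fix j
  show "(LINT z|mT. rsum n g z * z ^ j) = 0"
  proof (cases "n dvd j")
    case True
    then obtain k where j: "j = n * k" by auto
    have "(LINT z|mT. rsum n g z * z ^ j) = (LINT z|mT. rsum n (\<lambda>z. g z * z ^ j) z)"
      using rsum_mult_power[of n g "\<lambda>w. w ^ k"] by (simp add: j power_mult)
    also have "\<dots> = real n *\<^sub>R (LINT z|mT. g z * z ^ j)"
      using bz by (intro rsum_integral n integrable_mult_bounded[OF g]) auto
    finally show ?thesis using pos j by simp
  next
    case False
    then obtain v :: complex where v: "v ^ n = 1" "v ^ j \<noteq> 1" using exists_root_unity_power_neq_1[OF n] by blast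
    show ?thesis
      by (rule rsum_moment_zero[OF n g _ bz(1) v]) (auto simp: power_mult_distrib)
  qed
  show "(LINT z|mT. rsum n g z * cnj z ^ j) = 0"
  proof (cases "n dvd j")
    case True
    then obtain k where j: "j = n * k" by auto
    have "(LINT z|mT. rsum n g z * cnj z ^ j) = (LINT z|mT. rsum n (\<lambda>z. g z * cnj z ^ j) z)"
      using rsum_mult_power[of n g "\<lambda>w. cnj w ^ k"] by (simp add: j power_mult)
    also have "\<dots> = real n *\<^sub>R (LINT z|mT. g z * cnj z ^ j)"
      using bz by (intro rsum_integral n integrable_mult_bounded[OF g]) auto
    finally show ?thesis using neg j by simp
  next
    case False
    then obtain v :: complex where v: "v ^ n = 1" "v ^ j \<noteq> 1" using exists_root_unity_power_neq_1[OF n] by blast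
    have c: "cnj v ^ j \<noteq> 1" using v(2) by (metis complex_cnj_one complex_cnj_power complex_cnj_cnj)
    show ?thesis
      by (rule rsum_moment_zero[OF n g _ bz(2) v(1) c]) (auto simp: power_mult_distrib)
  qed
qed

text \<open>Powers between 1 and \<open>n - 1\<close> sum to 0 over the roots of unity, so sampling
  at \<open>n\<close> points computes the mean exactly once \<open>n\<close> exceeds the degree. In
  this discrete form the mean becomes accessible to a norm through its invariance under
  rotations.\<close>

lemma rsum_poly_const:
  assumes "degree p < n"
  shows "rsum n (poly p) z = of_nat n * coeff p 0"
proof -
  have n: "n \<ge> 1" using assms by simp
  have z: "rsum n (\<lambda>z. z ^ i) z = 0" if "0 < i" "i < n" for i
  proof -
    have "\<not> n dvd i" using that by (auto dest: dvd_imp_le)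
    then obtain v :: complex where v: "v ^ n = 1" "v ^ i \<noteq> 1" using exists_root_unity_power_neq_1[OF n] by blast
    have "rsum n (\<lambda>z. z ^ i) z = rsum n (\<lambda>z. z ^ i) (v * z)" by (rule rsum_rotate[OF n v(1), symmetric])
    also have "\<dots> = v ^ i * rsum n (\<lambda>z. z ^ i) z"
      by (simp add: rsum_def sum_distrib_left power_mult_distrib mult_ac)
    finally have "(1 - v ^ i) * rsum n (\<lambda>z. z ^ i) z = 0" by (simp add: algebra_simps)
    then show ?thesis using v(2) by simp
  qed
  have "rsum n (poly p) z = (\<Sum>i\<le>degree p. rsum n (\<lambda>z. coeff p i * z ^ i) z)"
    unfolding rsum_sum[symmetric] by (simp add: poly_altdef[abs_def])
  also have "\<dots> = (\<Sum>i\<le>degree p. if i = 0 then of_nat n * coeff p 0 else 0)"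
  proof (intro sum.cong refl)
    fix i assume i: "i \<in> {..degree p}"
    have "rsum n (\<lambda>z. coeff p i * z ^ i) z = coeff p i * rsum n (\<lambda>z. z ^ i) z"
      by (simp add: rsum_def sum_distrib_left)
    then show "rsum n (\<lambda>z. coeff p i * z ^ i) z = (if i = 0 then of_nat n * coeff p 0 else 0)"
      using z[of i] i assms rsum_const[OF n, of 1 z] by auto
  qed
  also have "\<dots> = of_nat n * coeff p 0" by simp
  finally show ?thesis .
qed

section \<open>Rotationally symmetric norms\<close>

lemma LinfI: "f \<in> borel_measurable borel \<Longrightarrow> AE z in mT. norm (f z) \<le> C \<Longrightarrow> f \<in> Linf"
  unfolding Linf_def by auto

lemma LinfD: "f \<in> Linf \<Longrightarrow> f \<in> borel_measurable borel"
  by (simp add: Linf_def)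

lemma Linf_boundE:
  assumes "f \<in> Linf"
  obtains C where "C > 0" "AE z in mT. norm (f z) \<le> C"
proof -
  obtain C where C: "AE z in mT. norm (f z) \<le> C" using assms by (auto simp: Linf_def)
  have "AE z in mT. norm (f z) \<le> max C 1" using C by eventually_elim auto
  then show ?thesis using that[of "max C 1"] by simp
qed

lemma Linf_mult:
  assumes f: "f \<in> Linf" and g: "g \<in> Linf" shows "(\<lambda>z. f z * g z) \<in> Linf"
proof -
  obtain C where C: "C > 0" "AE z in mT. norm (f z) \<le> C" using f by (rule Linf_boundE)
  obtain D where D: "D > 0" "AE z in mT. norm (g z) \<le> D" using g by (rule Linf_boundE)
  have "AE z in mT. norm (f z * g z) \<le> C * D"
    using C(2) D(2) by eventually_elim (use C(1) in \<open>auto simp: norm_mult intro!: mult_mono\<close>)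
  then show ?thesis using LinfD[OF f] LinfD[OF g] by (intro LinfI) auto
qed

lemma Linf_add:
  assumes f: "f \<in> Linf" and g: "g \<in> Linf" shows "(\<lambda>z. f z + g z) \<in> Linf"
proof -
  obtain C where C: "C > 0" "AE z in mT. norm (f z) \<le> C" using f by (rule Linf_boundE)
  obtain D where D: "D > 0" "AE z in mT. norm (g z) \<le> D" using g by (rule Linf_boundE)
  have "AE z in mT. norm (f z + g z) \<le> C + D"
    using C(2) D(2) by eventually_elim (intro order_trans[OF norm_triangle_ineq] add_mono)
  then show ?thesis using LinfD[OF f] LinfD[OF g] by (intro LinfI) auto
qed

lemma Linf_const [simp]: "(\<lambda>_. c) \<in> Linf"
  by (rule LinfI[where C="norm c"]) auto

lemma Linf_scale: "f \<in> Linf \<Longrightarrow> (\<lambda>z. c * f z) \<in> Linf"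
  by (rule Linf_mult) simp_all

lemma Linf_diff: "f \<in> Linf \<Longrightarrow> g \<in> Linf \<Longrightarrow> (\<lambda>z. f z - g z) \<in> Linf"
  using Linf_add[of f "\<lambda>z. (-1) * g z"] Linf_scale[of g "-1"] by simp

lemma Linf_sum: "(\<And>i. i \<in> I \<Longrightarrow> f i \<in> Linf) \<Longrightarrow> (\<lambda>z. \<Sum>i\<in>I. f i z) \<in> Linf"
  by (induction I rule: infinite_finite_induct) (auto intro: Linf_add)

lemma Linf_rotate:
  assumes f: "f \<in> Linf" and w: "norm w = 1" shows "(\<lambda>z. f (w * z)) \<in> Linf"
proof -
  note [measurable] = LinfD[OF f]
  obtain C where C: "C > 0" "AE z in mT. norm (f z) \<le> C" using f by (rule Linf_boundE)
  show ?thesis by (rule LinfI[OF _ AE_rotate[OF w C(2)]]) measurable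
qed

lemma Linf_power:
  assumes f: "f \<in> Linf" and n: "n \<ge> 1" shows "(\<lambda>z. f (z ^ n)) \<in> Linf"
proof -
  note [measurable] = LinfD[OF f]
  obtain C where C: "C > 0" "AE z in mT. norm (f z) \<le> C" using f by (rule Linf_boundE)
  show ?thesis by (rule LinfI[OF _ AE_power[OF n C(2)]]) measurable
qed

lemma Linf_cnj: "f \<in> Linf \<Longrightarrow> (\<lambda>z. cnj (f z)) \<in> Linf"
  unfolding Linf_def by auto

lemma Linf_of_norm: "f \<in> Linf \<Longrightarrow> (\<lambda>z. complex_of_real (norm (f z))) \<in> Linf"
  unfolding Linf_def by auto

lemma Linf_poly: "poly p \<in> Linf"
proof -
  obtain C where C: "\<And>z. norm z = 1 \<Longrightarrow> norm (poly p z) \<le> C"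
    using poly_bounded_circle[of p] by auto
  have "AE z in mT. norm (poly p z) \<le> C" using AE_mT_norm by eventually_elim (rule C)
  then show ?thesis by (intro LinfI) auto
qed

lemma Linf_L2: "f \<in> Linf \<Longrightarrow> f \<in> L2"
  using bounded_L2 by (auto simp: Linf_def)

text \<open>The kernel \<open>z powi (- k)\<close> is an ordinary power of \<open>z\<close> for
  negative \<open>k\<close>, which spares integer exponents from here on.\<close>

lemma Hinf_iff: "f \<in> Hinf \<longleftrightarrow> f \<in> Linf \<and> (\<forall>j\<ge>1. (LINT z|mT. f z * z ^ j) = 0)"
proof -
  have "(\<forall>k::int. k < 0 \<longrightarrow> fourier_coeff f k = 0) \<longleftrightarrow> (\<forall>j\<ge>(1::nat). fourier_coeff f (- int j) = 0)"
  proof safe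
    fix k :: int assume *: "\<forall>j\<ge>(1::nat). fourier_coeff f (- int j) = 0" and k: "k < 0"
    from *[rule_format, of "nat (- k)"] k show "fourier_coeff f k = 0" by simp
  qed auto
  then show ?thesis unfolding Hinf_def fourier_coeff_def by (simp add: power_int_of_nat)
qed

lemma Hinf_subset: "Hinf \<subseteq> borel_measurable borel" "Hinf \<subseteq> Linf"
  by (auto simp: Hinf_iff Linf_def)

lemma ennreal_tendsto_0I:
  fixes X :: "'a \<Rightarrow> ennreal"
  assumes "\<And>e::real. e > 0 \<Longrightarrow> eventually (\<lambda>x. X x \<le> ennreal e) F"
  shows "(X \<longlongrightarrow> 0) F"
proof (rule order_tendstoI)
  fix a :: ennreal assume "0 < a"
  then obtain b where b: "0 < b" "b < a" using dense by blast
  then have bt: "b < top" by (meson less_le_trans top_greatest)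
  have "eventually (\<lambda>x. X x \<le> ennreal (enn2real b)) F"
    using b bt by (intro assms) (auto simp: enn2real_positive_iff)
  then show "eventually (\<lambda>x. X x < a) F"
    by eventually_elim (use b bt in \<open>auto intro: le_less_trans simp: less_top\<close>)
qed simp

lemma ennreal_tendsto_0D:
  fixes X :: "'a \<Rightarrow> ennreal"
  assumes "(X \<longlongrightarrow> 0) F" "e > 0"
  shows "eventually (\<lambda>x. X x \<le> ennreal e) F"
  using order_tendstoD(2)[OF assms(1), of "ennreal e"] assms(2) by (auto elim!: eventually_mono)

lemma integral_norm_tendsto_0_of_AE:
  fixes f :: "nat \<Rightarrow> complex \<Rightarrow> complex"
  assumes [measurable]: "\<And>j. f j \<in> borel_measurable borel" and b: "\<And>j. AE z in mT. norm (f j z) \<le> C"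
    and l: "AE z in mT. (\<lambda>j. f j z) \<longlonglongrightarrow> 0"
  shows "(\<lambda>j. LINT z|mT. norm (f j z)) \<longlonglongrightarrow> 0"
proof -
  have "(\<lambda>j. LINT z|mT. norm (f j z)) \<longlonglongrightarrow> (LINT z|mT. 0)"
  proof (rule integral_dominated_convergence[where w="\<lambda>_. C"])
    show "AE z in mT. (\<lambda>j. norm (f j z)) \<longlonglongrightarrow> 0" using l by eventually_elim (rule tendsto_norm_zero)
  qed (use b in auto)
  then show ?thesis by simp
qed

locale continuous_rot_sym_norm =
  fixes \<alpha> :: "(complex \<Rightarrow> complex) \<Rightarrow> real"
  assumes rs: "rot_sym_norm \<alpha>" and cn: "continuous_norm \<alpha>"
begin

lemma alpha_cong: "f \<in> Linf \<Longrightarrow> g \<in> Linf \<Longrightarrow> AE z in mT. f z = g z \<Longrightarrow> \<alpha> f = \<alpha> g"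
  using rs unfolding rot_sym_norm_def Linf_norm_def by blast

lemma alpha_zero: "\<alpha> (\<lambda>_. 0) = 0"
proof -
  have "\<forall>f\<in>Linf. \<alpha> f = 0 \<longleftrightarrow> (AE z in mT. f z = 0)"
    using rs unfolding rot_sym_norm_def Linf_norm_def by (elim conjE)
  then show ?thesis using Linf_const[of 0] by (auto dest!: bspec)
qed

lemma alpha_triangle: "f \<in> Linf \<Longrightarrow> g \<in> Linf \<Longrightarrow> \<alpha> (\<lambda>z. f z + g z) \<le> \<alpha> f + \<alpha> g"
  using rs unfolding rot_sym_norm_def Linf_norm_def by blast

lemma alpha_scale: "f \<in> Linf \<Longrightarrow> \<alpha> (\<lambda>z. c * f z) = norm c * \<alpha> f"
  using rs unfolding rot_sym_norm_def Linf_norm_def by blast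

lemma alpha_one: "\<alpha> (\<lambda>_. 1) = 1"
  using rs unfolding rot_sym_norm_def by blast

lemma alpha_const: "\<alpha> (\<lambda>_. c) = norm c"
  using alpha_scale[of "\<lambda>_. 1" c] by (simp add: alpha_one)

lemma alpha_norm: "f \<in> Linf \<Longrightarrow> \<alpha> (\<lambda>z. complex_of_real (norm (f z))) = \<alpha> f"
  using rs unfolding rot_sym_norm_def by blast

lemma alpha_rotate: "f \<in> Linf \<Longrightarrow> norm w = 1 \<Longrightarrow> \<alpha> (\<lambda>z. f (w * z)) = \<alpha> f"
  using rs unfolding rot_sym_norm_def by (metis complex_cnj_cnj complex_mod_cnj)

text \<open>A function dominated by g is the average of two functions of the same modulus as g.\<close>

lemma alpha_mono:
  assumes f: "f \<in> Linf" and g: "g \<in> Linf" and le: "AE z in mT. norm (f z) \<le> norm (g z)"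
  shows "\<alpha> f \<le> \<alpha> g"
proof -
  note [measurable] = LinfD[OF f] LinfD[OF g]
  \<comment> \<open>\<open>P\<close> and \<open>Q\<close> are \<open>norm (g z)\<close> times the
    two unimodular numbers with real part \<open>h z\<close>. Where \<open>g z = 0\<close> the
    quotient is 0 by convention, in accordance with \<open>f z = 0\<close> almost everywhere
    there.\<close>
  define h where "h z = min 1 (norm (f z) / norm (g z))" for z
  define P where "P z = complex_of_real (norm (g z)) * (complex_of_real (h z) + \<i> * complex_of_real (sqrt (1 - (h z)\<^sup>2)))" for z
  define Q where "Q z = complex_of_real (norm (g z)) * (complex_of_real (h z) - \<i> * complex_of_real (sqrt (1 - (h z)\<^sup>2)))" for z
  have [measurable]: "h \<in> borel_measurable borel" unfolding h_def by measurable
  have [measurable]: "P \<in> borel_measurable borel" "Q \<in> borel_measurable borel"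
    unfolding P_def Q_def by measurable
  have h01: "0 \<le> h z" "h z \<le> 1" for z by (auto simp: h_def)
  have "(h z)\<^sup>2 \<le> 1" for z using h01[of z] by (simp add: power_le_one)
  then have n1: "norm (P z) = norm (g z)" "norm (Q z) = norm (g z)" for z
    unfolding P_def Q_def norm_mult by (simp_all add: cmod_def)
  obtain C where "AE z in mT. norm (g z) \<le> C" using g by (rule Linf_boundE)
  then have PQ: "P \<in> Linf" "Q \<in> Linf" by (auto intro!: LinfI[where C=C] simp: n1)
  have aP: "\<alpha> P = \<alpha> g" "\<alpha> Q = \<alpha> g" using alpha_norm[OF PQ(1)] alpha_norm[OF PQ(2)] alpha_norm[OF g] by (simp_all add: n1)
  have "\<alpha> f = \<alpha> (\<lambda>z. complex_of_real (norm (f z)))" using alpha_norm[OF f] by simp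
  also have "\<dots> = \<alpha> (\<lambda>z. (1/2) * (P z + Q z))"
  proof (rule alpha_cong)
    show "(\<lambda>z. complex_of_real (norm (f z))) \<in> Linf" by (rule Linf_of_norm[OF f])
    show "(\<lambda>z. (1/2) * (P z + Q z)) \<in> Linf" by (intro Linf_scale Linf_add PQ)
    show "AE z in mT. complex_of_real (norm (f z)) = (1/2) * (P z + Q z)"
      using le
    proof eventually_elim
      case (elim z)
      have "norm (g z) * h z = norm (f z)"
        using elim by (cases "g z = 0") (auto simp: h_def min_def)
      then show ?case by (simp add: P_def Q_def complex_eq_iff)
    qed
  qed
  also have "\<dots> = (1/2) * \<alpha> (\<lambda>z. P z + Q z)" by (subst alpha_scale) (auto intro: Linf_add PQ)
  also have "\<dots> \<le> (1/2) * (\<alpha> P + \<alpha> Q)" using alpha_triangle[OF PQ] by simp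
  also have "\<dots> = \<alpha> g" by (simp add: aP)
  finally show ?thesis .
qed

lemma alpha_nonneg: "f \<in> Linf \<Longrightarrow> 0 \<le> \<alpha> f"
  using alpha_mono[of "\<lambda>_. 0" f] by (simp add: alpha_zero)

lemma alpha_le_bound:
  assumes "f \<in> Linf" "AE z in mT. norm (f z) \<le> C" "C \<ge> 0"
  shows "\<alpha> f \<le> C"
  using alpha_mono[OF assms(1), of "\<lambda>_. of_real C"] assms(2,3) by (simp add: alpha_const)

lemma alpha_sum_le: "(\<And>i. i \<in> I \<Longrightarrow> f i \<in> Linf) \<Longrightarrow> \<alpha> (\<lambda>z. \<Sum>i\<in>I. f i z) \<le> (\<Sum>i\<in>I. \<alpha> (f i))"
proof (induction I rule: infinite_finite_induct)
  case (insert x F)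
  have "\<alpha> (\<lambda>z. f x z + (\<Sum>i\<in>F. f i z)) \<le> \<alpha> (f x) + \<alpha> (\<lambda>z. \<Sum>i\<in>F. f i z)"
    using insert by (intro alpha_triangle Linf_sum) auto
  then show ?case using insert by force
qed (auto simp: alpha_zero)

section \<open>The extension of the norm to measurable functions\<close>

text \<open>The supremum that defines the extension ranges over functions of finite range, so
  \<open>norm (g z)\<close> is rounded down to multiples of \<open>e\<close>, at a cost of at most
  \<open>e\<close> in \<open>\<alpha>\<close>. Bounded minorants may then be used in place of simple
  ones.\<close>

lemma ext_ge:
  assumes g: "g \<in> Linf" and le: "AE z in mT. norm (g z) \<le> norm (f z)"
  shows "ennreal (\<alpha> g) \<le> alpha_ext \<alpha> f"
proof (rule ennreal_le_epsilon)
  fix e :: real assume e: "e > 0"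
  note [measurable] = LinfD[OF g]
  obtain C where C: "C > 0" "AE z in mT. norm (g z) \<le> C" using g by (rule Linf_boundE)
  \<comment> \<open>The essential bound holds only almost everywhere, whereas finiteness of the
    range is demanded everywhere; hence the cap by \<open>C\<close>.\<close>
  define s where "s z = e * of_int \<lfloor>min (norm (g z)) C / e\<rfloor>" for z
  have [measurable]: "s \<in> borel_measurable borel" unfolding s_def by measurable
  have "range s \<subseteq> (\<lambda>k. e * of_int k) ` {0..\<lfloor>C / e\<rfloor>}"
  proof safe
    fix z
    have "\<lfloor>min (norm (g z)) C / e\<rfloor> \<in> {0..\<lfloor>C / e\<rfloor>}"
      using e C(1) by (auto intro!: floor_mono divide_right_mono)
    then show "s z \<in> (\<lambda>k. e * of_int k) ` {0..\<lfloor>C / e\<rfloor>}" unfolding s_def by (rule imageI)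
  qed
  then have fin: "finite (range s)" by (rule finite_subset) simp
  have s: "0 \<le> s z" "s z \<le> min (norm (g z)) C" "min (norm (g z)) C \<le> s z + e" for z
  proof -
    show "0 \<le> s z" unfolding s_def using e C(1) by simp
    define m where "m = min (norm (g z)) C"
    have sm: "s z = e * of_int \<lfloor>m / e\<rfloor>" by (simp add: s_def m_def)
    have "e * of_int \<lfloor>m / e\<rfloor> \<le> e * (m / e)" "e * (m / e) \<le> e * (of_int \<lfloor>m / e\<rfloor> + 1)"
      using e by (intro mult_left_mono; linarith)+
    then show "s z \<le> min (norm (g z)) C" "min (norm (g z)) C \<le> s z + e"
      unfolding sm m_def[symmetric] using e by (simp_all add: distrib_left)
  qed
  have sL: "(\<lambda>z. complex_of_real (s z)) \<in> Linf"
  proof (rule LinfI[where C=C])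
    have "norm (complex_of_real (s z)) \<le> C" for z using s[of z] by simp
    then show "AE z in mT. norm (complex_of_real (s z)) \<le> C" by simp
  qed measurable
  have "\<alpha> g = \<alpha> (\<lambda>z. complex_of_real (norm (g z)))" using alpha_norm[OF g] by simp
  also have "\<dots> = \<alpha> (\<lambda>z. complex_of_real (s z) + (complex_of_real (norm (g z)) - complex_of_real (s z)))" by simp
  also have "\<dots> \<le> \<alpha> (\<lambda>z. complex_of_real (s z)) + \<alpha> (\<lambda>z. complex_of_real (norm (g z)) - complex_of_real (s z))"
    by (intro alpha_triangle sL Linf_diff Linf_of_norm g)
  also have "\<alpha> (\<lambda>z. complex_of_real (norm (g z)) - complex_of_real (s z)) \<le> e"
  proof (rule alpha_le_bound)
    show "(\<lambda>z. complex_of_real (norm (g z)) - complex_of_real (s z)) \<in> Linf" by (intro Linf_diff sL Linf_of_norm g)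
    show "AE z in mT. norm (complex_of_real (norm (g z)) - complex_of_real (s z)) \<le> e"
      using C(2)
    proof eventually_elim
      case (elim z)
      then show ?case using s[of z] unfolding of_real_diff[symmetric] norm_of_real by (auto simp: min_def)
    qed
  qed (use e in simp)
  finally have "\<alpha> g \<le> \<alpha> (\<lambda>z. complex_of_real (s z)) + e" by simp
  then have "ennreal (\<alpha> g) \<le> ennreal (\<alpha> (\<lambda>z. complex_of_real (s z))) + ennreal e"
    using e alpha_nonneg[OF sL] by (simp add: ennreal_plus[symmetric] ennreal_leI del: ennreal_plus)
  also have "ennreal (\<alpha> (\<lambda>z. complex_of_real (s z))) \<le> alpha_ext \<alpha> f"
    unfolding alpha_ext_def
  proof (rule SUP_upper, intro CollectI conjI)
    show "AE z in mT. 0 \<le> s z \<and> s z \<le> norm (f z)"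
      using le
    proof eventually_elim
      case (elim z) then show ?case using s[of z] by auto
    qed
  qed (use fin in auto)
  finally show "ennreal (\<alpha> g) \<le> alpha_ext \<alpha> f + ennreal e" by (simp add: add_right_mono)
qed

text \<open>Simple minorants are bounded, and boundedness is what the later estimates work with.
  This bounds the supremum from above, as \<open>ext_ge\<close> bounds it from below.\<close>

lemma ext_leI:
  assumes "\<And>s. s \<in> borel_measurable borel \<Longrightarrow> (\<lambda>z. complex_of_real (s z)) \<in> Linf \<Longrightarrow>
     AE z in mT. 0 \<le> s z \<and> s z \<le> norm (f z) \<Longrightarrow> ennreal (\<alpha> (\<lambda>z. complex_of_real (s z))) \<le> B"
  shows "alpha_ext \<alpha> f \<le> B"
  unfolding alpha_ext_def
proof (rule SUP_least, elim CollectE conjE)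
  fix s :: "complex \<Rightarrow> real"
  assume s: "s \<in> borel_measurable mT" "finite (range s)" "AE z in mT. 0 \<le> s z \<and> s z \<le> norm (f z)"
  have "norm (complex_of_real (s z)) \<le> Max ((\<lambda>x. \<bar>x\<bar>) ` range s)" for z
    using s(2) by (auto intro!: Max_ge)
  then have "(\<lambda>z. complex_of_real (s z)) \<in> Linf"
    using s(1) by (intro LinfI[where C="Max ((\<lambda>x. \<bar>x\<bar>) ` range s)"]) (auto simp del: norm_of_real)
  then show "ennreal (\<alpha> (\<lambda>z. complex_of_real (s z))) \<le> B" using s by (intro assms) auto
qed

lemma ext_Linf: "f \<in> Linf \<Longrightarrow> alpha_ext \<alpha> f = ennreal (\<alpha> f)"
proof (rule antisym)
  assume f: "f \<in> Linf"
  show "ennreal (\<alpha> f) \<le> alpha_ext \<alpha> f" by (rule ext_ge[OF f]) simp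
  show "alpha_ext \<alpha> f \<le> ennreal (\<alpha> f)"
  proof (rule ext_leI)
    fix s assume s: "(\<lambda>z. complex_of_real (s z)) \<in> Linf" "AE z in mT. 0 \<le> s z \<and> s z \<le> norm (f z)"
    have "AE z in mT. norm (complex_of_real (s z)) \<le> norm (f z)" using s(2) by eventually_elim simp
    then show "ennreal (\<alpha> (\<lambda>z. complex_of_real (s z))) \<le> ennreal (\<alpha> f)"
      by (intro ennreal_leI alpha_mono s f)
  qed
qed

lemma ext_mono: "AE z in mT. norm (f z) \<le> norm (g z) \<Longrightarrow> alpha_ext \<alpha> f \<le> alpha_ext \<alpha> g"
proof (rule ext_leI)
  fix s assume le: "AE z in mT. norm (f z) \<le> norm (g z)"
    and s: "(\<lambda>z. complex_of_real (s z)) \<in> Linf" "AE z in mT. 0 \<le> s z \<and> s z \<le> norm (f z)"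
  have "AE z in mT. norm (complex_of_real (s z)) \<le> norm (g z)" using s(2) le by eventually_elim simp
  then show "ennreal (\<alpha> (\<lambda>z. complex_of_real (s z))) \<le> alpha_ext \<alpha> g" by (rule ext_ge[OF s(1)])
qed

lemma ext_cong: "AE z in mT. norm (f z) = norm (g z) \<Longrightarrow> alpha_ext \<alpha> f = alpha_ext \<alpha> g"
  by (intro antisym ext_mono) (auto elim!: eventually_mono)

lemma ext_zero: "AE z in mT. f z = 0 \<Longrightarrow> alpha_ext \<alpha> f = 0"
  using ext_cong[of f "\<lambda>_. 0"] ext_Linf[of "\<lambda>_. 0"] by (auto simp: alpha_zero)

lemma ext_diff_commute: "alpha_ext \<alpha> (\<lambda>z. f z - g z) = alpha_ext \<alpha> (\<lambda>z. g z - f z)"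
  by (rule ext_cong) (simp add: norm_minus_commute)

text \<open>A minorant of \<open>norm (f z + g z)\<close> is split in the proportion of
  \<open>norm (f z)\<close> to \<open>norm (g z)\<close> into minorants of the two summands.\<close>

lemma ext_triangle:
  assumes [measurable]: "f \<in> borel_measurable borel" "g \<in> borel_measurable borel"
  shows "alpha_ext \<alpha> (\<lambda>z. f z + g z) \<le> alpha_ext \<alpha> f + alpha_ext \<alpha> g"
proof (rule ext_leI)
  fix s :: "complex \<Rightarrow> real"
  assume [measurable]: "s \<in> borel_measurable borel" and sL: "(\<lambda>z. complex_of_real (s z)) \<in> Linf"
    and s: "AE z in mT. 0 \<le> s z \<and> s z \<le> norm (f z + g z)"
  \<comment> \<open>Where both functions vanish the quotients are 0 by convention, and
    \<open>s\<close> vanishes almost everywhere there.\<close>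
  define a where "a z = norm (f z) / (norm (f z) + norm (g z))" for z
  define b where "b z = norm (g z) / (norm (f z) + norm (g z))" for z
  have [measurable]: "a \<in> borel_measurable borel" "b \<in> borel_measurable borel"
    unfolding a_def b_def by measurable
  have ab: "0 \<le> a z" "a z \<le> 1" "0 \<le> b z" "b z \<le> 1" for z
  proof -
    have "x / (x + y) \<le> 1" "y / (x + y) \<le> 1" if "x \<ge> 0" "y \<ge> 0" for x y :: real
      using that by (cases "x + y = 0"; simp add: divide_le_eq_1; linarith)+
    then show "0 \<le> a z" "a z \<le> 1" "0 \<le> b z" "b z \<le> 1" by (auto simp: a_def b_def)
  qed
  have aL: "(\<lambda>z. complex_of_real (a z) * complex_of_real (s z)) \<in> Linf" "(\<lambda>z. complex_of_real (b z) * complex_of_real (s z)) \<in> Linf"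
  proof -
    have "(\<lambda>z. complex_of_real (a z)) \<in> Linf" "(\<lambda>z. complex_of_real (b z)) \<in> Linf"
      using ab by (auto intro!: LinfI[where C=1])
    then show "(\<lambda>z. complex_of_real (a z) * complex_of_real (s z)) \<in> Linf" "(\<lambda>z. complex_of_real (b z) * complex_of_real (s z)) \<in> Linf"
      by (auto intro: Linf_mult sL)
  qed
  have main: "AE z in mT. s z = a z * s z + b z * s z \<and> \<bar>a z * s z\<bar> \<le> norm (f z) \<and> \<bar>b z * s z\<bar> \<le> norm (g z)"
    using s
  proof eventually_elim
    case (elim z)
    have le: "s z \<le> norm (f z) + norm (g z)" using elim norm_triangle_ineq[of "f z" "g z"] by linarith
    show ?case
    proof (cases "norm (f z) + norm (g z) = 0")
      case True
      then show ?thesis using elim le by (simp add: a_def b_def)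
    next
      case False
      have "a z + b z = 1" using False by (simp add: a_def b_def add_divide_distrib[symmetric])
      then have "s z = a z * s z + b z * s z" by (metis distrib_right mult_1)
      moreover have "a z * s z \<le> a z * (norm (f z) + norm (g z))" "b z * s z \<le> b z * (norm (f z) + norm (g z))"
        using le ab by (auto intro!: mult_left_mono)
      moreover have "a z * (norm (f z) + norm (g z)) = norm (f z)" "b z * (norm (f z) + norm (g z)) = norm (g z)"
        using False by (auto simp: a_def b_def)
      moreover have "0 \<le> a z * s z" "0 \<le> b z * s z" using ab elim by auto
      ultimately show ?thesis by simp
    qed
  qed
  have "\<alpha> (\<lambda>z. complex_of_real (s z)) = \<alpha> (\<lambda>z. complex_of_real (a z) * complex_of_real (s z) + complex_of_real (b z) * complex_of_real (s z))"
  proof (rule alpha_cong[OF sL Linf_add[OF aL]])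
    show "AE z in mT. complex_of_real (s z) = complex_of_real (a z) * complex_of_real (s z) + complex_of_real (b z) * complex_of_real (s z)"
      using main by eventually_elim (metis of_real_add of_real_mult)
  qed
  also have "\<dots> \<le> \<alpha> (\<lambda>z. complex_of_real (a z) * complex_of_real (s z)) + \<alpha> (\<lambda>z. complex_of_real (b z) * complex_of_real (s z))"
    by (rule alpha_triangle[OF aL])
  finally have "ennreal (\<alpha> (\<lambda>z. complex_of_real (s z))) \<le> ennreal (\<alpha> (\<lambda>z. complex_of_real (a z) * complex_of_real (s z)))
     + ennreal (\<alpha> (\<lambda>z. complex_of_real (b z) * complex_of_real (s z)))"
    using alpha_nonneg[OF aL(1)] alpha_nonneg[OF aL(2)] by (simp add: ennreal_plus[symmetric] ennreal_leI del: ennreal_plus)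
  also have "\<dots> \<le> alpha_ext \<alpha> f + alpha_ext \<alpha> g"
    by (intro add_mono ext_ge aL) (use main in \<open>eventually_elim, simp add: abs_mult norm_mult\<close>)+
  finally show "ennreal (\<alpha> (\<lambda>z. complex_of_real (s z))) \<le> alpha_ext \<alpha> f + alpha_ext \<alpha> g" .
qed

lemma ext_triangle_diff:
  assumes "f \<in> borel_measurable borel" "g \<in> borel_measurable borel" "h \<in> borel_measurable borel"
  shows "alpha_ext \<alpha> (\<lambda>z. f z - h z) \<le> alpha_ext \<alpha> (\<lambda>z. f z - g z) + alpha_ext \<alpha> (\<lambda>z. g z - h z)"
  using ext_triangle[of "\<lambda>z. f z - g z" "\<lambda>z. g z - h z"] assms by simp

lemma ext_sum_le:
  assumes "\<And>i. i \<in> I \<Longrightarrow> f i \<in> borel_measurable borel"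
  shows "alpha_ext \<alpha> (\<lambda>z. \<Sum>i\<in>I. f i z) \<le> (\<Sum>i\<in>I. alpha_ext \<alpha> (f i))"
  using assms
proof (induction I rule: infinite_finite_induct)
  case (insert x F)
  have "alpha_ext \<alpha> (\<lambda>z. f x z + (\<Sum>i\<in>F. f i z)) \<le> alpha_ext \<alpha> (f x) + alpha_ext \<alpha> (\<lambda>z. \<Sum>i\<in>F. f i z)"
    using insert by (intro ext_triangle) auto
  also have "\<dots> \<le> alpha_ext \<alpha> (f x) + (\<Sum>i\<in>F. alpha_ext \<alpha> (f i))"
    using insert by (intro add_mono) auto
  finally show ?case using insert by simp
qed (auto simp: ext_zero)

lemma ext_mult_bounded:
  assumes C: "C > 0" "AE z in mT. norm (\<phi> z) \<le> C"
  shows "alpha_ext \<alpha> (\<lambda>z. \<phi> z * f z) \<le> ennreal C * alpha_ext \<alpha> f"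
proof (rule ext_leI)
  fix s assume sL: "(\<lambda>z. complex_of_real (s z)) \<in> Linf"
    and s: "AE z in mT. 0 \<le> s z \<and> s z \<le> norm (\<phi> z * f z)"
  have L: "(\<lambda>z. complex_of_real (1 / C) * complex_of_real (s z)) \<in> Linf" by (rule Linf_scale[OF sL])
  have "\<alpha> (\<lambda>z. complex_of_real (1 / C) * complex_of_real (s z)) = (1 / C) * \<alpha> (\<lambda>z. complex_of_real (s z))"
    unfolding alpha_scale[OF sL] using C by (simp add: norm_divide)
  then have "\<alpha> (\<lambda>z. complex_of_real (s z)) = C * \<alpha> (\<lambda>z. complex_of_real (1 / C) * complex_of_real (s z))"
    using C by simp
  then have "ennreal (\<alpha> (\<lambda>z. complex_of_real (s z))) = ennreal C * ennreal (\<alpha> (\<lambda>z. complex_of_real (1 / C) * complex_of_real (s z)))"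
    using C by (simp add: ennreal_mult')
  also have "\<dots> \<le> ennreal C * alpha_ext \<alpha> f"
  proof (intro mult_left_mono ext_ge[OF L])
    show "AE z in mT. norm (complex_of_real (1 / C) * complex_of_real (s z)) \<le> norm (f z)"
      using s C(2)
    proof eventually_elim
      case (elim z)
      have "s z \<le> C * norm (f z)"
        using elim mult_right_mono[OF elim(2) norm_ge_zero[of "f z"]] by (simp add: norm_mult)
      then show ?case using elim C(1) by (simp add: norm_divide field_simps)
    qed
  qed simp
  finally show "ennreal (\<alpha> (\<lambda>z. complex_of_real (s z))) \<le> ennreal C * alpha_ext \<alpha> f" .
qed

text \<open>Minorants are carried along by the inverse rotation, and \<open>\<alpha>\<close> does
  not notice.\<close>

lemma ext_rotate:
  assumes w: "norm w = 1"
  shows "alpha_ext \<alpha> (\<lambda>z. f (w * z)) \<le> alpha_ext \<alpha> f"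
proof (rule ext_leI)
  fix s assume sL: "(\<lambda>z. complex_of_real (s z)) \<in> Linf"
    and s: "AE z in mT. 0 \<le> s z \<and> s z \<le> norm (f (w * z))"
  have w': "norm (cnj w) = 1" using w by simp
  have eq: "w * (cnj w * z) = z" for z using circle_mult_cnj[OF w] by (simp add: mult.assoc[symmetric])
  have "AE z in mT. 0 \<le> s (cnj w * z) \<and> s (cnj w * z) \<le> norm (f z)"
    using AE_rotate[OF w' s] unfolding eq .
  then have "AE z in mT. norm (complex_of_real (s (cnj w * z))) \<le> norm (f z)" by eventually_elim simp
  then have "ennreal (\<alpha> (\<lambda>z. complex_of_real (s (cnj w * z)))) \<le> alpha_ext \<alpha> f"
    by (rule ext_ge[OF Linf_rotate[OF sL w']])
  then show "ennreal (\<alpha> (\<lambda>z. complex_of_real (s z))) \<le> alpha_ext \<alpha> f"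
    using alpha_rotate[OF sL w'] by simp
qed

text \<open>A fibre sum consists of \<open>n\<close> rotates of \<open>f\<close>, each of extended
  norm at most that of \<open>f\<close>.\<close>

lemma ext_rsum:
  assumes n: "n \<ge> 1" and [measurable]: "f \<in> borel_measurable borel"
  shows "alpha_ext \<alpha> (rsum n f) \<le> of_nat n * alpha_ext \<alpha> f"
proof -
  have "alpha_ext \<alpha> (rsum n f) \<le> (\<Sum>u\<in>{u::complex. u ^ n = 1}. alpha_ext \<alpha> (\<lambda>z. f (u * z)))"
    unfolding rsum_def[abs_def] by (rule ext_sum_le) measurable
  also have "\<dots> \<le> (\<Sum>u\<in>{u::complex. u ^ n = 1}. alpha_ext \<alpha> f)"
    using n by (intro sum_mono ext_rotate) (auto intro: root_unity_norm)
  also have "\<dots> = of_nat n * alpha_ext \<alpha> f" using n by (simp add: card_roots_unity_eq)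
  finally show ?thesis .
qed

section \<open>Convergence in the norm and domination of the L1 norm\<close>

text \<open>By Markov's inequality \<open>g j\<close> reaches \<open>e / 2\<close> only on a set of
  small measure, where it is at most \<open>B\<close>; continuity of the norm makes the contribution
  of that set small.\<close>

lemma alpha_bounded_convergence:
  assumes [measurable]: "\<And>j. g j \<in> borel_measurable borel" and B: "\<And>j. AE z in mT. norm (g j z) \<le> B"
    and l: "(\<lambda>j::nat. LINT z|mT. norm (g j z)) \<longlonglongrightarrow> 0"
  shows "(\<lambda>j. \<alpha> (g j)) \<longlonglongrightarrow> 0"
proof (rule LIMSEQ_I)
  fix e :: real assume e: "e > 0"
  have gL: "g j \<in> Linf" for j using B by (intro LinfI) auto
  have B0: "B \<ge> 0" using AE_mT_ex[OF B[of 0]] by (meson norm_ge_zero order_trans)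
  have gi: "integrable mT (\<lambda>z. norm (g j z))" for j
    using integrable_mT_bounded[OF _ B] by auto
  \<comment> \<open>The share \<open>B * e'\<close> of the exceptional set must stay below
    \<open>e / 2\<close>; \<open>B + 1\<close> keeps the quotient meaningful when \<open>B\<close>
    is 0.\<close>
  define e' where "e' = e / (2 * (B + 1))"
  have e': "e' > 0" using e B0 by (simp add: e'_def)
  obtain \<delta> where \<delta>: "\<delta> > 0" "\<And>E. E \<in> sets mT \<Longrightarrow> measure mT E < \<delta> \<Longrightarrow> \<alpha> (\<lambda>z. complex_of_real (indicator E z)) < e'"
    using cn e' unfolding continuous_norm_def by meson
  have "\<forall>\<^sub>F j in sequentially. (LINT z|mT. norm (g j z)) < \<delta> * (e / 2)"
    using l e \<delta>(1) by (intro order_tendstoD) auto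
  then obtain N where N: "\<And>j. j \<ge> N \<Longrightarrow> (LINT z|mT. norm (g j z)) < \<delta> * (e / 2)"
    unfolding eventually_sequentially by auto
  have "norm (\<alpha> (g j) - 0) < e" if j: "j \<ge> N" for j
  proof -
    define E where "E = {z. norm (g j z) \<ge> e / 2}"
    have [measurable]: "E \<in> sets borel" unfolding E_def by measurable
    have "measure mT E \<le> (LINT z|mT. norm (g j z)) / (e / 2)"
      using integral_Markov_inequality_measure[OF gi[of j], of UNIV "e/2"] e by (simp add: E_def)
    also have "\<dots> < \<delta>" using N[OF j] e by (simp add: field_simps)
    finally have aE: "\<alpha> (\<lambda>z. complex_of_real (indicator E z)) < e'" by (intro \<delta>) auto
    have iL: "(\<lambda>z. complex_of_real (indicator E z)) \<in> Linf"
      by (rule LinfI[where C=1]) (auto simp: indicator_def)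
    have "\<alpha> (g j) \<le> \<alpha> (\<lambda>z. complex_of_real (e / 2) + complex_of_real B * complex_of_real (indicator E z))"
    proof (rule alpha_mono[OF gL])
      show "(\<lambda>z. complex_of_real (e / 2) + complex_of_real B * complex_of_real (indicator E z)) \<in> Linf"
        by (intro Linf_add Linf_scale iL Linf_const)
      show "AE z in mT. norm (g j z) \<le> norm (complex_of_real (e / 2) + complex_of_real B * complex_of_real (indicator E z))"
        using B[of j]
      proof eventually_elim
        case (elim z)
        have "norm (g j z) \<le> e / 2 + B * indicator E z" using elim e by (auto simp: E_def indicator_def)
        then show ?case unfolding of_real_mult[symmetric] of_real_add[symmetric] norm_of_real by linarith
      qed
    qed
    also have "\<dots> \<le> \<alpha> (\<lambda>z. complex_of_real (e / 2)) + \<alpha> (\<lambda>z. complex_of_real B * complex_of_real (indicator E z))"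
      by (intro alpha_triangle Linf_scale iL Linf_const)
    also have "\<dots> = e / 2 + B * \<alpha> (\<lambda>z. complex_of_real (indicator E z))"
      unfolding alpha_const alpha_scale[OF iL] using e B0 by simp
    also have "\<dots> \<le> e / 2 + B * e'" using aE B0 by (intro add_mono mult_left_mono) auto
    also have "\<dots> < e / 2 + (B + 1) * e'" using e' by simp
    also have "\<dots> = e" using B0 by (simp add: e'_def field_simps)
    finally show ?thesis using alpha_nonneg[OF gL] by simp
  qed
  then show "\<exists>N. \<forall>j\<ge>N. norm (\<alpha> (g j) - 0) < e" by (intro exI[of _ N]) auto
qed

text \<open>Averaging over many roots of unity turns a polynomial into its mean.\<close>

lemma integral_Re_poly_le_alpha:
  "(LINT z|mT. Re (poly p z)) \<le> \<alpha> (\<lambda>z. complex_of_real (Re (poly p z)))"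
proof -
  define n where "n = Suc (degree p)"
  have n: "n \<ge> 1" "degree p < n" by (auto simp: n_def)
  define R where "R z = complex_of_real (Re (poly p z))" for z
  obtain C where C: "AE z in mT. norm (poly p z) \<le> C" using Linf_boundE[OF Linf_poly] by metis
  have "AE z in mT. norm (R z) \<le> C"
    using C by eventually_elim (metis R_def abs_Re_le_cmod norm_of_real order_trans)
  then have RL: "R \<in> Linf" by (intro LinfI[where C=C]) (auto simp: R_def[abs_def])
  have "rsum n R z = complex_of_real (Re (rsum n (poly p) z))" for z
    by (simp add: rsum_def R_def)
  also have "\<dots> z = of_nat n * complex_of_real (Re (coeff p 0))" for z
    unfolding rsum_poly_const[OF n(2)] by simp
  finally have r: "rsum n R = (\<lambda>z. of_nat n * complex_of_real (Re (coeff p 0)))" by auto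
  have "real n * \<bar>Re (coeff p 0)\<bar> = \<alpha> (rsum n R)" unfolding r alpha_const by (simp add: norm_mult)
  also have "\<dots> \<le> (\<Sum>u\<in>{u::complex. u ^ n = 1}. \<alpha> (\<lambda>z. R (u * z)))"
    unfolding rsum_def[abs_def] by (intro alpha_sum_le Linf_rotate RL) (auto intro: root_unity_norm[OF n(1)])
  also have "\<dots> = (\<Sum>u\<in>{u::complex. u ^ n = 1}. \<alpha> R)"
    by (intro sum.cong refl alpha_rotate RL) (auto intro: root_unity_norm[OF n(1)])
  also have "\<dots> = real n * \<alpha> R" using n by (simp add: card_roots_unity_eq)
  finally have "\<bar>Re (coeff p 0)\<bar> \<le> \<alpha> R" using n by simp
  moreover have "(LINT z|mT. Re (poly p z)) = Re (coeff p 0)"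
    using integral_Re[OF integrable_mT_poly] by (simp add: integral_mT_poly)
  ultimately show ?thesis by (simp add: R_def[abs_def])
qed

text \<open>The inequality is known for real parts of polynomials. Uniformly bounded ones converge
  to \<open>norm (f z)\<close> almost everywhere, hence also in \<open>\<alpha>\<close> by bounded
  convergence, and both sides pass to the limit.\<close>

lemma integral_norm_le_alpha:
  assumes f: "f \<in> Linf"
  shows "(LINT z|mT. norm (f z)) \<le> \<alpha> f"
proof -
  note [measurable] = LinfD[OF f]
  obtain C where C: "C > 0" "AE z in mT. norm (f z) \<le> C" using f by (rule Linf_boundE)
  define V where "V z = complex_of_real (norm (f z))" for z
  have VL: "V \<in> Linf" unfolding V_def by (rule Linf_of_norm[OF f])
  note [measurable] = LinfD[OF VL]
  have "AE z in mT. 0 \<le> norm (f z) \<and> norm (f z) \<le> C" using C(2) by eventually_elim simp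
  from bounded_limit_Re_poly[OF _ this] obtain p where
    p: "\<forall>j z. norm z = 1 \<longrightarrow> 0 \<le> Re (poly (p j) z) \<and> Re (poly (p j) z) \<le> C + 1"
    and l: "AE z in mT. (\<lambda>j. Re (poly (p j) z)) \<longlonglongrightarrow> norm (f z)" by auto
  define P where "P j z = complex_of_real (Re (poly (p j) z))" for j z
  have [measurable]: "P j \<in> borel_measurable borel" for j unfolding P_def by measurable
  have Pb: "AE z in mT. norm (P j z) \<le> C + 1" for j
    using AE_mT_norm by eventually_elim (use p in \<open>auto simp: P_def\<close>)
  have PL: "P j \<in> Linf" for j by (rule LinfI[OF _ Pb]) measurable
  have l0: "AE z in mT. (\<lambda>j. P j z - V z) \<longlonglongrightarrow> 0"
    using l by eventually_elim (auto simp: P_def V_def LIM_zero_iff intro!: tendsto_of_real)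
  have "(\<lambda>j. \<alpha> (\<lambda>z. P j z - V z)) \<longlonglongrightarrow> 0"
  proof (rule alpha_bounded_convergence)
    show b: "AE z in mT. norm (P j z - V z) \<le> (C + 1) + C" for j
      using Pb[of j] C(2) by eventually_elim (intro order_trans[OF norm_triangle_ineq4] add_mono, auto simp: V_def)
    show "(\<lambda>j. LINT z|mT. norm (P j z - V z)) \<longlonglongrightarrow> 0"
      by (rule integral_norm_tendsto_0_of_AE[OF _ b l0]) measurable
  qed measurable
  then have r: "(\<lambda>j. \<alpha> V + \<alpha> (\<lambda>z. P j z - V z)) \<longlonglongrightarrow> \<alpha> V + 0" by (intro tendsto_intros)
  have "(\<lambda>j. LINT z|mT. Re (poly (p j) z)) \<longlonglongrightarrow> (LINT z|mT. norm (f z))"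
  proof (rule integral_dominated_convergence[where w="\<lambda>_. C + 1"])
    show "AE z in mT. norm (Re (poly (p j) z)) \<le> C + 1" for j
      using Pb[of j] by eventually_elim (simp add: P_def)
  qed (use l in auto)
  moreover have "(LINT z|mT. Re (poly (p j) z)) \<le> \<alpha> V + \<alpha> (\<lambda>z. P j z - V z)" for j
  proof -
    have "(LINT z|mT. Re (poly (p j) z)) \<le> \<alpha> (P j)" unfolding P_def by (rule integral_Re_poly_le_alpha)
    also have "\<alpha> (P j) = \<alpha> (\<lambda>z. V z + (P j z - V z))" by simp
    also have "\<dots> \<le> \<alpha> V + \<alpha> (\<lambda>z. P j z - V z)" by (intro alpha_triangle VL Linf_diff PL)
    finally show ?thesis .
  qed
  ultimately have "(LINT z|mT. norm (f z)) \<le> \<alpha> V + 0" using r by (intro LIMSEQ_le) auto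
  then show ?thesis using alpha_norm[OF f] by (simp add: V_def[abs_def])
qed

text \<open>Cutting the modulus off at level \<open>k\<close> gives bounded minorants, for which the
  L1 bound is known; monotone convergence removes the cut-off.\<close>

lemma nn_integral_le_ext:
  assumes [measurable]: "f \<in> borel_measurable borel"
  shows "(\<integral>\<^sup>+ z. ennreal (norm (f z)) \<partial>mT) \<le> alpha_ext \<alpha> f"
proof -
  define g where "g k z = complex_of_real (min (norm (f z)) (real k))" for k z
  have ng: "norm (g k z) = min (norm (f z)) (real k)" for k z unfolding g_def norm_of_real by simp
  have [measurable]: "g k \<in> borel_measurable borel" for k unfolding g_def by measurable
  have gL: "g k \<in> Linf" for k by (rule LinfI[where C="real k"]) (auto simp: ng)
  have le: "(\<integral>\<^sup>+ z. ennreal (norm (g k z)) \<partial>mT) \<le> alpha_ext \<alpha> f" for k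
  proof -
    have "(\<integral>\<^sup>+ z. ennreal (norm (g k z)) \<partial>mT) = ennreal (LINT z|mT. norm (g k z))"
      by (intro nn_integral_eq_integral integrable_norm L2_integrable Linf_L2 gL) auto
    also have "\<dots> \<le> ennreal (\<alpha> (g k))" by (intro ennreal_leI integral_norm_le_alpha gL)
    also have "\<dots> \<le> alpha_ext \<alpha> f" by (rule ext_ge[OF gL]) (auto simp: ng)
    finally show ?thesis .
  qed
  have "(SUP k. ennreal (norm (g k z))) = ennreal (norm (f z))" for z
  proof (rule antisym)
    show "(SUP k. ennreal (norm (g k z))) \<le> ennreal (norm (f z))"
      by (rule SUP_least) (auto simp: ng intro!: ennreal_leI)
    obtain k where "norm (f z) \<le> real k" using real_arch_simple by blast
    then have "ennreal (norm (f z)) = ennreal (norm (g k z))" by (simp add: ng)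
    also have "\<dots> \<le> (SUP k. ennreal (norm (g k z)))" by (rule SUP_upper) simp
    finally show "ennreal (norm (f z)) \<le> (SUP k. ennreal (norm (g k z)))" .
  qed
  then have "(\<integral>\<^sup>+ z. ennreal (norm (f z)) \<partial>mT) = (\<integral>\<^sup>+ z. (SUP k. ennreal (norm (g k z))) \<partial>mT)" by simp
  also have "\<dots> = (SUP k. \<integral>\<^sup>+ z. ennreal (norm (g k z)) \<partial>mT)"
    by (intro nn_integral_monotone_convergence_SUP)
       (auto simp: incseq_def le_fun_def ng intro!: ennreal_leI)
  also have "\<dots> \<le> alpha_ext \<alpha> f" by (intro SUP_least le)
  finally show ?thesis .
qed

lemma ext_eq_0_imp_AE:
  assumes [measurable]: "f \<in> borel_measurable borel" and "alpha_ext \<alpha> f = 0"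
  shows "AE z in mT. f z = 0"
proof -
  have "(\<integral>\<^sup>+ z. ennreal (norm (f z)) \<partial>mT) = 0" using nn_integral_le_ext[OF assms(1)] assms(2) by simp
  then show ?thesis by (subst (asm) nn_integral_0_iff_AE) auto
qed

lemma ext_finite_integrable:
  assumes [measurable]: "f \<in> borel_measurable borel" and "alpha_ext \<alpha> f \<le> ennreal e" "e \<ge> 0"
  shows "integrable mT f" "(LINT z|mT. norm (f z)) \<le> e"
proof -
  have le: "(\<integral>\<^sup>+ z. ennreal (norm (f z)) \<partial>mT) \<le> ennreal e"
    using nn_integral_le_ext[OF assms(1)] assms(2) by (rule order_trans)
  then show i: "integrable mT f" by (auto simp: integrable_iff_bounded intro: le_less_trans)
  have "(\<integral>\<^sup>+ z. ennreal (norm (f z)) \<partial>mT) = ennreal (LINT z|mT. norm (f z))"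
    using i by (intro nn_integral_eq_integral) auto
  then show "(LINT z|mT. norm (f z)) \<le> e" using le assms(3) by (simp add: ennreal_le_iff)
qed

text \<open>The product is split along a bounded approximant \<open>b\<close> of \<open>f\<close>:
  \<open>\<phi> j * (f - b)\<close> is small uniformly in \<open>j\<close>, while
  \<open>\<phi> j * b\<close> is uniformly bounded and tends to 0 in L1. Approximability of
  \<open>f\<close> by bounded functions stands in for absolute continuity of the extended
  norm.\<close>

lemma ext_dominated_convergence:
  assumes [measurable]: "f \<in> borel_measurable borel" and [measurable]: "\<And>j::nat. \<phi> j \<in> borel_measurable borel"
    and f: "\<And>e. e > 0 \<Longrightarrow> \<exists>b\<in>Linf. alpha_ext \<alpha> (\<lambda>z. f z - b z) \<le> ennreal e"
    and C: "\<And>j. AE z in mT. norm (\<phi> j z) \<le> C"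
    and l: "(\<lambda>j. LINT z|mT. norm (\<phi> j z)) \<longlonglongrightarrow> 0"
  shows "(\<lambda>j. alpha_ext \<alpha> (\<lambda>z. \<phi> j z * f z)) \<longlonglongrightarrow> 0"
proof (rule ennreal_tendsto_0I)
  fix e :: real assume e: "e > 0"
  have C0: "C \<ge> 0" using AE_mT_ex[OF C[of 0]] by (meson norm_ge_zero order_trans)
  define C' where "C' = C + 1"
  have C': "C' > 0" "\<And>j. AE z in mT. norm (\<phi> j z) \<le> C'"
  proof -
    show "C' > 0" using C0 by (simp add: C'_def)
    show "AE z in mT. norm (\<phi> j z) \<le> C'" for j using C[of j] by eventually_elim (simp add: C'_def)
  qed
  obtain b where b: "b \<in> Linf" "alpha_ext \<alpha> (\<lambda>z. f z - b z) \<le> ennreal (e / (2 * C'))"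
    using f[of "e / (2 * C')"] e C' by auto
  note [measurable] = LinfD[OF b(1)]
  obtain B where B: "B > 0" "AE z in mT. norm (b z) \<le> B" using b(1) by (rule Linf_boundE)
  have pL: "\<phi> j \<in> Linf" for j by (rule LinfI[OF _ C]) measurable
  have i: "integrable mT (\<lambda>z. norm (\<phi> j z))" for j by (intro integrable_norm L2_integrable Linf_L2 pL)
  have "(\<lambda>j. \<alpha> (\<lambda>z. \<phi> j z * b z)) \<longlonglongrightarrow> 0"
  proof (rule alpha_bounded_convergence)
    show "AE z in mT. norm (\<phi> j z * b z) \<le> C * B" for j
      using C[of j] B(2) by eventually_elim (use C0 in \<open>auto simp: norm_mult intro!: mult_mono\<close>)
    show "(\<lambda>j. LINT z|mT. norm (\<phi> j z * b z)) \<longlonglongrightarrow> 0"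
    proof (rule tendsto_sandwich[OF _ _ tendsto_const])
      show "(\<lambda>j. B * (LINT z|mT. norm (\<phi> j z))) \<longlonglongrightarrow> 0" using tendsto_mult_right_zero[OF l] by simp
      show "\<forall>\<^sub>F j in sequentially. (LINT z|mT. norm (\<phi> j z * b z)) \<le> B * (LINT z|mT. norm (\<phi> j z))"
      proof (intro always_eventually allI)
        fix j
        have "(LINT z|mT. norm (\<phi> j z * b z)) \<le> (LINT z|mT. B * norm (\<phi> j z))"
        proof (rule integral_mono_AE)
          show "integrable mT (\<lambda>z. norm (\<phi> j z * b z))"
            by (intro integrable_norm L2_integrable Linf_L2 Linf_mult pL b)
          show "AE z in mT. norm (\<phi> j z * b z) \<le> B * norm (\<phi> j z)"
            using B(2) by eventually_elim (simp add: norm_mult mult.commute mult_right_mono)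
        qed (use i in auto)
        then show "(LINT z|mT. norm (\<phi> j z * b z)) \<le> B * (LINT z|mT. norm (\<phi> j z))" by simp
      qed
    qed auto
  qed measurable
  then have "\<forall>\<^sub>F j in sequentially. \<alpha> (\<lambda>z. \<phi> j z * b z) < e / 2" using e by (intro order_tendstoD) auto
  then show "\<forall>\<^sub>F j in sequentially. alpha_ext \<alpha> (\<lambda>z. \<phi> j z * f z) \<le> ennreal e"
  proof eventually_elim
    case (elim j)
    have "alpha_ext \<alpha> (\<lambda>z. \<phi> j z * f z) = alpha_ext \<alpha> (\<lambda>z. \<phi> j z * (f z - b z) + \<phi> j z * b z)"
      by (simp add: algebra_simps)
    also have "\<dots> \<le> alpha_ext \<alpha> (\<lambda>z. \<phi> j z * (f z - b z)) + alpha_ext \<alpha> (\<lambda>z. \<phi> j z * b z)"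
      by (intro ext_triangle) measurable
    also have "\<dots> \<le> ennreal C' * ennreal (e / (2 * C')) + ennreal (e / 2)"
    proof (intro add_mono)
      show "alpha_ext \<alpha> (\<lambda>z. \<phi> j z * (f z - b z)) \<le> ennreal C' * ennreal (e / (2 * C'))"
        by (rule order_trans[OF ext_mult_bounded[OF C'] mult_left_mono[OF b(2)]]) simp
      show "alpha_ext \<alpha> (\<lambda>z. \<phi> j z * b z) \<le> ennreal (e / 2)"
        unfolding ext_Linf[OF Linf_mult[OF pL b(1)]] using elim by (intro ennreal_leI) simp
    qed
    also have "\<dots> = ennreal e"
      using e C' by (simp add: ennreal_mult'[symmetric] ennreal_plus[symmetric] del: ennreal_plus)
    finally show ?case .
  qed
qed

section \<open>Closures in the norm and the space \<open>Halpha\<close>\<close>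

text \<open>Choosing approximants with error \<open>1 / (k + 1)\<close> recovers the sequence of the
  definition, so closure arguments become plain epsilon estimates in \<open>ennreal\<close>.\<close>

lemma alpha_closure_iff:
  "f \<in> alpha_closure \<alpha> S \<longleftrightarrow> f \<in> borel_measurable borel \<and> (\<forall>e>0. \<exists>g\<in>S. alpha_ext \<alpha> (\<lambda>z. f z - g z) \<le> ennreal e)"
proof
  assume "f \<in> alpha_closure \<alpha> S"
  then obtain h where h: "f \<in> borel_measurable borel" "\<And>k. h k \<in> S" "(\<lambda>k. alpha_ext \<alpha> (\<lambda>z. f z - h k z)) \<longlonglongrightarrow> 0"
    unfolding alpha_closure_def by auto
  have "\<exists>g\<in>S. alpha_ext \<alpha> (\<lambda>z. f z - g z) \<le> ennreal e" if e: "e > 0" for e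
    using ennreal_tendsto_0D[OF h(3) e] h(2) by (auto simp: eventually_sequentially)
  then show "f \<in> borel_measurable borel \<and> (\<forall>e>0. \<exists>g\<in>S. alpha_ext \<alpha> (\<lambda>z. f z - g z) \<le> ennreal e)"
    using h(1) by simp
next
  assume *: "f \<in> borel_measurable borel \<and> (\<forall>e>0. \<exists>g\<in>S. alpha_ext \<alpha> (\<lambda>z. f z - g z) \<le> ennreal e)"
  then have "\<exists>g\<in>S. alpha_ext \<alpha> (\<lambda>z. f z - g z) \<le> ennreal (1 / real (Suc k))" for k by simp
  then obtain h where h: "\<And>k. h k \<in> S" "\<And>k. alpha_ext \<alpha> (\<lambda>z. f z - h k z) \<le> ennreal (1 / real (Suc k))" by metis
  have "(\<lambda>k. alpha_ext \<alpha> (\<lambda>z. f z - h k z)) \<longlonglongrightarrow> 0"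
  proof (rule ennreal_tendsto_0I)
    fix e :: real assume "e > 0"
    then obtain N where N: "1 / real (Suc N) < e" using nat_approx_posE by blast
    have "alpha_ext \<alpha> (\<lambda>z. f z - h k z) \<le> ennreal e" if "k \<ge> N" for k
    proof (rule order_trans[OF h(2)], rule ennreal_leI)
      have "1 / real (Suc k) \<le> 1 / real (Suc N)" using that by (auto intro!: divide_left_mono)
      then show "1 / real (Suc k) \<le> e" using N by linarith
    qed
    then show "\<forall>\<^sub>F k in sequentially. alpha_ext \<alpha> (\<lambda>z. f z - h k z) \<le> ennreal e"
      unfolding eventually_sequentially by blast
  qed
  then show "f \<in> alpha_closure \<alpha> S" using h(1) * unfolding alpha_closure_def by auto
qed

lemma alpha_closure_closed:
  assumes S: "S \<subseteq> borel_measurable borel" and f: "f \<in> borel_measurable borel"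
    and *: "\<And>e. e > 0 \<Longrightarrow> \<exists>g\<in>alpha_closure \<alpha> S. alpha_ext \<alpha> (\<lambda>z. f z - g z) \<le> ennreal e"
  shows "f \<in> alpha_closure \<alpha> S"
  unfolding alpha_closure_iff
proof (intro conjI f allI impI)
  fix e :: real assume e: "e > 0"
  then obtain g where g: "g \<in> alpha_closure \<alpha> S" "alpha_ext \<alpha> (\<lambda>z. f z - g z) \<le> ennreal (e/2)"
    using *[of "e/2"] by auto
  then obtain h where h: "h \<in> S" "alpha_ext \<alpha> (\<lambda>z. g z - h z) \<le> ennreal (e/2)"
    unfolding alpha_closure_iff using e by (auto dest!: spec[of _ "e/2"])
  have "alpha_ext \<alpha> (\<lambda>z. f z - h z) \<le> alpha_ext \<alpha> (\<lambda>z. f z - g z) + alpha_ext \<alpha> (\<lambda>z. g z - h z)"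
    using S h f g by (intro ext_triangle_diff) (auto simp: alpha_closure_iff)
  also have "\<dots> \<le> ennreal (e/2) + ennreal (e/2)" by (intro add_mono g h)
  also have "\<dots> = ennreal e" using e by (simp add: ennreal_plus[symmetric] del: ennreal_plus)
  finally show "\<exists>g\<in>S. alpha_ext \<alpha> (\<lambda>z. f z - g z) \<le> ennreal e" using h(1) by blast
qed

text \<open>Since the norm dominates the L1 norm, integrability and the vanishing of negative
  Fourier coefficients survive the closure. Approximability by bounded functions is recorded because
  dominated convergence for the norm asks for it.\<close>

lemma HalphaD:
  assumes "f \<in> Halpha \<alpha>"
  shows "f \<in> borel_measurable borel" "integrable mT f" "j \<ge> 1 \<Longrightarrow> (LINT z|mT. f z * z ^ j) = 0"
    "e > 0 \<Longrightarrow> \<exists>b\<in>Linf. alpha_ext \<alpha> (\<lambda>z. f z - b z) \<le> ennreal e"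
proof -
  have f: "f \<in> borel_measurable borel" "\<And>e. e > 0 \<Longrightarrow> \<exists>g\<in>Hinf. alpha_ext \<alpha> (\<lambda>z. f z - g z) \<le> ennreal e"
    using assms unfolding Halpha_def alpha_closure_iff by auto
  show "f \<in> borel_measurable borel" by (rule f)
  show "\<exists>b\<in>Linf. alpha_ext \<alpha> (\<lambda>z. f z - b z) \<le> ennreal e" if "e > 0" for e
    using f(2)[OF that] Hinf_subset by blast
  have key: "\<exists>g\<in>Hinf. integrable mT g \<and> integrable mT (\<lambda>z. f z - g z) \<and> (LINT z|mT. norm (f z - g z)) \<le> e" if e: "e > 0" for e
  proof -
    obtain g where g: "g \<in> Hinf" "alpha_ext \<alpha> (\<lambda>z. f z - g z) \<le> ennreal e" using f(2)[OF e] by blast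
    then have "g \<in> Linf" using Hinf_subset by auto
    then have gm: "(\<lambda>z. f z - g z) \<in> borel_measurable borel" and gi: "integrable mT g"
      using f(1) by (auto dest: LinfD intro: L2_integrable Linf_L2)
    show ?thesis using ext_finite_integrable[OF gm g(2)] e g gi by (intro bexI[of _ g]) auto
  qed
  obtain g where "integrable mT g" "integrable mT (\<lambda>z. f z - g z)" using key[of 1] by auto
  from Bochner_Integration.integrable_add[OF this] show fi: "integrable mT f" by simp
  show "(LINT z|mT. f z * z ^ j) = 0" if j: "j \<ge> 1" for j
  proof -
    have z1: "AE z in mT. norm (z ^ j) \<le> 1" using AE_mT_norm by eventually_elim (simp add: norm_power)
    have "norm (LINT z|mT. f z * z ^ j) \<le> 0 + e" if e: "e > 0" for e
    proof -
      obtain g where g: "g \<in> Hinf" "integrable mT g" "integrable mT (\<lambda>z. f z - g z)" "(LINT z|mT. norm (f z - g z)) \<le> e"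
        using key[OF e] by auto
      have i: "integrable mT (\<lambda>z. f z * z ^ j)" "integrable mT (\<lambda>z. g z * z ^ j)" "integrable mT (\<lambda>z. (f z - g z) * z ^ j)"
        using z1 by (auto intro!: integrable_mult_bounded[where C=1] fi g)
      have "(LINT z|mT. f z * z ^ j) = (LINT z|mT. (f z - g z) * z ^ j)"
        using g(1) i j by (simp add: Hinf_iff left_diff_distrib)
      also have "norm \<dots> \<le> (LINT z|mT. norm ((f z - g z) * z ^ j))" by (rule integral_norm_bound)
      also have "\<dots> = (LINT z|mT. norm (f z - g z))"
      proof (rule integral_cong_AE)
        show "AE z in mT. norm ((f z - g z) * z ^ j) = norm (f z - g z)"
          using AE_mT_norm by eventually_elim (simp add: norm_mult norm_power)
      qed (use i g in \<open>auto dest!: borel_measurable_integrable\<close>)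
      finally show ?thesis using g(4) by simp
    qed
    then have "norm (LINT z|mT. f z * z ^ j) \<le> 0" by (rule field_le_epsilon)
    then show ?thesis by simp
  qed
qed

lemma Halpha_Linf: "f \<in> Halpha \<alpha> \<Longrightarrow> f \<in> Linf \<Longrightarrow> f \<in> Hinf"
  by (auto simp: Hinf_iff HalphaD)

end

section \<open>Invariant subspaces\<close>

text \<open>\<open>ln x\<close> is twice the logarithm of the square root, and a logarithm is at
  most its argument. An integrable majorant thus has a square integrable truncated
  logarithm.\<close>

lemma ln_squared_le:
  assumes "(1::real) \<le> x" shows "(ln x)\<^sup>2 \<le> 4 * x"
proof -
  have "ln x = 2 * ln (sqrt x)" using assms by (simp add: ln_sqrt)
  moreover have "ln (sqrt x) \<le> sqrt x" using assms by (intro ln_bound[THEN order_trans]) auto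
  moreover have "0 \<le> ln (sqrt x)" using assms by simp
  ultimately have "(ln x)\<^sup>2 \<le> (2 * sqrt x)\<^sup>2" by (intro power_mono) auto
  then show ?thesis using assms by (simp add: power_mult_distrib)
qed

text \<open>The \<open>v i\<close> are orthogonal vectors of squared length \<open>n\<close> in a
  space of dimension \<open>n\<close>. Bessel's inequality for each coordinate functional bounds the
  sum over \<open>i\<close> of \<open>(norm (v i w))^2\<close> by \<open>n\<close>; summing over
  \<open>w\<close> gives \<open>r * n \<le> n * n\<close>.\<close>

lemma orthogonal_family_card_le:
  fixes v :: "nat \<Rightarrow> 'a \<Rightarrow> complex"
  assumes E: "finite E" "card E = n" "n \<ge> 1"
    and o: "\<And>i j. i < r \<Longrightarrow> j < r \<Longrightarrow> (\<Sum>u\<in>E. v i u * cnj (v j u)) = (if i = j then of_nat n else 0)"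
  shows "r \<le> n"
proof -
  have key: "(\<Sum>i<r. (norm (v i w))\<^sup>2) \<le> real n" if w: "w \<in> E" for w
  proof -
    define A where "A = (\<Sum>i<r. (norm (v i w))\<^sup>2)"
    \<comment> \<open>Up to the factor \<open>n\<close>, the kernel that represents evaluation at
      \<open>w\<close> on the span of the \<open>v i\<close>: its value at \<open>w\<close> is
      \<open>A\<close>, its squared length is \<open>n * A\<close>.\<close>
    define a where "a u = (\<Sum>i<r. cnj (v i w) * v i u)" for u
    have A0: "A \<ge> 0" by (simp add: A_def sum_nonneg)
    have aw: "a w = of_real A"
      unfolding a_def A_def of_real_sum by (intro sum.cong refl) (simp only: complex_norm_square mult.commute)
    have "(\<Sum>u\<in>E. a u * cnj (a u)) = (\<Sum>u\<in>E. \<Sum>i<r. \<Sum>j<r. (cnj (v i w) * v j w) * (v i u * cnj (v j u)))"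
      unfolding a_def by (simp add: sum_product mult_ac)
    also have "\<dots> = (\<Sum>i<r. \<Sum>j<r. \<Sum>u\<in>E. (cnj (v i w) * v j w) * (v i u * cnj (v j u)))"
      by (subst sum.swap, intro sum.cong refl, rule sum.swap)
    also have "\<dots> = (\<Sum>i<r. \<Sum>j<r. (cnj (v i w) * v j w) * (if i = j then of_nat n else 0))"
      by (intro sum.cong refl) (simp add: sum_distrib_left[symmetric] o)
    also have "\<dots> = (\<Sum>i<r. (cnj (v i w) * v i w) * of_nat n)"
      by (intro sum.cong refl) (simp add: if_distrib cong: if_cong)
    also have "\<dots> = of_nat n * a w" by (simp add: a_def sum_distrib_left mult.commute)
    finally have "(\<Sum>u\<in>E. complex_of_real ((norm (a u))\<^sup>2)) = of_real (real n * A)"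
      unfolding complex_norm_square aw by simp
    then have "(\<Sum>u\<in>E. (norm (a u))\<^sup>2) = real n * A"
      unfolding of_real_sum[symmetric] of_real_eq_iff .
    moreover have "(norm (a w))\<^sup>2 \<le> (\<Sum>u\<in>E. (norm (a u))\<^sup>2)"
      using E w by (intro member_le_sum) auto
    ultimately have "A * A \<le> real n * A" using A0 by (simp add: aw power2_eq_square)
    then have "A \<le> real n" using A0 by (cases "A = 0") (auto simp: mult_le_cancel_right)
    then show ?thesis by (simp add: A_def)
  qed
  have s: "(\<Sum>u\<in>E. (norm (v i u))\<^sup>2) = real n" if "i < r" for i
  proof -
    have "complex_of_real (\<Sum>u\<in>E. (norm (v i u))\<^sup>2) = (\<Sum>u\<in>E. v i u * cnj (v i u))"
      unfolding of_real_sum by (simp only: complex_norm_square)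
    also have "\<dots> = of_real (real n)" using o[OF that that] by simp
    finally show ?thesis unfolding of_real_eq_iff .
  qed
  have "real r * real n = (\<Sum>i<r. \<Sum>u\<in>E. (norm (v i u))\<^sup>2)" by (simp add: s)
  also have "\<dots> = (\<Sum>u\<in>E. \<Sum>i<r. (norm (v i u))\<^sup>2)" by (rule sum.swap)
  also have "\<dots> \<le> (\<Sum>u\<in>E. real n)" by (intro sum_mono key)
  also have "\<dots> = real n * real n" using E by simp
  finally show ?thesis using E(3) by (simp add: mult_le_cancel_right)
qed

locale invariant_subspace = continuous_rot_sym_norm +
  fixes n :: nat and M :: "(complex \<Rightarrow> complex) set"
  assumes n: "n \<ge> 1" and inv: "closed_invariant_subspace \<alpha> n M"
begin

lemma M_Halpha: "f \<in> M \<Longrightarrow> f \<in> Halpha \<alpha>"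
  and M_zero: "(\<lambda>_. 0) \<in> M"
  and M_add: "f \<in> M \<Longrightarrow> g \<in> M \<Longrightarrow> (\<lambda>z. f z + g z) \<in> M"
  and M_scale: "f \<in> M \<Longrightarrow> (\<lambda>z. c * f z) \<in> M"
  and M_shift: "f \<in> M \<Longrightarrow> (\<lambda>z. z ^ n * f z) \<in> M"
  using inv unfolding closed_invariant_subspace_def by auto

lemma M_borel: "f \<in> M \<Longrightarrow> f \<in> borel_measurable borel"
  by (rule HalphaD(1)[OF M_Halpha])

lemma M_sum: "(\<And>i. i \<in> I \<Longrightarrow> f i \<in> M) \<Longrightarrow> (\<lambda>z. \<Sum>i\<in>I. f i z) \<in> M"
  by (induction I rule: infinite_finite_induct) (auto intro: M_add M_zero)

text \<open>Closedness of \<open>M\<close> is formulated inside \<open>Halpha \<alpha>\<close>, so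
  membership of the limit there has to be supplied; it follows because
  \<open>Halpha \<alpha>\<close> is itself a closure.\<close>

lemma M_closed:
  assumes f: "f \<in> borel_measurable borel"
    and *: "\<And>e. e > 0 \<Longrightarrow> \<exists>g\<in>M. alpha_ext \<alpha> (\<lambda>z. f z - g z) \<le> ennreal e"
  shows "f \<in> M"
proof -
  have "f \<in> alpha_closure \<alpha> M" using f * by (simp add: alpha_closure_iff)
  then obtain s where s: "\<And>k. s k \<in> M" "(\<lambda>k. alpha_ext \<alpha> (\<lambda>z. f z - s k z)) \<longlonglongrightarrow> 0"
    unfolding alpha_closure_def by auto
  have "f \<in> Halpha \<alpha>"
    unfolding Halpha_def
  proof (rule alpha_closure_closed[OF Hinf_subset(1) f])
    fix e :: real assume "e > 0"
    from *[OF this] M_Halpha show "\<exists>g\<in>alpha_closure \<alpha> Hinf. alpha_ext \<alpha> (\<lambda>z. f z - g z) \<le> ennreal e"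
      unfolding Halpha_def by blast
  qed
  moreover have "(\<lambda>k. alpha_ext \<alpha> (\<lambda>z. s k z - f z)) \<longlonglongrightarrow> 0"
    using s(2) by (simp add: ext_diff_commute)
  moreover have "\<forall>s f. (\<forall>k. s k \<in> M) \<and> f \<in> Halpha \<alpha> \<and> (\<lambda>k. alpha_ext \<alpha> (\<lambda>z. s k z - f z)) \<longlonglongrightarrow> 0 \<longrightarrow> f \<in> M"
    using inv unfolding closed_invariant_subspace_def by (elim conjE)
  ultimately show ?thesis using s(1) by (elim allE[of _ s] allE[of _ f]) simp
qed

lemma M_closed_seq:
  assumes f: "f \<in> borel_measurable borel" and "\<And>k. s k \<in> M" and l: "(\<lambda>k::nat. alpha_ext \<alpha> (\<lambda>z. f z - s k z)) \<longlonglongrightarrow> 0"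
  shows "f \<in> M"
proof (rule M_closed[OF f])
  fix e :: real assume "e > 0"
  from ennreal_tendsto_0D[OF l this] assms(2) show "\<exists>g\<in>M. alpha_ext \<alpha> (\<lambda>z. f z - g z) \<le> ennreal e"
    by (auto simp: eventually_sequentially)
qed

lemma M_AE_cong:
  assumes "f \<in> M" "g \<in> borel_measurable borel" "AE z in mT. f z = g z"
  shows "g \<in> M"
proof (rule M_closed[OF assms(2)])
  have "AE z in mT. g z - f z = 0" using assms(3) by eventually_elim simp
  from ext_zero[OF this] assms(1) show "\<exists>h\<in>M. alpha_ext \<alpha> (\<lambda>z. g z - h z) \<le> ennreal e" for e
    by (intro bexI[of _ f]) simp_all
qed

lemma M_poly: "f \<in> M \<Longrightarrow> (\<lambda>z. poly q (z ^ n) * f z) \<in> M"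
proof (induction q)
  case 0 then show ?case by (simp add: M_zero)
next
  case (pCons a q)
  have "(\<lambda>z. a * f z + z ^ n * (poly q (z ^ n) * f z)) \<in> M"
    using pCons by (intro M_add M_scale M_shift) auto
  then show ?case by (simp add: algebra_simps)
qed

section \<open>Truncation by outer functions of \<open>z ^ n\<close>\<close>

text \<open>\<open>M\<close> is stable under polynomials in \<open>z ^ n\<close>, and
  \<open>poly (p j) (z ^ n)\<close> converges boundedly to \<open>h (z ^ n)\<close>; dominated
  convergence for the norm carries the products with \<open>f\<close> along. The bound 2 is the one
  delivered with outer functions.\<close>

lemma M_limit_mult:
  assumes f: "f \<in> M" and [measurable]: "h \<in> borel_measurable borel"
    and p: "\<And>j z. norm z = 1 \<Longrightarrow> norm (poly (p j) z) \<le> 2"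
    and l: "AE z in mT. (\<lambda>j. poly (p j) z) \<longlonglongrightarrow> h z"
  shows "(\<lambda>z. h (z ^ n) * f z) \<in> M"
proof -
  note [measurable] = M_borel[OF f]
  define \<phi> where "\<phi> j z = h (z ^ n) - poly (p j) (z ^ n)" for j z
  have [measurable]: "\<phi> j \<in> borel_measurable borel" for j unfolding \<phi>_def by measurable
  have h2: "AE z in mT. norm (h z) \<le> 2"
    using l AE_mT_norm
  proof eventually_elim
    case (elim z)
    show ?case by (rule Lim_bounded[OF tendsto_norm[OF elim(1)], of 0]) (use p elim in auto)
  qed
  have b: "AE z in mT. norm (\<phi> j z) \<le> 4" for j
    using AE_power[OF n h2] AE_mT_norm
  proof eventually_elim
    case (elim z)
    have "norm (poly (p j) (z ^ n)) \<le> 2" using elim by (intro p) (simp add: norm_power)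
    then show ?case unfolding \<phi>_def using elim norm_triangle_ineq4[of "h (z ^ n)" "poly (p j) (z ^ n)"] by linarith
  qed
  have l0: "AE z in mT. (\<lambda>j. \<phi> j z) \<longlonglongrightarrow> 0"
    using AE_power[OF n l]
  proof eventually_elim
    case (elim z)
    from tendsto_diff[OF tendsto_const[of "h (z ^ n)"] elim] show ?case by (simp add: \<phi>_def)
  qed
  have "(\<lambda>j. alpha_ext \<alpha> (\<lambda>z. \<phi> j z * f z)) \<longlonglongrightarrow> 0"
    by (rule ext_dominated_convergence[OF _ _ HalphaD(4)[OF M_Halpha[OF f]] b integral_norm_tendsto_0_of_AE[OF _ b l0]])
       measurable
  then have l1: "(\<lambda>j. alpha_ext \<alpha> (\<lambda>z. h (z ^ n) * f z - poly (p j) (z ^ n) * f z)) \<longlonglongrightarrow> 0"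
    by (simp add: \<phi>_def left_diff_distrib)
  show ?thesis by (rule M_closed_seq[OF _ M_poly[OF f] l1]) measurable
qed

text \<open>The hypothesis with \<open>circle_root\<close> says that \<open>V\<close> is constant on
  fibres, so on the circle \<open>V z = u (z ^ n)\<close> for the composition \<open>u\<close> of
  \<open>V\<close> with \<open>circle_root n\<close>. The outer function for \<open>u\<close>,
  evaluated at \<open>z ^ n\<close>, is the multiplier, and \<open>z ^ n\<close> preserves the
  integrals.\<close>

lemma outer_multiplier:
  fixes V :: "complex \<Rightarrow> real"
  assumes [measurable]: "V \<in> borel_measurable borel" and pos: "\<And>z. 0 \<le> V z"
    and Vn: "\<And>z. norm z = 1 \<Longrightarrow> V (circle_root n (z ^ n)) = V z"
    and i: "integrable mT (\<lambda>z. (V z)\<^sup>2)"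
  shows "\<exists>H. H \<in> borel_measurable borel \<and> (AE z in mT. norm (H z) = exp (- V z)) \<and>
    sqn (\<lambda>z. 1 - H z) \<le> 8 * (LINT z|mT. (V z)\<^sup>2) \<and> (\<forall>f\<in>M. (\<lambda>z. H z * f z) \<in> M)"
proof -
  define u where "u w = V (circle_root n w)" for w
  have [measurable]: "u \<in> borel_measurable borel" unfolding u_def by measurable
  have eq: "AE z in mT. (V z)\<^sup>2 = (u (z ^ n))\<^sup>2"
    using AE_mT_norm by eventually_elim (simp add: u_def Vn)
  have "integrable mT (\<lambda>z. (u (z ^ n))\<^sup>2)"
    using i by (rule integrable_cong_AE_imp[OF _ _ eq]) measurable
  then have ui: "integrable mT (\<lambda>w. (u w)\<^sup>2)"
    using integrable_power_iff[OF n, of "\<lambda>w. (u w)\<^sup>2"] by simp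
  have "(LINT w|mT. (u w)\<^sup>2) = (LINT z|mT. (u (z ^ n))\<^sup>2)"
    by (rule integral_power[OF n, symmetric]) measurable
  also have "\<dots> = (LINT z|mT. (V z)\<^sup>2)" by (rule integral_cong_AE[symmetric, OF _ _ eq]) measurable
  finally have uV: "(LINT w|mT. (u w)\<^sup>2) = (LINT z|mT. (V z)\<^sup>2)" .
  have "AE z in mT. 0 \<le> u z" using pos by (simp add: u_def)
  from outer_function[OF _ this ui] obtain h p where h [measurable]: "h \<in> borel_measurable borel"
    and hn: "AE z in mT. norm (h z) = exp (- u z)" and h1: "sqn (\<lambda>z. h z - 1) \<le> 8 * (LINT z|mT. (u z)\<^sup>2)"
    and p: "\<forall>j z. norm z = 1 \<longrightarrow> norm (poly (p j) z) \<le> 2" and l: "AE z in mT. (\<lambda>j. poly (p j) z) \<longlonglongrightarrow> h z"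
    by auto
  have "AE z in mT. norm (h (z ^ n)) = exp (- V z)"
    using AE_power[OF n hn] AE_mT_norm by eventually_elim (simp add: u_def Vn)
  moreover have "sqn (\<lambda>z. 1 - h (z ^ n)) \<le> 8 * (LINT z|mT. (V z)\<^sup>2)"
  proof -
    have "sqn (\<lambda>z. 1 - h (z ^ n)) = sqn (\<lambda>z. h z - 1)"
      unfolding sqn_def norm_minus_commute[of 1] by (rule integral_power[OF n]) measurable
    then show ?thesis using h1 uV by simp
  qed
  moreover have "\<forall>f\<in>M. (\<lambda>z. h (z ^ n) * f z) \<in> M" using M_limit_mult[OF _ h _ l] p by blast
  ultimately show ?thesis by (intro exI[of _ "\<lambda>z. h (z ^ n)"]) auto
qed

text \<open>With \<open>S\<close> the fibre sum of the modulus, \<open>norm (H z)\<close> is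
  \<open>1 / max 1 (S z / A)\<close>, so \<open>H * s\<close> is bounded by \<open>A\<close>, while
  \<open>H\<close> has modulus 1 wherever \<open>S z \<le> A\<close>. The last bound says that
  \<open>H\<close> is close to 1 in L1 when the logarithmic excess of \<open>S\<close> over
  \<open>A\<close> is small in L2.\<close>

lemma outer_truncation:
  assumes s: "s \<in> M" and A: "A > 0"
  defines "V \<equiv> \<lambda>z. ln (max 1 (rsum n (\<lambda>z. norm (s z)) z / A))"
  assumes i: "integrable mT (\<lambda>z. (V z)\<^sup>2)"
  shows "\<exists>H. H \<in> Linf \<and> (AE z in mT. norm (H z) \<le> 1) \<and> (AE z in mT. norm (H z * s z) \<le> A) \<and>
    (\<lambda>z. H z * s z) \<in> M \<and> (LINT z|mT. norm (1 - H z)) \<le> sqrt (8 * (LINT z|mT. (V z)\<^sup>2))"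
proof -
  note [measurable] = M_borel[OF s]
  define S where "S = rsum n (\<lambda>z. norm (s z))"
  have V: "V z = ln (max 1 (S z / A))" for z by (simp add: V_def S_def)
  have sS: "norm (s z) \<le> S z" for z unfolding S_def by (rule rsum_member_le[OF n]) simp
  have Vm: "V \<in> borel_measurable borel" unfolding V_def by measurable
  have Vpos: "0 \<le> V z" for z by (simp add: V)
  have Vn: "V (circle_root n (z ^ n)) = V z" if "norm z = 1" for z
    unfolding V S_def using rsum_circle_root[OF n that] by metis
  obtain H where Hm [measurable]: "H \<in> borel_measurable borel"
    and Hn: "AE z in mT. norm (H z) = exp (- V z)"
    and H1: "sqn (\<lambda>z. 1 - H z) \<le> 8 * (LINT z|mT. (V z)\<^sup>2)"
    and HM: "\<forall>f\<in>M. (\<lambda>z. H z * f z) \<in> M"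
    using outer_multiplier[OF Vm Vpos Vn i] by auto
  have Hle: "AE z in mT. norm (H z) \<le> 1" using Hn by eventually_elim (simp add: Vpos)
  have HL: "H \<in> Linf" by (rule LinfI[OF Hm Hle])
  have HsA: "AE z in mT. norm (H z * s z) \<le> A"
    using Hn
  proof eventually_elim
    case (elim z)
    have m: "max 1 (S z / A) > 0" by simp
    have "norm (H z * s z) = norm (s z) / max 1 (S z / A)"
      using m by (simp add: norm_mult elim V exp_minus divide_inverse mult.commute)
    also have "\<dots> \<le> S z / max 1 (S z / A)" using sS m by (intro divide_right_mono) auto
    also have "\<dots> \<le> A"
    proof -
      have "S z = A * (S z / A)" using A by simp
      also have "\<dots> \<le> A * max 1 (S z / A)" using A by (intro mult_left_mono) auto
      finally show ?thesis using m by (simp only: pos_divide_le_eq)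
    qed
    finally show ?case .
  qed
  have "(\<lambda>z. 1 - H z) \<in> L2" by (intro Linf_L2 Linf_diff HL Linf_const)
  from integral_norm_le_sqn[OF this] H1
  have "(LINT z|mT. norm (1 - H z)) \<le> sqrt (8 * (LINT z|mT. (V z)\<^sup>2))"
    by (meson order_trans real_sqrt_le_mono)
  then show ?thesis using HL Hle HsA HM s by (intro exI[of _ H]) auto
qed

text \<open>At truncation level \<open>k + 1\<close> the logarithmic excess \<open>V k\<close>
  vanishes pointwise from some \<open>k\<close> on, with the integrable bound \<open>4 * S\<close>
  for its square; hence \<open>H k\<close> tends to 1 in L1 and \<open>H k * f\<close> tends to
  \<open>f\<close> in the norm.\<close>

lemma Linf_dense:
  assumes f: "f \<in> M" and e: "e > 0"
  shows "\<exists>g\<in>M \<inter> Linf. alpha_ext \<alpha> (\<lambda>z. f z - g z) \<le> ennreal e"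
proof -
  note [measurable] = M_borel[OF f]
  have fi: "integrable mT f" by (rule HalphaD(2)[OF M_Halpha[OF f]])
  define S where "S = rsum n (\<lambda>z. norm (f z))"
  have Si: "integrable mT S" unfolding S_def using fi by (intro rsum_integrable n) auto
  note [measurable] = borel_measurable_integrable[OF Si, unfolded borel_measurable_mT]
  have S0: "0 \<le> S z" for z unfolding S_def rsum_def by (intro sum_nonneg) auto
  define V where "V k z = ln (max 1 (S z / real (Suc k)))" for k z
  have [measurable]: "V k \<in> borel_measurable borel" for k unfolding V_def by measurable
  have Vb: "(V k z)\<^sup>2 \<le> 4 * S z" for k z
  proof (cases "S z / real (Suc k) \<le> 1")
    case True then show ?thesis using S0 by (simp add: V_def max_def)
  next
    case False
    then have "(V k z)\<^sup>2 \<le> 4 * (S z / real (Suc k))" unfolding V_def using ln_squared_le[of "S z / real (Suc k)"] by (simp add: max_def)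
    also have "S z / real (Suc k) \<le> S z" using S0[of z] by (simp add: divide_le_eq mult_le_cancel_left1)
    finally show ?thesis by simp
  qed
  have Vi: "integrable mT (\<lambda>z. (V k z)\<^sup>2)" for k
  proof (rule Bochner_Integration.integrable_bound[OF integrable_mult_right[OF Si, of 4]])
    show "AE z in mT. norm ((V k z)\<^sup>2) \<le> norm (4 * S z)" using Vb S0 by simp
  qed measurable
  have "(\<lambda>k. LINT z|mT. (V k z)\<^sup>2) \<longlonglongrightarrow> (LINT z|mT. 0)"
  proof (rule integral_dominated_convergence[where w="\<lambda>z. 4 * S z"])
    have "(\<lambda>k. (V k z)\<^sup>2) \<longlonglongrightarrow> 0" for z
    proof (rule tendsto_eventually)
      obtain K where K: "S z \<le> real K" using real_arch_simple by blast
      have "(V k z)\<^sup>2 = 0" if "k \<ge> K" for k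
      proof -
        have "S z / real (Suc k) \<le> 1" using K that by (simp add: divide_le_eq)
        then show ?thesis by (simp add: V_def max_def)
      qed
      then show "\<forall>\<^sub>F k in sequentially. (V k z)\<^sup>2 = 0" unfolding eventually_sequentially by blast
    qed
    then show "AE z in mT. (\<lambda>k. (V k z)\<^sup>2) \<longlonglongrightarrow> 0" by simp
    show "AE z in mT. norm ((V k z)\<^sup>2) \<le> 4 * S z" for k using Vb by simp
  qed (use Si in auto)
  then have V0: "(\<lambda>k. LINT z|mT. (V k z)\<^sup>2) \<longlonglongrightarrow> 0" by simp
  have "\<exists>H. H \<in> Linf \<and> (AE z in mT. norm (H z) \<le> 1) \<and> (AE z in mT. norm (H z * f z) \<le> real (Suc k)) \<and>
    (\<lambda>z. H z * f z) \<in> M \<and> (LINT z|mT. norm (1 - H z)) \<le> sqrt (8 * (LINT z|mT. (V k z)\<^sup>2))" for k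
    using Vi[of k] unfolding V_def S_def by (intro outer_truncation) (use f in auto)
  then have "\<exists>H. \<forall>k. H k \<in> Linf \<and> (AE z in mT. norm (H k z) \<le> 1) \<and> (AE z in mT. norm (H k z * f z) \<le> real (Suc k)) \<and>
    (\<lambda>z. H k z * f z) \<in> M \<and> (LINT z|mT. norm (1 - H k z)) \<le> sqrt (8 * (LINT z|mT. (V k z)\<^sup>2))"
    by (intro choice allI)
  then obtain H where HL: "\<And>k. H k \<in> Linf"
    and Hle: "\<And>k. AE z in mT. norm (H k z) \<le> 1"
    and HsA: "\<And>k. AE z in mT. norm (H k z * f z) \<le> real (Suc k)"
    and HM: "\<And>k. (\<lambda>z. H k z * f z) \<in> M"
    and H1: "\<And>k. (LINT z|mT. norm (1 - H k z)) \<le> sqrt (8 * (LINT z|mT. (V k z)\<^sup>2))" by auto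
  note [measurable] = LinfD[OF HL]
  have gL: "(\<lambda>z. H k z * f z) \<in> Linf" for k by (rule LinfI[OF _ HsA]) measurable
  have b: "AE z in mT. norm (1 - H k z) \<le> 2" for k
    using Hle[of k]
  proof eventually_elim
    case (elim z) then show ?case using norm_triangle_ineq4[of 1 "H k z"] by simp
  qed
  have "(\<lambda>k. LINT z|mT. norm (1 - H k z)) \<longlonglongrightarrow> 0"
  proof (rule tendsto_sandwich[OF _ _ tendsto_const])
    have "(\<lambda>k. sqrt (8 * (LINT z|mT. (V k z)\<^sup>2))) \<longlonglongrightarrow> sqrt (8 * 0)" by (intro tendsto_intros V0)
    then show "(\<lambda>k. sqrt (8 * (LINT z|mT. (V k z)\<^sup>2))) \<longlonglongrightarrow> 0" by simp
    show "\<forall>\<^sub>F k in sequentially. (LINT z|mT. norm (1 - H k z)) \<le> sqrt (8 * (LINT z|mT. (V k z)\<^sup>2))"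
      by (intro always_eventually allI H1)
  qed auto
  then have "(\<lambda>k. alpha_ext \<alpha> (\<lambda>z. (1 - H k z) * f z)) \<longlonglongrightarrow> 0"
    by (rule ext_dominated_convergence[OF _ _ HalphaD(4)[OF M_Halpha[OF f]] b, rotated -1]) measurable
  from ennreal_tendsto_0D[OF this e] obtain k where "alpha_ext \<alpha> (\<lambda>z. (1 - H k z) * f z) \<le> ennreal e"
    by (auto simp: eventually_sequentially)
  then show ?thesis using HM[of k] gL[of k] by (intro bexI[of _ "\<lambda>z. H k z * f z"]) (auto simp: left_diff_distrib)
qed

section \<open>The L2 closure of the bounded elements\<close>

definition N :: "(complex \<Rightarrow> complex) set" where
  "N = L2_closure (M \<inter> Linf)"

lemma M_Linf_Hinf: "f \<in> M \<Longrightarrow> f \<in> Linf \<Longrightarrow> f \<in> Hinf"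
  by (rule Halpha_Linf[OF M_Halpha])

lemma M_Linf_subspace: "L2_subspace (M \<inter> Linf)"
  unfolding L2_subspace_def using Linf_L2 by (auto intro: M_add M_zero M_scale Linf_add Linf_scale)

lemma N_subspace: "L2_subspace N" unfolding N_def by (rule L2_subspace_closure[OF M_Linf_subspace])

lemma N_closed: "L2_closed N"
  unfolding N_def using Linf_L2 by (intro L2_closed_closure) auto

lemmas N_L2 = L2_subspaceD(1)[OF N_subspace]
lemmas N_add = L2_subspaceD(3)[OF N_subspace]
lemmas N_scale = L2_subspaceD(4)[OF N_subspace]
lemmas N_diff = L2_subspace_diff[OF N_subspace]

lemma M_Linf_N: "f \<in> M \<Longrightarrow> f \<in> Linf \<Longrightarrow> f \<in> N"
  unfolding N_def using Linf_L2 by (intro L2_closure_mono) auto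

lemma N_AE_cong:
  assumes "f \<in> N" "g \<in> borel_measurable borel" "AE z in mT. f z = g z"
  shows "g \<in> N"
proof -
  have g: "g \<in> L2" by (rule L2_AE_cong(1)[OF N_L2[OF assms(1)] assms(3,2)])
  have "AE z in mT. g z - f z = 0" using assms(3) by eventually_elim simp
  then have "sqn (\<lambda>z. g z - f z) = 0" using sqn_eq_0_iff[OF L2_diff[OF g N_L2[OF assms(1)]]] by simp
  then show ?thesis using N_closed g assms(1) unfolding L2_closed_def by metis
qed

lemma N_analytic:
  assumes f: "f \<in> N" and j: "j \<ge> 1"
  shows "(LINT z|mT. f z * z ^ j) = 0"
proof -
  have fL: "f \<in> L2" by (rule N_L2[OF f])
  have zL: "(\<lambda>z. cnj z ^ j) \<in> L2"
    using AE_mT_norm by (intro bounded_L2[where C=1]) (auto simp: norm_power)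
  have *: "ip g (\<lambda>z. cnj z ^ j) = (LINT z|mT. g z * z ^ j)" for g by (simp add: ip_def)
  define B where "B = sqrt (sqn (\<lambda>z. cnj z ^ j)) + 1"
  have B: "B > 0" by (simp add: B_def add_nonneg_pos)
  have "norm (LINT z|mT. f z * z ^ j) \<le> 0 + e" if e: "e > 0" for e
  proof -
    have "(e / B)\<^sup>2 > 0" using e B by simp
    then obtain g where g: "g \<in> M" "g \<in> Linf" "sqn (\<lambda>z. f z - g z) < (e / B)\<^sup>2"
      using f unfolding N_def L2_closure_def by (auto dest!: spec[of _ "(e / B)\<^sup>2"])
    have "g \<in> Hinf" by (rule M_Linf_Hinf[OF g(1,2)])
    then have "(LINT z|mT. f z * z ^ j) = ip (\<lambda>z. f z - g z) (\<lambda>z. cnj z ^ j)"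
      unfolding ip_diff_left[OF fL Linf_L2[OF g(2)] zL] * using j by (simp add: Hinf_iff)
    also have "norm \<dots> \<le> sqrt (sqn (\<lambda>z. f z - g z)) * sqrt (sqn (\<lambda>z. cnj z ^ j))"
      by (intro norm_ip_le L2_diff fL Linf_L2 g zL)
    also have "\<dots> \<le> (e / B) * B"
    proof (rule mult_mono)
      show "sqrt (sqn (\<lambda>z. f z - g z)) \<le> e / B" using g(3) e B by (intro real_le_lsqrt) auto
    qed (use e B in \<open>auto simp: B_def\<close>)
    also have "\<dots> = e" using B by simp
    finally show ?thesis by simp
  qed
  then have "norm (LINT z|mT. f z * z ^ j) \<le> 0" by (rule field_le_epsilon)
  then show ?thesis by simp
qed

lemma N_mult_power:
  assumes f: "f \<in> N" shows "(\<lambda>z. z ^ (n * k) * f z) \<in> N"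
proof -
  have z: "AE z in mT. norm (z ^ (n * k)) \<le> 1" using AE_mT_norm by eventually_elim (simp add: norm_power)
  have L: "(\<lambda>z. z ^ (n * k) * f z) \<in> L2" by (rule L2_mult_bounded(1)[OF N_L2[OF f] _ z]) measurable
  have "\<exists>g\<in>N. sqn (\<lambda>z. z ^ (n * k) * f z - g z) < e" if e: "e > 0" for e
  proof -
    obtain g where g: "g \<in> M" "g \<in> Linf" "sqn (\<lambda>z. f z - g z) < e"
      using f e unfolding N_def L2_closure_def by auto
    have "(\<lambda>z. z ^ (n * k) * g z) \<in> M"
      using M_poly[OF g(1), of "monom 1 k"] by (simp add: poly_monom power_mult)
    moreover have "(\<lambda>z. z ^ (n * k) * g z) \<in> Linf"
      by (intro Linf_mult g LinfI[OF _ z]) measurable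
    ultimately have "(\<lambda>z. z ^ (n * k) * g z) \<in> N" by (rule M_Linf_N)
    moreover have "sqn (\<lambda>z. z ^ (n * k) * (f z - g z)) \<le> 1\<^sup>2 * sqn (\<lambda>z. f z - g z)"
      by (rule L2_mult_bounded(2)[OF L2_diff[OF N_L2[OF f] Linf_L2[OF g(2)]] _ z]) measurable
    ultimately show ?thesis using g(3) by (intro bexI[of _ "\<lambda>z. z ^ (n * k) * g z"]) (auto simp: right_diff_distrib)
  qed
  then show ?thesis by (rule L2_closedD[OF N_closed L])
qed

text \<open>L2 approximants \<open>s k\<close> of \<open>f\<close> from \<open>M\<close> need not be
  uniformly bounded, so they are truncated by outer multipliers \<open>H k\<close>. Their fibre sums
  exceed \<open>n * C\<close> by at most the fibre sum of \<open>norm (f z - s k z)\<close>, which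
  tends to 0 in L2. Thus \<open>H k\<close> tends to 1, and \<open>H k * s k\<close> converges to
  \<open>f\<close> boundedly in L1, hence in the norm.\<close>

lemma N_Linf_M:
  assumes f: "f \<in> N" and fL: "f \<in> Linf"
  shows "f \<in> M"
proof -
  note [measurable] = LinfD[OF fL]
  obtain C where C: "C > 0" "AE z in mT. norm (f z) \<le> C" using fL by (rule Linf_boundE)
  have "\<exists>g\<in>M \<inter> Linf. sqn (\<lambda>z. f z - g z) < 1 / real (Suc k)" for k
    using f unfolding N_def L2_closure_def by simp
  then obtain s where s: "\<And>k. s k \<in> M" "\<And>k. s k \<in> Linf" "\<And>k. sqn (\<lambda>z. f z - s k z) < 1 / real (Suc k)"
    by (metis IntE)
  note [measurable] = LinfD[OF s(2)]
  \<comment> \<open>An essential bound for the fibre sum of \<open>norm (f z)\<close>; at this level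
    only the error \<open>f - s k\<close> enters the logarithm.\<close>
  define A where "A = real n * C"
  have A: "A > 0" using n C by (simp add: A_def)
  define S where "S k = rsum n (\<lambda>z. norm (s k z))" for k
  have [measurable]: "S k \<in> borel_measurable borel" for k unfolding S_def by measurable
  define V where "V k z = ln (max 1 (S k z / A))" for k z
  have [measurable]: "V k \<in> borel_measurable borel" for k unfolding V_def by measurable
  have Vpos: "0 \<le> V k z" for k z by (simp add: V_def)
  define T where "T k = rsum n (\<lambda>z. norm (f z - s k z))" for k
  define Q where "Q k = rsum n (\<lambda>z. (norm (f z - s k z))\<^sup>2)" for k
  have dL: "(\<lambda>z. f z - s k z) \<in> L2" for k by (intro L2_diff Linf_L2 fL s)
  have Qi: "integrable mT (Q k)" for k unfolding Q_def by (intro rsum_integrable n L2D(2) dL)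
  have QI: "(LINT z|mT. Q k z) = real n * sqn (\<lambda>z. f z - s k z)" for k
    unfolding Q_def using rsum_integral[OF n L2D(2)[OF dL[of k]]] by (simp add: sqn_def)
  have TQ: "(T k z)\<^sup>2 \<le> real n * Q k z" for k z
    unfolding T_def Q_def rsum_def
    using sum_squared_le_sum_of_squares[of "\<lambda>u. norm (f (u * z) - s k (u * z))" "{u::complex. u ^ n = 1}"] n
    by (simp add: card_roots_unity_eq mult.commute)
  have VT: "AE z in mT. (V k z)\<^sup>2 \<le> (real n / A\<^sup>2) * Q k z" for k
    using AE_roots[OF n C(2)]
  proof eventually_elim
    case (elim z)
    have T0: "0 \<le> T k z" unfolding T_def rsum_def by (intro sum_nonneg) auto
    have "S k z \<le> (\<Sum>u\<in>{u::complex. u ^ n = 1}. C + norm (f (u * z) - s k (u * z)))"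
      unfolding S_def rsum_def
    proof (rule sum_mono)
      fix u :: complex assume "u \<in> {u. u ^ n = 1}"
      then have "norm (f (u * z)) \<le> C" using elim by blast
      then show "norm (s k (u * z)) \<le> C + norm (f (u * z) - s k (u * z))"
        using norm_triangle_sub[of "s k (u * z)" "f (u * z)"] by (simp add: norm_minus_commute)
    qed
    also have "\<dots> = A + T k z" using n by (simp add: sum.distrib card_roots_unity_eq A_def T_def rsum_def)
    finally have "S k z / A \<le> (A + T k z) / A" using A by (intro divide_right_mono) auto
    also have "\<dots> = 1 + T k z / A" using A by (simp add: add_divide_distrib)
    finally have "max 1 (S k z / A) \<le> 1 + T k z / A" using T0 A by simp
    \<comment> \<open>This makes the weight at most linear in the error, so that the integral of its
      square is controlled by the squared L2 distance of \<open>s k\<close> from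
      \<open>f\<close>.\<close>
    moreover have "V k z \<le> max 1 (S k z / A) - 1" unfolding V_def by (rule ln_le_minus_one) simp
    ultimately have "V k z \<le> T k z / A" by linarith
    then have "(V k z)\<^sup>2 \<le> (T k z / A)\<^sup>2" using Vpos by (intro power_mono) auto
    also have "\<dots> = (T k z)\<^sup>2 / A\<^sup>2" by (simp add: power_divide)
    also have "\<dots> \<le> (real n * Q k z) / A\<^sup>2" by (intro divide_right_mono TQ) simp
    finally show ?case by simp
  qed
  have bi: "integrable mT (\<lambda>z. (real n / A\<^sup>2) * Q k z)" for k by (rule integrable_mult_right[OF Qi])
  have Vi: "integrable mT (\<lambda>z. (V k z)\<^sup>2)" for k
  proof (rule Bochner_Integration.integrable_bound[OF bi])
    show "AE z in mT. norm ((V k z)\<^sup>2) \<le> norm ((real n / A\<^sup>2) * Q k z)"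
      using VT[of k] by eventually_elim (simp only: real_norm_def abs_power2 order_trans[OF _ abs_ge_self])
  qed measurable
  define B where "B = (real n)\<^sup>2 / A\<^sup>2"
  have Vle: "(LINT z|mT. (V k z)\<^sup>2) \<le> B * (1 / real (Suc k))" for k
  proof -
    have "(LINT z|mT. (V k z)\<^sup>2) \<le> (LINT z|mT. (real n / A\<^sup>2) * Q k z)"
      by (rule integral_mono_AE[OF Vi bi VT])
    also have "\<dots> = B * sqn (\<lambda>z. f z - s k z)" by (simp add: QI B_def power2_eq_square)
    also have "\<dots> \<le> B * (1 / real (Suc k))" using s(3)[of k] by (intro mult_left_mono) (auto simp: B_def)
    finally show ?thesis .
  qed
  have "\<exists>H. H \<in> Linf \<and> (AE z in mT. norm (H z) \<le> 1) \<and> (AE z in mT. norm (H z * s k z) \<le> A) \<and>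
    (\<lambda>z. H z * s k z) \<in> M \<and> (LINT z|mT. norm (1 - H z)) \<le> sqrt (8 * (LINT z|mT. (V k z)\<^sup>2))" for k
    using Vi[of k] unfolding V_def S_def by (intro outer_truncation) (use s A in auto)
  then have "\<exists>H. \<forall>k. H k \<in> Linf \<and> (AE z in mT. norm (H k z) \<le> 1) \<and> (AE z in mT. norm (H k z * s k z) \<le> A) \<and>
    (\<lambda>z. H k z * s k z) \<in> M \<and> (LINT z|mT. norm (1 - H k z)) \<le> sqrt (8 * (LINT z|mT. (V k z)\<^sup>2))"
    by (intro choice allI)
  then obtain H where HL: "\<And>k. H k \<in> Linf"
    and Hle: "\<And>k. AE z in mT. norm (H k z) \<le> 1"
    and HsA: "\<And>k. AE z in mT. norm (H k z * s k z) \<le> A"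
    and HM: "\<And>k. (\<lambda>z. H k z * s k z) \<in> M"
    and H1: "\<And>k. (LINT z|mT. norm (1 - H k z)) \<le> sqrt (8 * (LINT z|mT. (V k z)\<^sup>2))" by auto
  note [measurable] = LinfD[OF HL]
  define d where "d k z = f z - H k z * s k z" for k z
  have [measurable]: "d k \<in> borel_measurable borel" for k unfolding d_def by measurable
  have db: "AE z in mT. norm (d k z) \<le> C + A" for k
    using HsA[of k] C(2)
  proof eventually_elim
    case (elim z) then show ?case unfolding d_def using norm_triangle_ineq4[of "f z" "H k z * s k z"] by linarith
  qed
  have dLi: "d k \<in> Linf" for k by (rule LinfI[OF _ db]) measurable
  have oL: "(\<lambda>z. 1 - H k z) \<in> L2" for k by (intro Linf_L2 Linf_diff HL Linf_const)
  have "(\<lambda>k. LINT z|mT. norm (d k z)) \<longlonglongrightarrow> 0"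
  proof (rule tendsto_sandwich[OF _ _ tendsto_const])
    have "(\<lambda>k. sqrt (1 / real (Suc k)) + C * sqrt (8 * (B * (1 / real (Suc k))))) \<longlonglongrightarrow> sqrt 0 + C * sqrt (8 * (B * 0))"
      by (intro tendsto_intros LIMSEQ_Suc[OF lim_1_over_n])
    then show "(\<lambda>k. sqrt (1 / real (Suc k)) + C * sqrt (8 * (B * (1 / real (Suc k))))) \<longlonglongrightarrow> 0" by simp
    show "\<forall>\<^sub>F k in sequentially. (LINT z|mT. norm (d k z)) \<le> sqrt (1 / real (Suc k)) + C * sqrt (8 * (B * (1 / real (Suc k))))"
    proof (intro always_eventually allI)
      fix k
      have i1: "integrable mT (\<lambda>z. norm (f z - s k z))" by (intro integrable_norm L2_integrable dL)
      have i2: "integrable mT (\<lambda>z. norm (1 - H k z))" by (intro integrable_norm L2_integrable oL)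
      have "(LINT z|mT. norm (d k z)) \<le> (LINT z|mT. norm (f z - s k z) + C * norm (1 - H k z))"
      proof (rule integral_mono_AE)
        show "integrable mT (\<lambda>z. norm (d k z))" by (intro integrable_norm L2_integrable Linf_L2 dLi)
        show "integrable mT (\<lambda>z. norm (f z - s k z) + C * norm (1 - H k z))"
          by (intro Bochner_Integration.integrable_add integrable_mult_right i1 i2)
        show "AE z in mT. norm (d k z) \<le> norm (f z - s k z) + C * norm (1 - H k z)"
          using Hle[of k] C(2)
        proof eventually_elim
          case (elim z)
          \<comment> \<open>Each error term is paired with a bounded factor: \<open>H k\<close> by 1
            and \<open>f\<close> by \<open>C\<close>.\<close>
          have "d k z = H k z * (f z - s k z) + f z * (1 - H k z)" by (simp add: d_def algebra_simps)
          then have "norm (d k z) \<le> norm (H k z) * norm (f z - s k z) + norm (f z) * norm (1 - H k z)"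
            by (metis norm_mult norm_triangle_ineq)
          also have "\<dots> \<le> 1 * norm (f z - s k z) + C * norm (1 - H k z)"
            using elim by (intro add_mono mult_right_mono) auto
          finally show ?case by simp
        qed
      qed
      also have "\<dots> = (LINT z|mT. norm (f z - s k z)) + C * (LINT z|mT. norm (1 - H k z))" using i1 i2 by simp
      also have "\<dots> \<le> sqrt (1 / real (Suc k)) + C * sqrt (8 * (B * (1 / real (Suc k))))"
      proof (intro add_mono mult_left_mono)
        show "(LINT z|mT. norm (f z - s k z)) \<le> sqrt (1 / real (Suc k))"
          using s(3)[of k] by (intro order_trans[OF integral_norm_le_sqn[OF dL]] real_sqrt_le_mono) simp
        show "(LINT z|mT. norm (1 - H k z)) \<le> sqrt (8 * (B * (1 / real (Suc k))))"
          using Vle[of k] by (intro order_trans[OF H1] real_sqrt_le_mono) simp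
      qed (use C in simp)
      finally show "(LINT z|mT. norm (d k z)) \<le> sqrt (1 / real (Suc k)) + C * sqrt (8 * (B * (1 / real (Suc k))))" .
    qed
  qed auto
  then have "(\<lambda>k. \<alpha> (d k)) \<longlonglongrightarrow> 0" by (rule alpha_bounded_convergence[OF _ db, rotated]) measurable
  then have "(\<lambda>k. ennreal (\<alpha> (d k))) \<longlonglongrightarrow> ennreal 0" by (intro tendsto_ennrealI)
  then have l1: "(\<lambda>k. alpha_ext \<alpha> (\<lambda>z. f z - H k z * s k z)) \<longlonglongrightarrow> 0"
    by (simp add: ext_Linf[OF dLi, symmetric]) (simp add: d_def[abs_def])
  show ?thesis by (rule M_closed_seq[OF _ HM l1]) measurable
qed

section \<open>Orthonormal families of wandering vectors\<close>

definition W :: "(complex \<Rightarrow> complex) set" where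
  "W = {f \<in> N. \<forall>g\<in>N. ip f (\<lambda>z. z ^ n * g z) = 0}"

text \<open>Only entries below \<open>r\<close> matter, so a family is enlarged by overwriting entry
  \<open>r\<close> of the same function.\<close>

definition orthonormal_in_W :: "nat \<Rightarrow> (nat \<Rightarrow> complex \<Rightarrow> complex) \<Rightarrow> bool" where
  "orthonormal_in_W r J \<longleftrightarrow> (\<forall>i<r. J i \<in> W) \<and> (\<forall>i<r. \<forall>j<r. ip (J i) (J j) = (if i = j then 1 else 0))"

lemma W_N: "f \<in> W \<Longrightarrow> f \<in> N" and W_L2: "f \<in> W \<Longrightarrow> f \<in> L2"
  by (auto simp: W_def N_L2)

text \<open>\<open>N\<close> is invariant, so all but one of the \<open>k\<close> shifts can be
  absorbed into \<open>g\<close>.\<close>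

lemma W_orth:
  assumes "f \<in> W" "g \<in> N" "k \<ge> 1"
  shows "ip f (\<lambda>z. z ^ (n * k) * g z) = 0"
proof -
  obtain m where k: "k = Suc m" using assms(3) by (cases k) auto
  have "ip f (\<lambda>z. z ^ n * (z ^ (n * m) * g z)) = 0"
    using assms(1) N_mult_power[OF assms(2), of m] by (simp add: W_def)
  then show ?thesis by (simp add: k power_add mult.assoc)
qed

text \<open>Wandering vectors are orthogonal to all proper shifts of elements of \<open>N\<close>.
  Applied to \<open>J j\<close> this kills the moments of \<open>J i * cnj (J j)\<close> against
  \<open>z ^ (n * k)\<close>, applied to \<open>J i\<close> those against the conjugate powers; the
  moment of order 0 is the given inner product.\<close>

lemma orthonormal_rsum:
  assumes J: "orthonormal_in_W r J" and ij: "i < r" "j < r"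
  shows "AE z in mT. rsum n (\<lambda>z. J i z * cnj (J j z)) z = (if i = j then of_nat n else 0)"
proof -
  define c :: complex where "c = (if i = j then 1 else 0)"
  have W: "J i \<in> W" "J j \<in> W" and o: "ip (J i) (J j) = c"
    using J ij by (auto simp: orthonormal_in_W_def c_def)
  note L = W_L2[OF W(1)] W_L2[OF W(2)]
  have gi: "integrable mT (\<lambda>z. J i z * cnj (J j z))" by (rule L2_ip_integrable[OF L])
  have bz: "AE z in mT. norm (z ^ j) \<le> 1" "AE z in mT. norm (cnj z ^ j) \<le> 1" for j
    using AE_mT_norm by (auto simp: norm_power)
  have zero: "(LINT z|mT. (J i z * cnj (J j z) - c) * z ^ 0) = 0"
    using gi o by (simp add: ip_def)
  have "AE z in mT. rsum n (\<lambda>z. J i z * cnj (J j z) - c) z = 0"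
  proof (rule rsum_AE_zero[OF n])
    show "integrable mT (\<lambda>z. J i z * cnj (J j z) - c)" using gi by simp
    fix k
    have i1: "integrable mT (\<lambda>z. J i z * cnj (J j z) * z ^ (n * k))"
      by (rule integrable_mult_bounded[OF gi _ bz(1)]) measurable
    have i2: "integrable mT (\<lambda>z. J i z * cnj (J j z) * cnj z ^ (n * k))"
      by (rule integrable_mult_bounded[OF gi _ bz(2)]) measurable
    have i3: "integrable mT (\<lambda>z. c * z ^ (n * k))" "integrable mT (\<lambda>z. c * cnj z ^ (n * k))"
      using integrable_mult_bounded[OF _ _ bz(1), of "\<lambda>_. c"] integrable_mult_bounded[OF _ _ bz(2), of "\<lambda>_. c"] by auto
    show "(LINT z|mT. (J i z * cnj (J j z) - c) * z ^ (n * k)) = 0"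
    proof (cases "k = 0")
      case True then show ?thesis using zero by simp
    next
      case False
      have "(LINT z|mT. J i z * cnj (J j z) * z ^ (n * k)) = ip (\<lambda>z. z ^ (n * k) * J i z) (J j)"
        by (simp add: ip_def mult_ac)
      also have "\<dots> = cnj (ip (J j) (\<lambda>z. z ^ (n * k) * J i z))" by (rule ip_commute)
      also have "\<dots> = 0" using W_orth[OF W(2) W_N[OF W(1)], of k] False by simp
      finally show ?thesis
        using i1 i3 False n by (simp add: left_diff_distrib integral_mT_power)
    qed
    show "(LINT z|mT. (J i z * cnj (J j z) - c) * cnj z ^ (n * k)) = 0"
    proof (cases "k = 0")
      case True then show ?thesis using zero by simp
    next
      case False
      have "(LINT z|mT. J i z * cnj (J j z) * cnj z ^ (n * k)) = ip (J i) (\<lambda>z. z ^ (n * k) * J j z)"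
        by (simp add: ip_def mult_ac)
      also have "\<dots> = 0" using W_orth[OF W(1) W_N[OF W(2)], of k] False by simp
      finally have e: "(LINT z|mT. J i z * cnj (J j z) * cnj z ^ (n * k)) = 0" .
      have "(LINT z|mT. cnj z ^ (n * k)) = cnj (LINT z|mT. z ^ (n * k))"
        unfolding Bochner_Integration.integral_cnj[symmetric] by simp
      also have "\<dots> = 0" using False n by (simp add: integral_mT_power)
      finally show ?thesis using e i2 i3 by (simp add: left_diff_distrib)
    qed
  qed
  then show ?thesis
  proof eventually_elim
    case (elim z)
    then show ?case using rsum_const[OF n, of c z] unfolding rsum_diff by (auto simp: c_def)
  qed
qed

text \<open>For \<open>i = j\<close> the squared moduli over a fibre sum to \<open>n\<close>, and a
  single term is at most the sum.\<close>

lemma orthonormal_bounded: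
  assumes J: "orthonormal_in_W r J" and i: "i < r"
  shows "AE z in mT. norm (J i z) \<le> sqrt (real n)"
  using orthonormal_rsum[OF J i i]
proof eventually_elim
  case (elim z)
  have "rsum n (\<lambda>z. J i z * cnj (J i z)) z = of_real (rsum n (\<lambda>z. (norm (J i z))\<^sup>2) z)"
    unfolding rsum_def of_real_sum by (simp only: complex_norm_square)
  then have "complex_of_real (rsum n (\<lambda>z. (norm (J i z))\<^sup>2) z) = of_real (real n)" using elim by simp
  then have "rsum n (\<lambda>z. (norm (J i z))\<^sup>2) z = real n" unfolding of_real_eq_iff .
  then have "(norm (J i z))\<^sup>2 \<le> real n" using rsum_member_le[OF n, of "\<lambda>z. (norm (J i z))\<^sup>2" z] by simp
  then show ?case by (rule real_le_rsqrt)
qed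

lemma orthonormal_Linf:
  assumes J: "orthonormal_in_W r J" and i: "i < r"
  shows "J i \<in> Linf" "J i \<in> N" "J i \<in> M" "J i \<in> Hinf"
proof -
  have W: "J i \<in> W" using J i by (simp add: orthonormal_in_W_def)
  show L: "J i \<in> Linf" by (rule LinfI[OF L2D(1)[OF W_L2[OF W]] orthonormal_bounded[OF J i]])
  show N: "J i \<in> N" by (rule W_N[OF W])
  show M: "J i \<in> M" by (rule N_Linf_M[OF N L])
  show "J i \<in> Hinf" by (rule M_Linf_Hinf[OF M L])
qed

lemma orthonormal_n_inner:
  assumes J: "orthonormal_in_W r J" and i: "i < r"
  shows "n_inner n (J i)"
  unfolding n_inner_def
proof (intro conjI allI)
  show "J i \<in> Hinf" by (rule orthonormal_Linf[OF J i])
  have W: "J i \<in> W" and o: "ip (J i) (J i) = 1" using J i by (auto simp: orthonormal_in_W_def)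
  note [measurable] = L2D(1)[OF W_L2[OF W]]
  fix m k
  \<comment> \<open>The common factor \<open>z ^ (n * m)\<close> is unimodular and cancels, leaving
    the shift by the difference \<open>d\<close>.\<close>
  have le: "(LINT z|mT. (z ^ (n * m) * J i z) * cnj (z ^ (n * (m + d)) * J i z)) = (if d = 0 then 1 else 0)" for m d
  proof -
    have "(LINT z|mT. (z ^ (n * m) * J i z) * cnj (z ^ (n * (m + d)) * J i z)) = ip (J i) (\<lambda>z. z ^ (n * d) * J i z)"
      unfolding ip_def
    proof (rule integral_cong_AE)
      show "AE z in mT. (z ^ (n * m) * J i z) * cnj (z ^ (n * (m + d)) * J i z) = J i z * cnj (z ^ (n * d) * J i z)"
        using AE_mT_norm
      proof eventually_elim
        case (elim z)
        have "(z ^ (n * m) * J i z) * cnj (z ^ (n * (m + d)) * J i z) = (z * cnj z) ^ (n * m) * (J i z * cnj (z ^ (n * d) * J i z))"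
          by (simp add: power_add distrib_left power_mult_distrib mult_ac)
        then show ?case using circle_mult_cnj[OF elim] by simp
      qed
    qed measurable
    also have "\<dots> = (if d = 0 then 1 else 0)"
      using W_orth[OF W W_N[OF W], of d] o by (cases "d = 0") auto
    finally show ?thesis .
  qed
  show "(LINT z|mT. (z ^ (n * m) * J i z) * cnj (z ^ (n * k) * J i z)) = (if m = k then 1 else 0)"
  proof (cases "m \<le> k")
    case True
    then show ?thesis using le[of m "k - m"] by auto
  next
    case False
    have "(LINT z|mT. (z ^ (n * m) * J i z) * cnj (z ^ (n * k) * J i z))
      = cnj (LINT z|mT. (z ^ (n * k) * J i z) * cnj (z ^ (n * m) * J i z))"
      unfolding Bochner_Integration.integral_cnj[symmetric] by (simp add: mult_ac)
    then show ?thesis using le[of k "m - k"] False by auto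
  qed
qed

lemma orthonormal_AE_all:
  assumes J: "orthonormal_in_W r J"
  shows "AE z in mT. \<forall>i<r. \<forall>j<r. rsum n (\<lambda>z. J i z * cnj (J j z)) z = (if i = j then of_nat n else 0)"
proof -
  have "AE z in mT. \<forall>i\<in>{..<r}. \<forall>j\<in>{..<r}. rsum n (\<lambda>z. J i z * cnj (J j z)) z = (if i = j then of_nat n else 0)"
    by (intro AE_finite_allI orthonormal_rsum[OF J]) auto
  then show ?thesis by eventually_elim auto
qed

text \<open>Over a generic fibre the values of the \<open>J i\<close> form \<open>r\<close>
  orthogonal vectors of squared length \<open>n\<close> in a space of dimension \<open>n\<close>;
  one such fibre suffices.\<close>

lemma orthonormal_card_le:
  assumes J: "orthonormal_in_W r J"
  shows "r \<le> n"
proof -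
  obtain z where z: "\<forall>i<r. \<forall>j<r. rsum n (\<lambda>z. J i z * cnj (J j z)) z = (if i = j then of_nat n else 0)"
    using AE_mT_ex[OF orthonormal_AE_all[OF J]] by blast
  show ?thesis
    by (rule orthogonal_family_card_le[of "{u::complex. u ^ n = 1}" n r "\<lambda>i u. J i (u * z)"])
       (use n z in \<open>auto simp: rsum_def card_roots_unity_eq intro: finite_roots_unity\<close>)
qed

text \<open>Multiplying by polynomials in \<open>z ^ n\<close> keeps \<open>J\<close> inside
  \<open>M\<close>. They approximate \<open>F (z ^ n)\<close> in L2, and the bounded factor
  \<open>J\<close> preserves this approximation, so closedness of \<open>N\<close> applies.\<close>

lemma mult_Hinf_zn_N:
  assumes J: "J \<in> N" "J \<in> Linf" and F: "F \<in> Hinf"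
  shows "(\<lambda>z. J z * F (z ^ n)) \<in> N" "(\<lambda>z. J z * F (z ^ n)) \<in> Linf"
proof -
  note [measurable] = LinfD[OF J(2)]
  have FL: "F \<in> Linf" using F by (simp add: Hinf_iff)
  note [measurable] = LinfD[OF FL]
  obtain C where C: "C > 0" "AE z in mT. norm (J z) \<le> C" using J(2) by (rule Linf_boundE)
  show L: "(\<lambda>z. J z * F (z ^ n)) \<in> Linf" by (intro Linf_mult J Linf_power FL n)
  have FC: "F \<in> L2_closure (range poly)"
    using F by (intro H2_poly_dense Linf_L2 FL) (auto simp: Hinf_iff)
  show "(\<lambda>z. J z * F (z ^ n)) \<in> N"
  proof (rule L2_closedD[OF N_closed Linf_L2[OF L]])
    fix e :: real assume e: "e > 0"
    then have "e / C\<^sup>2 > 0" using C by simp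
    then obtain q where q: "sqn (\<lambda>z. F z - poly q z) < e / C\<^sup>2"
      using FC unfolding L2_closure_def by (auto dest!: spec[of _ "e / C\<^sup>2"])
    have qL: "(\<lambda>z. poly q (z ^ n)) \<in> Linf" by (rule Linf_power[OF Linf_poly n])
    have "(\<lambda>z. poly q (z ^ n) * J z) \<in> M" by (rule M_poly[OF N_Linf_M[OF J]])
    moreover have "(\<lambda>z. poly q (z ^ n) * J z) \<in> Linf" by (intro Linf_mult qL J)
    ultimately have N: "(\<lambda>z. poly q (z ^ n) * J z) \<in> N" by (rule M_Linf_N)
    have "sqn (\<lambda>z. J z * (F (z ^ n) - poly q (z ^ n))) \<le> C\<^sup>2 * sqn (\<lambda>z. F (z ^ n) - poly q (z ^ n))"
      by (intro L2_mult_bounded(2) C Linf_L2 Linf_diff Linf_power FL n qL LinfD J)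
    also have "sqn (\<lambda>z. F (z ^ n) - poly q (z ^ n)) = sqn (\<lambda>z. F z - poly q z)"
      unfolding sqn_def by (rule integral_power[OF n]) measurable
    also have "C\<^sup>2 * sqn (\<lambda>z. F z - poly q z) < e" using q C by (simp add: field_simps)
    finally show "\<exists>g\<in>N. sqn (\<lambda>z. J z * F (z ^ n) - g z) < e"
      using N by (intro bexI[of _ "\<lambda>z. poly q (z ^ n) * J z"]) (auto simp: algebra_simps)
  qed
qed

text \<open>A fibre average is a function of \<open>z ^ n\<close>, and its moment of order
  \<open>j\<close> on the base circle is the moment of \<open>g\<close> of order
  \<open>n * j\<close>. Vanishing of the latter is thus exactly analyticity of the coefficient
  function.\<close>

lemma rsum_descends:
  assumes g: "g \<in> Linf" and an: "\<And>k. k \<ge> 1 \<Longrightarrow> (LINT z|mT. g z * z ^ (n * k)) = 0"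
  shows "\<exists>F\<in>Hinf. \<forall>z. norm z = 1 \<longrightarrow> F (z ^ n) = rsum n g z / of_nat n"
proof -
  note [measurable] = LinfD[OF g]
  define F where "F w = rsum n g (circle_root n w) / of_nat n" for w
  have [measurable]: "F \<in> borel_measurable borel" unfolding F_def by measurable
  have F: "F (z ^ n) = rsum n g z / of_nat n" if "norm z = 1" for z
    unfolding F_def using rsum_circle_root[OF n that] by metis
  have "rsum n g \<in> Linf"
    unfolding rsum_def[abs_def] by (intro Linf_sum Linf_rotate g) (auto intro: root_unity_norm[OF n])
  then obtain C where C: "C > 0" "AE z in mT. norm (rsum n g z) \<le> C" by (rule Linf_boundE)
  have "AE z in mT. norm (F (z ^ n)) \<le> C / real n"
    using C(2) AE_mT_norm by eventually_elim (use n in \<open>auto simp: F norm_divide divide_right_mono\<close>)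
  then have "AE w in mT. norm (F w) \<le> C / real n"
    by (subst (asm) AE_power_iff[OF n]) measurable
  then have FL: "F \<in> Linf" by (rule LinfI[rotated]) measurable
  have "(LINT w|mT. F w * w ^ j) = 0" if j: "j \<ge> 1" for j
  proof -
    have bz: "AE z in mT. norm (z ^ (n * j)) \<le> 1" using AE_mT_norm by eventually_elim (simp add: norm_power)
    have gi: "integrable mT (\<lambda>z. g z * z ^ (n * j))"
      by (rule integrable_mult_bounded[OF L2_integrable[OF Linf_L2[OF g]] _ bz]) measurable
    have "(LINT w|mT. F w * w ^ j) = (LINT z|mT. F (z ^ n) * (z ^ n) ^ j)"
      by (rule integral_power[OF n, symmetric]) measurable
    also have "\<dots> = (LINT z|mT. rsum n (\<lambda>z. g z * z ^ (n * j)) z / of_nat n)"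
    proof (rule integral_cong_AE)
      show "AE z in mT. F (z ^ n) * (z ^ n) ^ j = rsum n (\<lambda>z. g z * z ^ (n * j)) z / of_nat n"
        using AE_mT_norm
      proof eventually_elim
        case (elim z)
        show ?case using rsum_mult_power[of n g "\<lambda>w. w ^ j" z] F[OF elim] by (simp add: power_mult)
      qed
    qed measurable
    also have "\<dots> = (LINT z|mT. rsum n (\<lambda>z. g z * z ^ (n * j)) z) / of_nat n" by simp
    also have "\<dots> = 0" unfolding rsum_integral[OF n gi] an[OF j] by simp
    finally show ?thesis .
  qed
  then have "F \<in> Hinf" using FL by (simp add: Hinf_iff)
  then show ?thesis using F by blast
qed

lemma cnj_power_mult_cancel:
  "AE z in mT. cnj z ^ m * (z ^ m * f z) = f z" "AE z in mT. z ^ m * (cnj z ^ m * f z) = f z"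
proof -
  have *: "cnj z ^ m * (z ^ m * f z) = f z \<and> z ^ m * (cnj z ^ m * f z) = f z" if "norm z = 1" for z
  proof -
    have "(z * cnj z) ^ m * f z = f z" using circle_mult_cnj[OF that] by simp
    then show ?thesis by (simp add: power_mult_distrib mult_ac)
  qed
  show "AE z in mT. cnj z ^ m * (z ^ m * f z) = f z" using AE_mT_norm by eventually_elim (simp only: *)
  show "AE z in mT. z ^ m * (cnj z ^ m * f z) = f z" using AE_mT_norm by eventually_elim (simp only: *)
qed

lemma ip_cong_right:
  assumes "f \<in> borel_measurable borel" "g \<in> borel_measurable borel" "h \<in> borel_measurable borel" "AE z in mT. g z = h z"
  shows "ip f g = ip f h"
  unfolding ip_def
proof (rule integral_cong_AE)
  show "AE z in mT. f z * cnj (g z) = f z * cnj (h z)" using assms(4) by eventually_elim simp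
qed (use assms in auto)

text \<open>Dividing out the largest power of the shift and projecting off the shifted subspace
  yields a new vector of W.\<close>

lemma orthogonal_complement_trivial:
  assumes J: "orthonormal_in_W r J" and max: "\<And>J'. \<not> orthonormal_in_W (Suc r) J'"
    and f: "f \<in> N" and o: "\<And>i. i < r \<Longrightarrow> AE z in mT. rsum n (\<lambda>z. f z * cnj (J i z)) z = 0"
  shows "AE z in mT. f z = 0"
proof (cases "\<forall>k. (\<lambda>z. cnj z ^ (n * k) * f z) \<in> N")
  case True
  note [measurable] = L2D(1)[OF N_L2[OF f]]
  show ?thesis
  proof (rule AE_zero_of_moments[OF L2_integrable[OF N_L2[OF f]]])
    show neg: "(LINT z|mT. f z * cnj z ^ j) = 0" for j
    proof -
      \<comment> \<open>If \<open>f\<close> can be divided by \<open>z ^ n\<close> arbitrarily often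
        within \<open>N\<close>, dividing often enough turns any given coefficient of
        \<open>f\<close> into one that vanishes by analyticity; \<open>k = j + 1\<close> ensures
        \<open>n * k > j\<close>.\<close>
      define k where "k = Suc j"
      have "j < k * 1" by (simp add: k_def)
      also have "\<dots> \<le> k * n" using n by (intro mult_left_mono) auto
      finally obtain m where m: "n * k = m + j" "m \<ge> 1"
        by (metis add.commute less_imp_add_positive less_one linorder_not_less mult.commute not_less_zero)
      have "(LINT z|mT. f z * cnj z ^ j) = (LINT z|mT. (cnj z ^ (n * k) * f z) * z ^ m)"
      proof (rule integral_cong_AE)
        show "AE z in mT. f z * cnj z ^ j = (cnj z ^ (n * k) * f z) * z ^ m"
          using cnj_power_mult_cancel(1)[of m f]
        proof eventually_elim
          case (elim z)
          have "(cnj z ^ (n * k) * f z) * z ^ m = cnj z ^ j * (cnj z ^ m * (z ^ m * f z))"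
            unfolding m(1) power_add by (simp add: mult_ac)
          then show ?case unfolding elim by (simp only: mult.commute)
        qed
      qed measurable
      also have "\<dots> = 0" by (rule N_analytic[OF True[rule_format] m(2)])
      finally show ?thesis .
    qed
    show "(LINT z|mT. f z * z ^ j) = 0" for j
      using neg[of 0] N_analytic[OF f, of j] by (cases "j = 0") auto
  qed
next
  case False
  note fm [measurable] = L2D(1)[OF N_L2[OF f]]
  define Q where "Q k \<longleftrightarrow> (\<lambda>z. cnj z ^ (n * k) * f z) \<in> N" for k
  have "Q 0" using f by (simp add: Q_def)
  obtain k where k: "Q k" "\<not> Q (Suc k)"
  proof (rule ccontr)
    assume "\<not> thesis"
    then have "Q k \<Longrightarrow> Q (Suc k)" for k using that by blast
    then have "Q k" for k using \<open>Q 0\<close> by (induction k) auto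
    then show False using False by (simp add: Q_def)
  qed
  define g where "g z = cnj z ^ (n * k) * f z" for z
  have gN: "g \<in> N" using k(1) by (simp add: Q_def g_def[abs_def])
  have gL: "g \<in> L2" by (rule N_L2[OF gN])
  note [measurable] = L2D(1)[OF gL]
  \<comment> \<open>Up to null sets, \<open>Z\<close> is the shifted space \<open>z ^ n * N\<close>,
    described by division so that its closedness is inherited directly from
    \<open>N\<close>.\<close>
  define Z where "Z = {y \<in> L2. (\<lambda>z. cnj z ^ n * y z) \<in> N}"
  have cb: "AE z in mT. norm (cnj z ^ n) \<le> 1" "AE z in mT. norm (z ^ n) \<le> 1"
    using AE_mT_norm by (auto simp: norm_power)
  have Zsub: "L2_subspace Z"
    unfolding L2_subspace_def
  proof (intro conjI ballI allI)
    show "Z \<subseteq> L2" by (auto simp: Z_def)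
    show "(\<lambda>_. 0) \<in> Z" using L2_subspaceD(2)[OF N_subspace] by (simp add: Z_def)
    fix a b c assume a: "a \<in> Z"
    have "(\<lambda>z. c * (cnj z ^ n * a z)) \<in> N" using a by (intro N_scale) (simp add: Z_def)
    then show "(\<lambda>z. c * a z) \<in> Z" using a by (auto simp: Z_def mult_ac intro: L2_scale)
    assume b: "b \<in> Z"
    have "(\<lambda>z. cnj z ^ n * a z + cnj z ^ n * b z) \<in> N" using a b by (intro N_add) (auto simp: Z_def)
    then show "(\<lambda>z. a z + b z) \<in> Z" using a b by (auto simp: Z_def distrib_left intro: L2_add)
  qed
  have Zcl: "L2_closed Z"
    unfolding L2_closed_def
  proof (intro ballI impI)
    fix y assume y: "y \<in> L2" "\<forall>e>0. \<exists>g\<in>Z. sqn (\<lambda>z. y z - g z) < e"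
    have "(\<lambda>z. cnj z ^ n * y z) \<in> N"
    proof (rule L2_closedD[OF N_closed])
      show "(\<lambda>z. cnj z ^ n * y z) \<in> L2" by (rule L2_mult_bounded(1)[OF y(1) _ cb(1)]) measurable
      fix e :: real assume "e > 0"
      then obtain b where b: "b \<in> Z" "sqn (\<lambda>z. y z - b z) < e" using y(2) by blast
      have "sqn (\<lambda>z. cnj z ^ n * (y z - b z)) \<le> 1\<^sup>2 * sqn (\<lambda>z. y z - b z)"
        by (rule L2_mult_bounded(2)[OF L2_diff[OF y(1)] _ cb(1)]) (use b in \<open>auto simp: Z_def\<close>)
      then show "\<exists>h\<in>N. sqn (\<lambda>z. cnj z ^ n * y z - h z) < e"
        using b by (intro bexI[of _ "\<lambda>z. cnj z ^ n * b z"]) (auto simp: Z_def right_diff_distrib)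
    qed
    then show "y \<in> Z" using y(1) by (simp add: Z_def)
  qed
  obtain y where y: "y \<in> Z" and yo: "\<And>v. v \<in> Z \<Longrightarrow> ip (\<lambda>z. g z - y z) v = 0"
    using L2_projection[OF Zsub Zcl gL] by blast
  have yL: "y \<in> L2" and yZ: "(\<lambda>z. cnj z ^ n * y z) \<in> N" using y by (auto simp: Z_def)
  note [measurable] = L2D(1)[OF yL]
  have y': "AE z in mT. z ^ (n * 1) * (cnj z ^ n * y z) = y z"
    using cnj_power_mult_cancel(2)[of n y] by simp
  have yN: "y \<in> N"
    by (rule N_AE_cong[OF N_mult_power[OF yZ, of 1] _ y']) measurable
  define w where "w z = g z - y z" for z
  have wN: "w \<in> N" unfolding w_def[abs_def] by (rule N_diff[OF gN yN])
  have wL: "w \<in> L2" by (rule N_L2[OF wN])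
  have wW: "w \<in> W"
    unfolding W_def
  proof (intro CollectI conjI wN ballI)
    fix h assume h: "h \<in> N"
    note [measurable] = L2D(1)[OF N_L2[OF h]]
    have "(\<lambda>z. cnj z ^ n * (z ^ n * h z)) \<in> N"
    proof (rule N_AE_cong[OF h])
      show "AE z in mT. h z = cnj z ^ n * (z ^ n * h z)"
        using cnj_power_mult_cancel(1)[of n h] by eventually_elim simp
    qed measurable
    moreover have "(\<lambda>z. z ^ n * h z) \<in> L2" by (rule L2_mult_bounded(1)[OF N_L2[OF h] _ cb(2)]) measurable
    ultimately show "ip w (\<lambda>z. z ^ n * h z) = 0" unfolding w_def[abs_def] by (intro yo) (simp add: Z_def)
  qed
  \<comment> \<open>Were \<open>w\<close> zero, \<open>g\<close> would agree with \<open>y\<close>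
    in the shifted space, and one more factor \<open>z ^ n\<close> could be divided out of
    \<open>f\<close>.\<close>
  have w0: "sqn w \<noteq> 0"
  proof
    assume "sqn w = 0"
    then have "AE z in mT. w z = 0" using sqn_eq_0_iff[OF wL] by simp
    then have "AE z in mT. cnj z ^ n * y z = cnj z ^ (n * Suc k) * f z"
    proof eventually_elim
      case (elim z)
      have "n * Suc k = n + n * k" by simp
      then show ?case using elim by (simp only: power_add) (simp add: w_def g_def mult.assoc)
    qed
    then have "Q (Suc k)" unfolding Q_def by (intro N_AE_cong[OF yZ]) measurable
    then show False using k(2) by simp
  qed
  \<comment> \<open>\<open>y\<close> is a shift and \<open>J i\<close> is wandering. In
    \<open>g\<close> the factor \<open>cnj z ^ (n * k)\<close> is constant on fibres, so the fibre
    sum of \<open>g * cnj (J i)\<close> vanishes with that of \<open>f * cnj (J i)\<close>, and its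
    integral is \<open>n\<close> times the inner product.\<close>
  have wJ: "ip w (J i) = 0" if i: "i < r" for i
  proof -
    have JW: "J i \<in> W" using J i by (simp add: orthonormal_in_W_def)
    have JL: "J i \<in> L2" by (rule W_L2[OF JW])
    note [measurable] = L2D(1)[OF JL]
    have "ip (J i) y = ip (J i) (\<lambda>z. z ^ (n * 1) * (cnj z ^ n * y z))"
    proof (rule ip_cong_right)
      show "AE z in mT. y z = z ^ (n * 1) * (cnj z ^ n * y z)" using y' by eventually_elim simp
    qed measurable
    also have "\<dots> = 0" by (rule W_orth[OF JW yZ]) simp
    finally have y0: "ip y (J i) = 0" by (subst ip_commute) simp
    define G where "G z = f z * cnj (J i z) * cnj z ^ (n * k)" for z
    have bz: "AE z in mT. norm (cnj z ^ (n * k)) \<le> 1" using AE_mT_norm by eventually_elim (simp add: norm_power)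
    have Gi: "integrable mT G" unfolding G_def[abs_def]
      by (rule integrable_mult_bounded[OF L2_ip_integrable[OF N_L2[OF f] JL] _ bz]) measurable
    have G0: "AE z in mT. rsum n G z = 0"
      using o[OF i]
    proof eventually_elim
      case (elim z)
      then show ?case
        using rsum_mult_power[of n "\<lambda>z. f z * cnj (J i z)" "\<lambda>w. cnj w ^ k" z] by (simp add: G_def[abs_def] power_mult)
    qed
    have "real n *\<^sub>R (LINT z|mT. G z) = (LINT z|mT. rsum n G z)" by (rule rsum_integral[OF n Gi, symmetric])
    also have "\<dots> = (LINT z|mT. 0)"
      using G0 Gi by (intro integral_cong_AE) (auto dest!: borel_measurable_integrable)
    finally have "(LINT z|mT. G z) = 0" using n by simp
    moreover have "ip g (J i) = (LINT z|mT. G z)" by (simp add: ip_def g_def G_def mult_ac)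
    ultimately show ?thesis unfolding w_def[abs_def] using y0 by (simp add: ip_diff_left[OF gL yL JL])
  qed
  define c where "c = complex_of_real (1 / sqrt (sqn w))"
  define J' where "J' = J(r := (\<lambda>z. c * w z))"
  have "orthonormal_in_W (Suc r) J'"
    unfolding orthonormal_in_W_def
  proof (intro conjI allI impI)
    have cW: "(\<lambda>z. c * w z) \<in> W"
      using wW N_scale[OF wN] by (auto simp: W_def ip_scale_left)
    show "J' i \<in> W" if "i < Suc r" for i
      using that J cW by (cases "i = r") (auto simp: J'_def orthonormal_in_W_def)
    have cc: "c * cnj c * complex_of_real (sqn w) = 1"
      using w0 sqn_nonneg[of w] by (simp add: c_def flip: of_real_mult)
    have ww: "ip (\<lambda>z. c * w z) (\<lambda>z. c * w z) = 1"
      unfolding ip_scale_left ip_scale_right ip_self using cc by (simp add: mult.assoc)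
    have wi: "ip (\<lambda>z. c * w z) (J i) = 0" "ip (J i) (\<lambda>z. c * w z) = 0" if "i < r" for i
      using wJ[OF that] ip_commute[of "J i" w] by (simp_all add: ip_scale_left ip_scale_right)
    show "ip (J' i) (J' j) = (if i = j then 1 else 0)" if "i < Suc r" "j < Suc r" for i j
      using that J ww wi by (cases "i = r"; cases "j = r") (auto simp: J'_def orthonormal_in_W_def)
  qed
  then show ?thesis using max by blast
qed

section \<open>Expansion in a maximal family and the decomposition of \<open>M\<close>\<close>

text \<open>Sizes of orthonormal families are bounded by \<open>n\<close> and the empty family has
  size 0, so some size is attained while its successor is not.\<close>

lemma exists_maximal_orthonormal:
  "\<exists>r J. orthonormal_in_W r J \<and> (\<forall>J'. \<not> orthonormal_in_W (Suc r) J')"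
proof -
  define P where "P r \<longleftrightarrow> (\<exists>J. orthonormal_in_W r J)" for r
  have "P 0" by (auto simp: P_def orthonormal_in_W_def)
  moreover have "\<not> P (Suc n)" using orthonormal_card_le unfolding P_def by fastforce
  ultimately obtain r where "P r" "\<not> P (Suc r)" by (metis nat_induct)
  then show ?thesis unfolding P_def by blast
qed

text \<open>The candidate expansion is subtracted from \<open>f\<close>. By orthogonality over
  fibres the remainder has vanishing fibre products with every \<open>J i\<close>, and maximality of
  the family leaves it no room in \<open>N\<close>. The sum stays finite because each
  \<open>F i\<close> collects all powers of \<open>z ^ n\<close> at once.\<close>

lemma wandering_expansion:
  assumes J: "orthonormal_in_W r J" and max: "\<And>J'. \<not> orthonormal_in_W (Suc r) J'"
    and f: "f \<in> M" "f \<in> Linf"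
  shows "\<exists>F. (\<forall>i<r. F i \<in> Hinf \<and> (\<forall>z. norm z = 1 \<longrightarrow> F i (z ^ n) = rsum n (\<lambda>z. f z * cnj (J i z)) z / of_nat n)) \<and>
    (AE z in mT. f z = (\<Sum>i<r. J i z * F i (z ^ n)))"
proof -
  note JL = orthonormal_Linf[OF J]
  have fN: "f \<in> N" by (rule M_Linf_N[OF f])
  note [measurable] = LinfD[OF f(2)]
  have "\<exists>F\<in>Hinf. \<forall>z. norm z = 1 \<longrightarrow> F (z ^ n) = rsum n (\<lambda>z. f z * cnj (J i z)) z / of_nat n" if i: "i < r" for i
  proof (rule rsum_descends)
    show "(\<lambda>z. f z * cnj (J i z)) \<in> Linf" by (intro Linf_mult f Linf_cnj JL i)
    fix k :: nat assume k: "k \<ge> 1"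
    have JW: "J i \<in> W" using J i by (simp add: orthonormal_in_W_def)
    have "(LINT z|mT. f z * cnj (J i z) * z ^ (n * k)) = ip (\<lambda>z. z ^ (n * k) * f z) (J i)"
      by (simp add: ip_def mult_ac)
    also have "\<dots> = cnj (ip (J i) (\<lambda>z. z ^ (n * k) * f z))" by (rule ip_commute)
    also have "\<dots> = 0" using W_orth[OF JW fN k] by simp
    finally show "(LINT z|mT. f z * cnj (J i z) * z ^ (n * k)) = 0" .
  qed
  then have "\<forall>i. \<exists>F. i < r \<longrightarrow> F \<in> Hinf \<and> (\<forall>z. norm z = 1 \<longrightarrow> F (z ^ n) = rsum n (\<lambda>z. f z * cnj (J i z)) z / of_nat n)"
    by blast
  from choice[OF this] obtain F where F: "\<And>i. i < r \<Longrightarrow> F i \<in> Hinf"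
    "\<And>i z. i < r \<Longrightarrow> norm z = 1 \<Longrightarrow> F i (z ^ n) = rsum n (\<lambda>z. f z * cnj (J i z)) z / of_nat n" by auto
  define f' where "f' z = f z - (\<Sum>i<r. J i z * F i (z ^ n))" for z
  have f'N: "f' \<in> N" unfolding f'_def[abs_def]
    by (intro N_diff fN L2_subspace_sum[OF N_subspace] mult_Hinf_zn_N JL F) auto
  have "AE z in mT. rsum n (\<lambda>z. f' z * cnj (J i z)) z = 0" if i: "i < r" for i
    using orthonormal_AE_all[OF J] AE_mT_norm
  proof eventually_elim
    case (elim z)
    have "rsum n (\<lambda>z. f' z * cnj (J i z)) z
      = rsum n (\<lambda>z. f z * cnj (J i z)) z - (\<Sum>j<r. rsum n (\<lambda>z. (J j z * cnj (J i z)) * F j (z ^ n)) z)"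
      unfolding rsum_sum[symmetric] rsum_diff[symmetric] f'_def left_diff_distrib sum_distrib_right
      by (simp add: mult_ac)
    also have "(\<Sum>j<r. rsum n (\<lambda>z. (J j z * cnj (J i z)) * F j (z ^ n)) z) = (\<Sum>j<r. (if j = i then of_nat n else 0) * F j (z ^ n))"
    proof (intro sum.cong refl)
      fix j assume "j \<in> {..<r}"
      then show "rsum n (\<lambda>z. (J j z * cnj (J i z)) * F j (z ^ n)) z = (if j = i then of_nat n else 0) * F j (z ^ n)"
        using rsum_mult_power[of n "\<lambda>z. J j z * cnj (J i z)" "F j" z] elim i by simp
    qed
    also have "\<dots> = of_nat n * F i (z ^ n)" using i by (simp add: if_distrib[of "\<lambda>x. x * _"] cong: if_cong)
    also have "\<dots> = rsum n (\<lambda>z. f z * cnj (J i z)) z" using F(2)[OF i elim(2)] n by simp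
    finally show ?case by simp
  qed
  from orthogonal_complement_trivial[OF J max f'N this]
  have "AE z in mT. f' z = 0" .
  then have "AE z in mT. f z = (\<Sum>i<r. J i z * F i (z ^ n))" by eventually_elim (simp add: f'_def)
  then show ?thesis using F by (intro exI[of _ F]) auto
qed

lemma Hinf_zn_subset: "Hinf_zn n \<subseteq> borel_measurable borel"
proof
  fix g assume "g \<in> Hinf_zn n"
  then obtain f where g: "g = (\<lambda>z. f (z ^ n))" and f: "f \<in> Hinf" by (auto simp: Hinf_zn_def)
  note [measurable] = subsetD[OF Hinf_subset(1) f]
  show "g \<in> borel_measurable borel" unfolding g by measurable
qed

text \<open>Rotation by a root of unity fixes every element of \<open>Hinf_zn n\<close> and does not
  increase the extended norm, so the invariance passes to the closure. Elements of the closure may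
  therefore be treated as constants on fibres.\<close>

lemma Malpha_rotate:
  assumes h: "h \<in> Malpha_zn \<alpha> n" and u: "u ^ n = 1"
  shows "AE z in mT. h (u * z) = h z"
proof -
  have hm [measurable]: "h \<in> borel_measurable borel" using h by (simp add: Malpha_zn_def alpha_closure_iff)
  have u1: "norm u = 1" by (rule root_unity_norm[OF n u])
  have "alpha_ext \<alpha> (\<lambda>z. h (u * z) - h z) \<le> 0 + ennreal e" if e: "e > 0" for e
  proof -
    obtain g where g: "g \<in> Hinf_zn n" "alpha_ext \<alpha> (\<lambda>z. h z - g z) \<le> ennreal (e/2)"
      using h e unfolding Malpha_zn_def alpha_closure_iff by (auto dest!: spec[of _ "e/2"])
    have [measurable]: "g \<in> borel_measurable borel" using g(1) Hinf_zn_subset by auto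
    have gu: "g (u * z) = g z" for z using g(1) u by (auto simp: Hinf_zn_def power_mult_distrib)
    have "alpha_ext \<alpha> (\<lambda>z. h (u * z) - h z) \<le> alpha_ext \<alpha> (\<lambda>z. h (u * z) - g (u * z)) + alpha_ext \<alpha> (\<lambda>z. g (u * z) - h z)"
      by (intro ext_triangle_diff) measurable
    also have "alpha_ext \<alpha> (\<lambda>z. h (u * z) - g (u * z)) \<le> alpha_ext \<alpha> (\<lambda>z. h z - g z)"
      by (rule ext_rotate[OF u1])
    also have "alpha_ext \<alpha> (\<lambda>z. g (u * z) - h z) = alpha_ext \<alpha> (\<lambda>z. h z - g z)"
      unfolding gu by (rule ext_diff_commute)
    also have "alpha_ext \<alpha> (\<lambda>z. h z - g z) + alpha_ext \<alpha> (\<lambda>z. h z - g z) \<le> ennreal (e/2) + ennreal (e/2)"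
      by (intro add_mono g)
    also have "\<dots> = ennreal e" using e by (simp add: ennreal_plus[symmetric] del: ennreal_plus)
    finally show ?thesis by (simp add: add_right_mono)
  qed
  then have "alpha_ext \<alpha> (\<lambda>z. h (u * z) - h z) \<le> 0" by (rule ennreal_le_epsilon)
  then have "AE z in mT. h (u * z) - h z = 0" by (intro ext_eq_0_imp_AE) auto
  then show ?thesis by eventually_elim simp
qed

lemma mult_Malpha_M:
  assumes J: "orthonormal_in_W r J" and i: "i < r" and h: "h \<in> Malpha_zn \<alpha> n"
  shows "(\<lambda>z. J i z * h z) \<in> M"
proof (rule M_closed)
  note JL = orthonormal_Linf[OF J i]
  note [measurable] = LinfD[OF JL(1)]
  have hm [measurable]: "h \<in> borel_measurable borel" using h by (simp add: Malpha_zn_def alpha_closure_iff)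
  show "(\<lambda>z. J i z * h z) \<in> borel_measurable borel" by measurable
  obtain C where C: "C > 0" "AE z in mT. norm (J i z) \<le> C" using JL(1) by (rule Linf_boundE)
  fix e :: real assume e: "e > 0"
  then have "e / C > 0" using C by simp
  then obtain g where g: "g \<in> Hinf_zn n" "alpha_ext \<alpha> (\<lambda>z. h z - g z) \<le> ennreal (e / C)"
    using h unfolding Malpha_zn_def alpha_closure_iff by blast
  then obtain F where F: "F \<in> Hinf" "g = (\<lambda>z. F (z ^ n))" by (auto simp: Hinf_zn_def)
  have "(\<lambda>z. J i z * g z) \<in> M"
    unfolding F(2) by (intro N_Linf_M mult_Hinf_zn_N JL F)
  moreover have "alpha_ext \<alpha> (\<lambda>z. J i z * (h z - g z)) \<le> ennreal C * alpha_ext \<alpha> (\<lambda>z. h z - g z)"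
    by (rule ext_mult_bounded[OF C])
  moreover have "ennreal C * alpha_ext \<alpha> (\<lambda>z. h z - g z) \<le> ennreal C * ennreal (e / C)"
    by (intro mult_left_mono g) simp
  moreover have "ennreal C * ennreal (e / C) = ennreal e" using C e by (simp add: ennreal_mult'[symmetric])
  ultimately show "\<exists>g\<in>M. alpha_ext \<alpha> (\<lambda>z. J i z * h z - g z) \<le> ennreal e"
    by (intro bexI[of _ "\<lambda>z. J i z * g z"]) (auto simp: right_diff_distrib)
qed

text \<open>Bounded approximants \<open>s\<close> of \<open>f\<close> have exact expansions with
  coefficients \<open>F i\<close>. The map from a function to its coefficients is bounded for the
  norm, so the \<open>F i\<close> approximate the \<open>g i\<close>; this puts \<open>g i\<close>
  into the closure and bounds the remainder of \<open>f\<close>.\<close>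

lemma M_coefficients:
  assumes J: "orthonormal_in_W r J" and max: "\<And>J'. \<not> orthonormal_in_W (Suc r) J'"
    and f: "f \<in> M"
  defines "g \<equiv> \<lambda>i z. rsum n (\<lambda>z. f z * cnj (J i z)) z / of_nat n"
  shows "\<And>i. i < r \<Longrightarrow> g i \<in> Malpha_zn \<alpha> n" "AE z in mT. f z = (\<Sum>i<r. J i z * g i z)"
proof -
  note JL = orthonormal_Linf[OF J]
  note Jm = LinfD[OF JL(1)]
  have fm [measurable]: "f \<in> borel_measurable borel" by (rule M_borel[OF f])
  have gm: "g i \<in> borel_measurable borel" if "i < r" for i
  proof -
    note [measurable] = Jm[OF that]
    show ?thesis unfolding g_def by measurable
  qed
  \<comment> \<open>The essential bound of the \<open>J i\<close>. The factor \<open>n\<close> from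
    summing over a fibre cancels against the averaging, so \<open>A\<close> also bounds the
    coefficient map.\<close>
  define A where "A = sqrt (real n)"
  have A: "A > 0" using n by (simp add: A_def)
  have approx: "\<exists>F. (\<forall>i<r. F i \<in> Hinf \<and> alpha_ext \<alpha> (\<lambda>z. g i z - F i (z ^ n)) \<le> ennreal (A * e)) \<and>
      alpha_ext \<alpha> (\<lambda>z. f z - (\<Sum>i<r. J i z * F i (z ^ n))) \<le> ennreal e" if e: "e > 0" for e
  proof -
    obtain s where s: "s \<in> M" "s \<in> Linf" "alpha_ext \<alpha> (\<lambda>z. f z - s z) \<le> ennreal e"
      using Linf_dense[OF f e] by auto
    note [measurable] = LinfD[OF s(2)]
    obtain F where F: "\<And>i. i < r \<Longrightarrow> F i \<in> Hinf"
      "\<And>i z. i < r \<Longrightarrow> norm z = 1 \<Longrightarrow> F i (z ^ n) = rsum n (\<lambda>z. s z * cnj (J i z)) z / of_nat n"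
      and sF: "AE z in mT. s z = (\<Sum>i<r. J i z * F i (z ^ n))"
      using wandering_expansion[OF J max s(1,2)] by auto
    have "alpha_ext \<alpha> (\<lambda>z. g i z - F i (z ^ n)) \<le> ennreal (A * e)" if i: "i < r" for i
    proof -
      note [measurable] = Jm[OF i]
      have "AE z in mT. norm (g i z - F i (z ^ n)) = norm (of_real (1 / real n) * rsum n (\<lambda>z. cnj (J i z) * (f z - s z)) z)"
        using AE_mT_norm
      proof eventually_elim
        case (elim z)
        have "rsum n (\<lambda>z. cnj (J i z) * (f z - s z)) z = rsum n (\<lambda>z. f z * cnj (J i z)) z - rsum n (\<lambda>z. s z * cnj (J i z)) z"
          unfolding rsum_diff[symmetric] by (simp add: algebra_simps)
        then show ?case unfolding g_def F(2)[OF i elim] by (simp add: diff_divide_distrib)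
      qed
      then have "alpha_ext \<alpha> (\<lambda>z. g i z - F i (z ^ n)) = alpha_ext \<alpha> (\<lambda>z. of_real (1 / real n) * rsum n (\<lambda>z. cnj (J i z) * (f z - s z)) z)"
        by (rule ext_cong)
      also have "\<dots> \<le> ennreal (1 / real n) * alpha_ext \<alpha> (rsum n (\<lambda>z. cnj (J i z) * (f z - s z)))"
        using n by (intro ext_mult_bounded) (auto simp: norm_divide)
      also have "\<dots> \<le> ennreal (1 / real n) * (of_nat n * alpha_ext \<alpha> (\<lambda>z. cnj (J i z) * (f z - s z)))"
        by (intro mult_left_mono ext_rsum n) auto
      also have "\<dots> \<le> ennreal (1 / real n) * (of_nat n * (ennreal A * alpha_ext \<alpha> (\<lambda>z. f z - s z)))"
        using orthonormal_bounded[OF J i] by (intro mult_left_mono ext_mult_bounded A) (auto simp: A_def)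
      also have "\<dots> \<le> ennreal (1 / real n) * (of_nat n * (ennreal A * ennreal e))"
        by (intro mult_left_mono s) auto
      also have "\<dots> = ennreal (1 / real n * (real n * (A * e)))"
      proof -
        have c: "0 \<le> 1 / real n" "0 \<le> real n" "0 \<le> A" using A by auto
        show ?thesis
          by (simp only: ennreal_of_nat_eq_real_of_nat ennreal_mult'[OF c(1)] ennreal_mult'[OF c(2)] ennreal_mult'[OF c(3)])
      qed
      also have "\<dots> = ennreal (A * e)" using n by simp
      finally show ?thesis .
    qed
    moreover have "alpha_ext \<alpha> (\<lambda>z. f z - (\<Sum>i<r. J i z * F i (z ^ n))) = alpha_ext \<alpha> (\<lambda>z. f z - s z)"
    proof (rule ext_cong)
      show "AE z in mT. norm (f z - (\<Sum>i<r. J i z * F i (z ^ n))) = norm (f z - s z)"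
        using sF by eventually_elim simp
    qed
    ultimately show ?thesis using F(1) s(3) by (intro exI[of _ F]) auto
  qed
  show "g i \<in> Malpha_zn \<alpha> n" if i: "i < r" for i
    unfolding Malpha_zn_def alpha_closure_iff
  proof (intro conjI allI impI)
    show "g i \<in> borel_measurable borel" by (rule gm[OF i])
    fix e :: real assume "e > 0"
    then obtain F where "F i \<in> Hinf" "alpha_ext \<alpha> (\<lambda>z. g i z - F i (z ^ n)) \<le> ennreal (A * (e / A))"
      using approx[of "e / A"] A i by auto
    then show "\<exists>h\<in>Hinf_zn n. alpha_ext \<alpha> (\<lambda>z. g i z - h z) \<le> ennreal e"
      using A by (intro bexI[of _ "\<lambda>z. F i (z ^ n)"]) (auto simp: Hinf_zn_def)
  qed
  define R where "R z = f z - (\<Sum>i<r. J i z * g i z)" for z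
  have Jg: "(\<lambda>z. J i z * h z) \<in> borel_measurable borel" if "i < r" "h \<in> borel_measurable borel" for i h
    using Jm[OF that(1)] that(2) by measurable
  have Rm: "R \<in> borel_measurable borel" unfolding R_def[abs_def]
    by (intro borel_measurable_diff borel_measurable_sum fm Jg gm) auto
  \<comment> \<open>One unit for replacing \<open>f\<close> by the approximating sum, and
    \<open>A * A\<close> for each of the \<open>r\<close> coefficients: one \<open>A\<close> from
    the coefficient map, one from multiplying by \<open>J i\<close>.\<close>
  define B where "B = 1 + real r * (A * A)"
  have B: "B > 0" using A by (simp add: B_def add_pos_nonneg)
  have "alpha_ext \<alpha> R \<le> 0 + ennreal e" if e: "e > 0" for e
  proof -
    define d where "d = e / B"
    have d: "d > 0" using e B by (simp add: d_def)
    obtain F where F: "\<And>i. i < r \<Longrightarrow> F i \<in> Hinf" "\<And>i. i < r \<Longrightarrow> alpha_ext \<alpha> (\<lambda>z. g i z - F i (z ^ n)) \<le> ennreal (A * d)"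
      and fF: "alpha_ext \<alpha> (\<lambda>z. f z - (\<Sum>i<r. J i z * F i (z ^ n))) \<le> ennreal d"
      using approx[OF d] by auto
    have Fm: "(\<lambda>z. F i (z ^ n)) \<in> borel_measurable borel" if "i < r" for i
      using Hinf_zn_subset F(1)[OF that] by (auto simp: Hinf_zn_def)
    have JF: "(\<lambda>z. \<Sum>i<r. J i z * F i (z ^ n)) \<in> borel_measurable borel"
      "(\<lambda>z. \<Sum>i<r. J i z * g i z) \<in> borel_measurable borel"
      by (intro borel_measurable_sum Jg Fm gm; simp)+
    have "alpha_ext \<alpha> R \<le> alpha_ext \<alpha> (\<lambda>z. f z - (\<Sum>i<r. J i z * F i (z ^ n)))
        + alpha_ext \<alpha> (\<lambda>z. (\<Sum>i<r. J i z * F i (z ^ n)) - (\<Sum>i<r. J i z * g i z))"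
      unfolding R_def[abs_def] by (intro ext_triangle_diff fm JF)
    also have "alpha_ext \<alpha> (\<lambda>z. (\<Sum>i<r. J i z * F i (z ^ n)) - (\<Sum>i<r. J i z * g i z))
        = alpha_ext \<alpha> (\<lambda>z. \<Sum>i<r. J i z * (g i z - F i (z ^ n)))"
      by (rule ext_cong) (simp add: norm_minus_commute right_diff_distrib sum_subtractf)
    also have "\<dots> \<le> (\<Sum>i<r. alpha_ext \<alpha> (\<lambda>z. J i z * (g i z - F i (z ^ n))))"
      by (intro ext_sum_le Jg borel_measurable_diff gm Fm) auto
    also have "\<dots> \<le> (\<Sum>i<r. ennreal (A * (A * d)))"
    proof (rule sum_mono)
      fix i assume "i \<in> {..<r}"
      then have i: "i < r" by simp
      have "alpha_ext \<alpha> (\<lambda>z. J i z * (g i z - F i (z ^ n))) \<le> ennreal A * alpha_ext \<alpha> (\<lambda>z. g i z - F i (z ^ n))"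
        using orthonormal_bounded[OF J i] by (intro ext_mult_bounded A) (simp add: A_def)
      also have "\<dots> \<le> ennreal A * ennreal (A * d)" by (intro mult_left_mono F i) simp
      also have "\<dots> = ennreal (A * (A * d))" using A d by (simp add: ennreal_mult')
      finally show "alpha_ext \<alpha> (\<lambda>z. J i z * (g i z - F i (z ^ n))) \<le> ennreal (A * (A * d))" .
    qed
    also have "\<dots> = ennreal (real r * (A * (A * d)))"
      using A d by (simp add: ennreal_mult' ennreal_of_nat_eq_real_of_nat)
    finally have "alpha_ext \<alpha> R \<le> ennreal d + ennreal (real r * (A * (A * d)))"
      using fF by (meson add_mono order_refl order_trans)
    also have "\<dots> = ennreal (d + real r * (A * (A * d)))" using A d by (intro ennreal_plus[symmetric]) auto
    also have "d + real r * (A * (A * d)) = d * B" by (simp add: B_def algebra_simps)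
    also have "d * B = e" using B by (simp add: d_def)
    finally show ?thesis by simp
  qed
  then have "alpha_ext \<alpha> R \<le> 0" by (rule ennreal_le_epsilon)
  then have "AE z in mT. R z = 0" by (intro ext_eq_0_imp_AE Rm) simp
  then show "AE z in mT. f z = (\<Sum>i<r. J i z * g i z)" by eventually_elim (simp add: R_def)
qed

text \<open>Multiplying a vanishing sum by \<open>cnj (J i)\<close> and summing over a fibre
  isolates \<open>n * h i\<close>, because the factors \<open>h j\<close> are constant on fibres and
  the \<open>J j\<close> are orthogonal there.\<close>

lemma direct_sum_J:
  assumes J: "orthonormal_in_W r J"
  shows "direct_sum r (\<lambda>i. mult_set (J i) (Malpha_zn \<alpha> n))"
  unfolding direct_sum_def
proof (intro allI impI, elim conjE)
  fix g i assume g: "\<forall>i<r. g i \<in> mult_set (J i) (Malpha_zn \<alpha> n)" and z: "AE z in mT. (\<Sum>i<r. g i z) = 0" and i: "i < r"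
  have "\<forall>i. \<exists>h. i < r \<longrightarrow> h \<in> Malpha_zn \<alpha> n \<and> g i = (\<lambda>z. J i z * h z)"
    using g unfolding mult_set_def by blast
  from choice[OF this] obtain h where h: "\<And>i. i < r \<Longrightarrow> h i \<in> Malpha_zn \<alpha> n"
    "\<And>i. i < r \<Longrightarrow> g i = (\<lambda>z. J i z * h i z)" by auto
  have "AE z in mT. \<forall>j\<in>{..<r}. \<forall>u\<in>{u. u ^ n = 1}. h j (u * z) = h j z"
    using n h by (intro AE_finite_allI Malpha_rotate) (auto intro: finite_roots_unity)
  then show "AE z in mT. g i z = 0"
    using orthonormal_AE_all[OF J] AE_roots[OF n z]
  proof eventually_elim
    case (elim z)
    have "0 = (\<Sum>u\<in>{u::complex. u ^ n = 1}. (\<Sum>j<r. g j (u * z)) * cnj (J i (u * z)))" using elim(3) by simp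
    also have "\<dots> = (\<Sum>u\<in>{u::complex. u ^ n = 1}. \<Sum>j<r. (J j (u * z) * cnj (J i (u * z))) * h j z)"
      unfolding sum_distrib_right
    proof (intro sum.cong refl)
      fix u :: complex and j assume "u \<in> {u. u ^ n = 1}" "j \<in> {..<r}"
      then have "g j (u * z) = J j (u * z) * h j z" using elim(1) h(2)[of j] by auto
      then show "g j (u * z) * cnj (J i (u * z)) = J j (u * z) * cnj (J i (u * z)) * h j z" by (simp add: mult_ac)
    qed
    also have "\<dots> = (\<Sum>j<r. rsum n (\<lambda>z. J j z * cnj (J i z)) z * h j z)"
      unfolding rsum_def sum_distrib_right by (rule sum.swap)
    also have "\<dots> = (\<Sum>j<r. (if j = i then of_nat n else 0) * h j z)"
      using elim(2) i by (intro sum.cong refl) auto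
    also have "\<dots> = of_nat n * h i z" using i by (simp add: if_distrib[of "\<lambda>x. x * _"] cong: if_cong)
    finally have "h i z = 0" using n by simp
    then show ?case using h(2)[OF i] by simp
  qed
qed

lemma invariant_subspace_decomposition:
  "\<exists>r J. r \<le> n \<and> (\<forall>i<r. n_inner n (J i)) \<and>
     M = sum_subspaces r (\<lambda>i. mult_set (J i) (Malpha_zn \<alpha> n)) \<and>
     direct_sum r (\<lambda>i. mult_set (J i) (Malpha_zn \<alpha> n))"
proof -
  obtain r J where J: "orthonormal_in_W r J" and max: "\<And>J'. \<not> orthonormal_in_W (Suc r) J'"
    using exists_maximal_orthonormal by blast
  have "M = sum_subspaces r (\<lambda>i. mult_set (J i) (Malpha_zn \<alpha> n))"
  proof (intro subset_antisym subsetI)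
    fix f assume f: "f \<in> M"
    define g where "g i z = rsum n (\<lambda>z. f z * cnj (J i z)) z / of_nat n" for i z
    have "\<forall>i<r. (\<lambda>z. J i z * g i z) \<in> mult_set (J i) (Malpha_zn \<alpha> n)"
    proof (intro allI impI)
      fix i assume i: "i < r"
      have "g i \<in> Malpha_zn \<alpha> n" using M_coefficients(1)[OF J max f i] by (simp add: g_def[abs_def])
      then show "(\<lambda>z. J i z * g i z) \<in> mult_set (J i) (Malpha_zn \<alpha> n)"
        unfolding mult_set_def by (intro CollectI exI[of _ "g i"]) simp
    qed
    moreover have "AE z in mT. f z = (\<Sum>i<r. J i z * g i z)"
      using M_coefficients(2)[OF J max f] unfolding g_def .
    ultimately show "f \<in> sum_subspaces r (\<lambda>i. mult_set (J i) (Malpha_zn \<alpha> n))"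
      unfolding sum_subspaces_def using M_borel[OF f] by (intro CollectI conjI exI[of _ "\<lambda>i z. J i z * g i z"]) auto
  next
    fix f assume "f \<in> sum_subspaces r (\<lambda>i. mult_set (J i) (Malpha_zn \<alpha> n))"
    then obtain g where fm: "f \<in> borel_measurable borel" and g: "\<forall>i<r. g i \<in> mult_set (J i) (Malpha_zn \<alpha> n)"
      and fg: "AE z in mT. f z = (\<Sum>i<r. g i z)"
      unfolding sum_subspaces_def by auto
    have "g i \<in> M" if "i < r" for i
      using g that mult_Malpha_M[OF J that] unfolding mult_set_def by auto
    then have "(\<lambda>z. \<Sum>i<r. g i z) \<in> M" by (intro M_sum) auto
    then show "f \<in> M" by (rule M_AE_cong[OF _ fm]) (use fg in eventually_elim, simp)
  qed
  then show ?thesis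
    using orthonormal_card_le[OF J] orthonormal_n_inner[OF J] direct_sum_J[OF J]
    by (intro exI[of _ r] exI[of _ J]) auto
qed

end

theorem theorem4p6:
  fixes \<alpha> :: "(complex \<Rightarrow> complex) \<Rightarrow> real" and n :: nat
    and M :: "(complex \<Rightarrow> complex) set"
  assumes "rot_sym_norm \<alpha>" and "continuous_norm \<alpha>" and "n \<ge> 1"
    and "closed_invariant_subspace \<alpha> n M"
  shows "\<exists>r J. r \<le> n \<and> (\<forall>i<r. n_inner n (J i)) \<and>
           M = sum_subspaces r (\<lambda>i. mult_set (J i) (Malpha_zn \<alpha> n)) \<and>
           direct_sum r (\<lambda>i. mult_set (J i) (Malpha_zn \<alpha> n))"
proof -
  interpret invariant_subspace \<alpha> n M
    using assms by unfold_locales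
  show ?thesis by (rule invariant_subspace_decomposition)
qed

end
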